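(* The assignment $$X^-(u)\mapsto e_{-1,0}(u),\qquad X^+(u)\mapsto f_{0,-1}(u),\qquad H(u)\mapsto k_{-1}^{-1}(u)k_0(u)$$ (i.e. $x^-_k\mapsto e^{(k+1)}_{-1,0}$, $x^+_k\mapsto f^{(k+1)}_{0,-1}$, and $h_k\mapsto$ the coefficient of $u^{-k-1}$ in $k_{-1}^{-1}(u)k_0(u)$) extends to an algebra isomorphism $\Phi: Y(\mathfrak{so}_3)\to Y_R(\mathfrak{so}_3)$. Its inverse is determined by $e_{-1,0}(u)\mapsto X^-(u)$, $f_{0,-1}(u)\mapsto X^+(u)$, $k_{-1}(u)\mapsto H^{-1}(u-\frac12)$.
   Context: Let $e_{ij}$ ($i,j\in\{-1,0,1\}$) be the matrix units of $\mathrm{End}\,\mathbb{C}^3$, with rows and columns indexed by $-1,0,1$. Let $P=\sum_{i,j}e_{ij}\otimes e_{ji}$, $Q=\sum_{i,j}e_{ij}\otimes e_{-i,-j}$ and $R(u)=1-\frac{P}{u}+\frac{Q}{u-\frac12}$. Let $t$ be the transposition on $\mathrm{End}\,\mathbb{C}^3$ given by $(e_{ij})^t=e_{-j,-i}$. The algebra $Y_R(\mathfrak{so}_3)$ is the unital associative algebra over $\mathbb{C}$ generated by elements $t_{ij}^{(r)}$, $r\ge 1$, $i,j\in\{-1,0,1\}$; put $t_{ij}(u)=\delta_{ij}+\sum_{r\ge1}t^{(r)}_{ij}u^{-r}$, $T(u)=\sum_{i,j}t_{ij}(u)\otimes e_{ij}$, $T^t(u)=\sum_{i,j}t_{ij}(u)\otimes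 e_{-j,-i}$, $T_1(u)=\sum t_{ij}(u)\otimes e_{ij}\otimes 1$, $T_2(v)=\sum t_{ij}(v)\otimes 1\otimes e_{ij}$. The defining relations are $R(u-v)T_1(u)T_2(v)=T_2(v)T_1(u)R(u-v)$ and $T(u)T^t(u+\frac12)=T^t(u+\frac12)T(u)=1$. The Gauss generators are the unique series $k_i(u)\in 1+u^{-1}Y_R(\mathfrak{so}_3)[[u^{-1}]]$ ($i=-1,0,1$) and $e_{ij}(u),f_{ji}(u)\in u^{-1}Y_R(\mathfrak{so}_3)[[u^{-1}]]$ ($-1\le i<j\le1$) such that $T(u)=F(u)K(u)E(u)$, where $F(u)$ is the lower unitriangular matrix with below-diagonal entries $F_{0,-1}=f_{0,-1}(u)$, $F_{1,-1}=f_{1,-1}(u)$, $F_{1,0}=f_{1,0}(u)$, $K(u)=\mathrm{diag}(k_{-1}(u),k_0(u),k_1(u))$, and $E(u)$ is the upper unitriangular matrix with above-diagonal entries $E_{-1,0}=e_{-1,0}(u)$, $E_{-1,1}=e_{-1,1}(u)$, $E_{0,1}=e_{01}(u)$ (rows/columns indexed by $-1,0,1$); write $e_{-1,0}(u)=\sum_{r\ge1}e^{(r)}_{-1,0}u^{-r}$, $f_{0,-1}(u)=\sum_{r\ge1}f^{(r)}_{0,-1}u^{-r}$. $Y(\mathfrak{so}_3)$ (Drinfeld's new realization) is the unital associative algebra over $\mathbb{C}$ generated by $h_l, x^{\pm}_l$, $l=0,1,2,\dots$, subject to the relations, for all $k,l\ge0$: $[h_k,h_l]=0$, $[x^+_k,x^-_l]=h_{k+l}$,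 $[h_0,x^{\pm}_l]=\pm x^{\pm}_l$, $[h_{k+1},x^{\pm}_l]-[h_k,x^{\pm}_{l+1}]=\pm\frac12\{h_k,x^{\pm}_l\}$, $[x^{\pm}_{k+1},x^{\pm}_l]-[x^{\pm}_k,x^{\pm}_{l+1}]=\pm\frac12\{x^{\pm}_k,x^{\pm}_l\}$, where $\{a,b\}=ab+ba$. Generating series: $X^{\pm}(u)=\sum_{k\ge0}x^{\pm}_k u^{-k-1}$, $H(u)=1+\sum_{k\ge0}h_k u^{-k-1}$. *)

theory Defs
  imports Complex_Main "HOL-Library.Poly_Mapping" "HOL-Algebra.QuotRing"
begin

text \<open>Words in an alphabet, with concatenation as (non-commutative) monoid addition.
  The free associative unital C-algebra on generators of type 'g is then the
  algebra of finitely supported functions from words to C (convolution product).\<close>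

datatype 'g word = Word "'g list"

instantiation word :: (type) monoid_add
begin
definition zero_word_def: "0 = Word []"
fun plus_word :: "'a word \<Rightarrow> 'a word \<Rightarrow> 'a word" where
  "plus_word (Word a) (Word b) = Word (a @ b)"
instance
proof
  fix a b c :: "'a word"
  show "a + b + c = a + (b + c)" by (cases a; cases b; cases c) simp
  show "0 + a = a" by (cases a) (simp add: zero_word_def)
  show "a + 0 = a" by (cases a) (simp add: zero_word_def)
qed
end

type_synonym 'g fa = "'g word \<Rightarrow>\<^sub>0 complex"

definition fa_gen :: "'g \<Rightarrow> 'g fa" where
  "fa_gen g = Poly_Mapping.single (Word [g]) 1"

definition fa_scal :: "complex \<Rightarrow> 'g fa" where
  "fa_scal c = Poly_Mapping.single 0 c"

definition fa_ring :: "'g fa ring" where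
  "fa_ring = \<lparr>carrier = UNIV, mult = (*), one = 1, zero = 0, add = (+)\<rparr>"

definition comm :: "'g fa \<Rightarrow> 'g fa \<Rightarrow> 'g fa" where
  "comm a b = a * b - b * a"

definition acomm :: "'g fa \<Rightarrow> 'g fa \<Rightarrow> 'g fa" where
  "acomm a b = a * b + b * a"

definition presented :: "'g fa set \<Rightarrow> 'g fa set ring" where
  "presented S = fa_ring Quot (genideal fa_ring S)"

definition cls :: "'g fa set \<Rightarrow> 'g fa \<Rightarrow> 'g fa set" where
  "cls S x = a_r_coset fa_ring (genideal fa_ring S) x"

datatype genY = GH nat | GXp nat | GXm nat

definition hY :: "nat \<Rightarrow> genY fa" where "hY k = fa_gen (GH k)"
definition xpY :: "nat \<Rightarrow> genY fa" where "xpY k = fa_gen (GXp k)"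
definition xmY :: "nat \<Rightarrow> genY fa" where "xmY k = fa_gen (GXm k)"

definition relsY :: "genY fa set" where
  "relsY =
     {comm (hY k) (hY l) | k l. True}
   \<union> {comm (xpY k) (xmY l) - hY (k + l) | k l. True}
   \<union> {comm (hY 0) (xpY l) - xpY l | l. True}
   \<union> {comm (hY 0) (xmY l) + xmY l | l. True}
   \<union> {comm (hY (k+1)) (xpY l) - comm (hY k) (xpY (l+1)) - fa_scal (1/2) * acomm (hY k) (xpY l) | k l. True}
   \<union> {comm (hY (k+1)) (xmY l) - comm (hY k) (xmY (l+1)) + fa_scal (1/2) * acomm (hY k) (xmY l) | k l. True}
   \<union> {comm (xpY (k+1)) (xpY l) - comm (xpY k) (xpY (l+1)) - fa_scal (1/2) * acomm (xpY k) (xpY l) | k l. True}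
   \<union> {comm (xmY (k+1)) (xmY l) - comm (xmY k) (xmY (l+1)) + fa_scal (1/2) * acomm (xmY k) (xmY l) | k l. True}"

definition YD :: "genY fa set ring" where "YD = presented relsY"

definition clsY :: "genY fa \<Rightarrow> genY fa set" where "clsY = cls relsY"

text \<open>Index set {-1,0,1}: Im = -1, I0 = 0, Ip = 1.\<close>
datatype idx3 = Im | I0 | Ip

definition idxs :: "idx3 set" where "idxs = {Im, I0, Ip}"

fun neg3 :: "idx3 \<Rightarrow> idx3" where
  "neg3 Im = Ip" | "neg3 I0 = I0" | "neg3 Ip = Im"

text \<open>Generator GT i j r stands for t_ij^(r+1).\<close>
datatype genR = GT idx3 idx3 nat

definition tR :: "idx3 \<Rightarrow> idx3 \<Rightarrow> nat \<Rightarrow> genR fa" where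
  "tR i j r = (if r = 0 then (if i = j then 1 else 0) else fa_gen (GT i j (r - 1)))"

text \<open>Entries of operators on C^3 (x) C^3, indexed by pairs: row (i,k), column (m,n).\<close>
definition IdM :: "idx3 \<times> idx3 \<Rightarrow> idx3 \<times> idx3 \<Rightarrow> complex" where
  "IdM ik mn = (if ik = mn then 1 else 0)"
definition PM :: "idx3 \<times> idx3 \<Rightarrow> idx3 \<times> idx3 \<Rightarrow> complex" where
  "PM ik mn = (if fst mn = snd ik \<and> snd mn = fst ik then 1 else 0)"
definition QM :: "idx3 \<times> idx3 \<Rightarrow> idx3 \<times> idx3 \<Rightarrow> complex" where
  "QM ik mn = (if snd ik = neg3 (fst ik) \<and> snd mn = neg3 (fst mn) then 1 else 0)"

text \<open>(u-v)(u-v-1/2) R(u-v) = sum over p q of u^p v^q MC p q.\<close>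
definition MC :: "nat \<Rightarrow> nat \<Rightarrow> idx3 \<times> idx3 \<Rightarrow> idx3 \<times> idx3 \<Rightarrow> complex" where
  "MC p q ik mn =
     (if (p, q) = (2, 0) then IdM ik mn
      else if (p, q) = (1, 1) then - 2 * IdM ik mn
      else if (p, q) = (0, 2) then IdM ik mn
      else if (p, q) = (1, 0) then - (1/2) * IdM ik mn - PM ik mn + QM ik mn
      else if (p, q) = (0, 1) then (1/2) * IdM ik mn + PM ik mn - QM ik mn
      else if (p, q) = (0, 0) then (1/2) * PM ik mn
      else 0)"

text \<open>Coefficient of u^a v^b, entry ((i,k),(j,l)), of
  (u-v)(u-v-1/2) [R(u-v) T_1(u) T_2(v) - T_2(v) T_1(u) R(u-v)].\<close>
definition rttRel :: "int \<Rightarrow> int \<Rightarrow> idx3 \<Rightarrow> idx3 \<Rightarrow> idx3 \<Rightarrow> idx3 \<Rightarrow> genR fa" where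
  "rttRel a b i k j l =
     (\<Sum>p\<in>{0..2::nat}. \<Sum>q\<in>{0..2::nat}.
        if a \<le> int p \<and> b \<le> int q then
          (\<Sum>m\<in>idxs. \<Sum>n\<in>idxs.
              fa_scal (MC p q (i, k) (m, n)) * tR m j (nat (int p - a)) * tR n l (nat (int q - b))
            - tR k n (nat (int q - b)) * tR i m (nat (int p - a)) * fa_scal (MC p q (m, n) (j, l)))
        else 0)"

text \<open>(u + 1/2)^(-s) = sum over n of cshift s n u^(-s-n).\<close>
definition cshift :: "nat \<Rightarrow> nat \<Rightarrow> complex" where
  "cshift s n = ((- of_nat s) gchoose n) * (1/2) ^ n"

text \<open>Coefficient of u^(-N), entry (i,j), of T(u) T^t(u+1/2) - 1 and of T^t(u+1/2) T(u) - 1.\<close>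
definition unitRel1 :: "nat \<Rightarrow> idx3 \<Rightarrow> idx3 \<Rightarrow> genR fa" where
  "unitRel1 N i j =
     (\<Sum>r\<in>{0..N}. \<Sum>s\<in>{0..N - r}. \<Sum>m\<in>idxs.
        fa_scal (cshift s (N - r - s)) * tR i m r * tR (neg3 j) (neg3 m) s)
     - (if N = 0 \<and> i = j then 1 else 0)"

definition unitRel2 :: "nat \<Rightarrow> idx3 \<Rightarrow> idx3 \<Rightarrow> genR fa" where
  "unitRel2 N i j =
     (\<Sum>r\<in>{0..N}. \<Sum>s\<in>{0..N - r}. \<Sum>m\<in>idxs.
        fa_scal (cshift s (N - r - s)) * tR (neg3 m) (neg3 i) s * tR m j r)
     - (if N = 0 \<and> i = j then 1 else 0)"

definition relsR :: "genR fa set" where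
  "relsR = {rttRel a b i k j l | a b i k j l. True}
         \<union> {unitRel1 N i j | N i j. True}
         \<union> {unitRel2 N i j | N i j. True}"

definition YR :: "genR fa set ring" where "YR = presented relsR"

definition clsR :: "genR fa \<Rightarrow> genR fa set" where "clsR = cls relsR"

definition tser :: "idx3 \<Rightarrow> idx3 \<Rightarrow> nat \<Rightarrow> genR fa set" where
  "tser i j r = clsR (tR i j r)"

text \<open>A series is represented by its coefficient sequence: a n is the coefficient of u^(-n).\<close>

definition ser_mult :: "('a, 'b) ring_scheme \<Rightarrow> (nat \<Rightarrow> 'a) \<Rightarrow> (nat \<Rightarrow> 'a) \<Rightarrow> nat \<Rightarrow> 'a" where
  "ser_mult R a b n = finsum R (\<lambda>j. a j \<otimes>\<^bsub>R\<^esub> b (n - j)) {..n}"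

definition ser_one :: "('a, 'b) ring_scheme \<Rightarrow> nat \<Rightarrow> 'a" where
  "ser_one R n = (if n = 0 then \<one>\<^bsub>R\<^esub> else \<zero>\<^bsub>R\<^esub>)"

definition ser_zero :: "('a, 'b) ring_scheme \<Rightarrow> nat \<Rightarrow> 'a" where
  "ser_zero R n = \<zero>\<^bsub>R\<^esub>"

definition ser_inv :: "('a, 'b) ring_scheme \<Rightarrow> (nat \<Rightarrow> 'a) \<Rightarrow> nat \<Rightarrow> 'a" where
  "ser_inv R a = (THE b. (\<forall>n. b n \<in> carrier R) \<and> ser_mult R b a = ser_one R \<and> ser_mult R a b = ser_one R)"

text \<open>Substitution u \<mapsto> u + c, where sc embeds the scalars into R:
  a(u+c) = sum_s a_s (u+c)^(-s) = sum_s sum_m a_s ((-s) choose m) c^m u^(-s-m).\<close>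
definition ser_shift :: "('a, 'b) ring_scheme \<Rightarrow> (complex \<Rightarrow> 'a) \<Rightarrow> complex \<Rightarrow> (nat \<Rightarrow> 'a) \<Rightarrow> nat \<Rightarrow> 'a" where
  "ser_shift R sc c a n = finsum R (\<lambda>s. sc (((- of_nat s) gchoose (n - s)) * c ^ (n - s)) \<otimes>\<^bsub>R\<^esub> a s) {..n}"

datatype gcomp = Km1 | K0 | K1 | Em10 | Em11 | E01 | F0m1 | F1m1 | F10

definition Fm :: "('a, 'b) ring_scheme \<Rightarrow> (gcomp \<Rightarrow> nat \<Rightarrow> 'a) \<Rightarrow> idx3 \<Rightarrow> idx3 \<Rightarrow> nat \<Rightarrow> 'a" where
  "Fm R g i m = (if i = m then ser_one R else
     (case (i, m) of (I0, Im) \<Rightarrow> g F0m1 | (Ip, Im) \<Rightarrow> g F1m1 | (Ip, I0) \<Rightarrow> g F10 | _ \<Rightarrow> ser_zero R))"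

definition Em :: "('a, 'b) ring_scheme \<Rightarrow> (gcomp \<Rightarrow> nat \<Rightarrow> 'a) \<Rightarrow> idx3 \<Rightarrow> idx3 \<Rightarrow> nat \<Rightarrow> 'a" where
  "Em R g m j = (if m = j then ser_one R else
     (case (m, j) of (Im, I0) \<Rightarrow> g Em10 | (Im, Ip) \<Rightarrow> g Em11 | (I0, Ip) \<Rightarrow> g E01 | _ \<Rightarrow> ser_zero R))"

definition Km :: "(gcomp \<Rightarrow> nat \<Rightarrow> 'a) \<Rightarrow> idx3 \<Rightarrow> nat \<Rightarrow> 'a" where
  "Km g m = (case m of Im \<Rightarrow> g Km1 | I0 \<Rightarrow> g K0 | Ip \<Rightarrow> g K1)"

definition is_gauss :: "('a, 'b) ring_scheme \<Rightarrow> (idx3 \<Rightarrow> idx3 \<Rightarrow> nat \<Rightarrow> 'a) \<Rightarrow> (gcomp \<Rightarrow> nat \<Rightarrow> 'a) \<Rightarrow> bool" where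
  "is_gauss R t g \<longleftrightarrow>
     (\<forall>c n. g c n \<in> carrier R)
   \<and> (\<forall>c \<in> {Km1, K0, K1}. g c 0 = \<one>\<^bsub>R\<^esub>)
   \<and> (\<forall>c \<in> {Em10, Em11, E01, F0m1, F1m1, F10}. g c 0 = \<zero>\<^bsub>R\<^esub>)
   \<and> (\<forall>i j. t i j = (\<lambda>n. finsum R (\<lambda>m. ser_mult R (ser_mult R (Fm R g i m) (Km g m)) (Em R g m j) n) idxs))"

definition gauss :: "('a, 'b) ring_scheme \<Rightarrow> (idx3 \<Rightarrow> idx3 \<Rightarrow> nat \<Rightarrow> 'a) \<Rightarrow> gcomp \<Rightarrow> nat \<Rightarrow> 'a" where
  "gauss R t = (THE g. is_gauss R t g)"

definition gR :: "gcomp \<Rightarrow> nat \<Rightarrow> genR fa set" where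
  "gR = gauss YR tser"

definition Hser :: "nat \<Rightarrow> genY fa set" where
  "Hser n = (if n = 0 then \<one>\<^bsub>YD\<^esub> else clsY (hY (n - 1)))"

end

(* Proof idea. Over any algebra, a 3x3 matrix T(u) of series satisfies the RTT and unitarity relations if and only if
   T = F K E with factors given by explicit formulas in a triple (e, f, H) satisfying the Drinfeld relations: k_{-1}(u) = H(u - 1/2)^{-1},
   k_0 = k_{-1} H, k_1 = H, e_{01}(u) = - e(u - 1/2), e_{-1,1} = - e^2 / 2, and likewise for f. This gives mutually inverse
   homomorphisms between the two algebras, without a Poincare-Birkhoff-Witt theorem.

   From T to (e, f, H): the 2x2 corner of T is of type gl_2, eliminating t_{-1,1} gives e_{-1,1} and the relation of
   e with itself, and unitarity determines the remaining factors; there k_0 = k_{-1}(u) k_{-1}(u + 1/2)^{-1} holds because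
   q(u) q(u - 1/2) = 1 forces q = 1.

   From (e, f, H) to T: T is equivariant under the zero modes of e and f. Equivariance reduces unitarity to four entries
   and the RTT relations to those involving t_{-1,-1}(u). Of these, five are verified directly and the others
   follow by crossing symmetry, T(v)^{-1} = T^t(v + 1/2). *)

theory Submission
  imports Defs "HOL-Computational_Algebra.Formal_Power_Series"
begin

text \<open>All computations take place in the type class \<open>calg\<close>; only at the end are
  the results carried over to the ring records \<open>YD\<close> and \<open>YR\<close>. Making a
  presented algebra a type of this class requires 0 \<noteq> 1, so both relation ideals must be
  known to be proper beforehand; this comes from the one-dimensional representation e = f = 0, H =
  1.

  Series in u^-1 and v^-1 cannot be divided by u - v, so every relation is multiplied out, and two
  operations replace the calculus of poles: \<open>lin_cancel\<close> removes a factor u - v + c,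
  and setting v = u + c (\<open>spec\<close>) kills such a factor and so isolates what would be a
  residue. Residues yield the relations at shifted arguments, the value -e^2/2 of e_(-1,1), and the
  boundary terms when coefficient relations are assembled into generating series.

  The shift 1/2 suits R: exchanging u and v and then shifting v by 1/2 exchanges, up to sign, the
  denominators u - v of P and u - v - 1/2 of Q. This is why conjugation by T(v)^-1 turns relations
  into relations.\<close>

unbundle fps_syntax

section \<open>Associative algebras over the complex numbers and coefficientwise maps of
  series\<close>

class calg = ring_1 +
  fixes sc :: "complex \<Rightarrow> 'a"
  assumes sc_add: "sc (c + d) = sc c + sc d"
    and sc_mult: "sc (c * d) = sc c * sc d"
    and sc_one [simp]: "sc 1 = 1"
    and sc_commute: "sc c * a = a * sc c"
begin

lemma sc_zero [simp]: "sc 0 = 0"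
  using sc_add[of 0 0] by simp

lemma sc_minus: "sc (- c) = - sc c"
  using sc_add[of c "- c"] by (simp add: eq_neg_iff_add_eq_0 add.commute)

lemma sc_diff: "sc (c - d) = sc c - sc d"
  using sc_add[of c "- d"] by (simp add: sc_minus)

lemma sc_sum: "sc (\<Sum>i\<in>A. f i) = (\<Sum>i\<in>A. sc (f i))"
  by (induction A rule: infinite_finite_induct) (auto simp: sc_add)

lemma sc_left_commute: "a * (sc c * b) = sc c * (a * b)"
  by (metis mult.assoc sc_commute)

lemma sc_mult_mult: "sc (c * d) * (a * b) = sc c * a * (sc d * b)"
  by (metis mult.assoc sc_commute sc_mult)

end

instantiation fps :: (calg) calg
begin
definition sc_fps :: "complex \<Rightarrow> 'a fps" where "sc_fps c = fps_const (sc c)"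
instance
proof
  show "sc c * a = a * sc c" for c and a :: "'a fps"
    by (rule fps_ext) (simp add: sc_fps_def sc_commute)
qed (simp_all add: sc_fps_def sc_add sc_mult)
end

lemma sc_fps_nth [simp]: "(sc c * a :: 'a::calg fps) $ n = sc c * a $ n"
  by (simp add: sc_fps_def)

definition calg_hom :: "('a::calg \<Rightarrow> 'b::calg) \<Rightarrow> bool" where
  "calg_hom f \<longleftrightarrow> (\<forall>a b. f (a + b) = f a + f b) \<and> (\<forall>a b. f (a * b) = f a * f b) \<and> (\<forall>c. f (sc c) = sc c)"

lemma calg_hom_add: "calg_hom f \<Longrightarrow> f (a + b) = f a + f b"
  and calg_hom_mult: "calg_hom f \<Longrightarrow> f (a * b) = f a * f b"
  and calg_hom_sc: "calg_hom f \<Longrightarrow> f (sc c) = sc c"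
  by (simp_all add: calg_hom_def)

lemma calg_hom_zero: "calg_hom f \<Longrightarrow> f 0 = 0"
  using calg_hom_sc[of f 0] by simp

lemma calg_hom_one: "calg_hom f \<Longrightarrow> f 1 = 1"
  using calg_hom_sc[of f 1] by simp

lemma calg_hom_minus: "calg_hom f \<Longrightarrow> f (- a) = - f a"
  using calg_hom_add[of f a "- a"] by (simp add: calg_hom_zero eq_neg_iff_add_eq_0 add.commute)

lemma calg_hom_diff: "calg_hom f \<Longrightarrow> f (a - b) = f a - f b"
  using calg_hom_add[of f a "- b"] by (simp add: calg_hom_minus)

lemma calg_hom_sum: "calg_hom f \<Longrightarrow> f (\<Sum>i\<in>A. g i) = (\<Sum>i\<in>A. f (g i))"
  by (induction A rule: infinite_finite_induct) (auto simp: calg_hom_add calg_hom_zero)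

lemmas calg_hom_simps =
  calg_hom_add calg_hom_mult calg_hom_sc calg_hom_zero calg_hom_one calg_hom_minus calg_hom_diff

lemma calg_hom_comp: "calg_hom f \<Longrightarrow> calg_hom g \<Longrightarrow> calg_hom (\<lambda>a. f (g a))"
  by (simp add: calg_hom_def)

definition fmap :: "('a \<Rightarrow> 'b) \<Rightarrow> 'a fps \<Rightarrow> 'b fps" where
  "fmap f a = Abs_fps (\<lambda>n. f (a $ n))"

lemma fmap_nth [simp]: "fmap f a $ n = f (a $ n)"
  by (simp add: fmap_def)

lemma calg_hom_fmap:
  assumes f: "calg_hom f" shows "calg_hom (fmap f)"
  by (simp add: calg_hom_def fps_eq_iff fps_mult_nth sc_fps_def calg_hom_simps[OF f] calg_hom_sum[OF f])

lemma calg_hom_fps_const: "calg_hom (fps_const :: 'a::calg \<Rightarrow> 'a fps)"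
  by (simp add: calg_hom_def sc_fps_def)

section \<open>Shift of the variable\<close>

text \<open>Series are in the variable \<open>u\<^sup>-\<^sup>1\<close>; \<open>shift c\<close> is the substitution \<open>u \<mapsto> u + c\<close>.\<close>

definition shift_coeff :: "complex \<Rightarrow> nat \<Rightarrow> nat \<Rightarrow> complex" where
  "shift_coeff c s m = ((- of_nat s) gchoose m) * c ^ m"

definition shift :: "complex \<Rightarrow> 'a::calg fps \<Rightarrow> 'a fps" where
  "shift c a = Abs_fps (\<lambda>n. \<Sum>s\<le>n. sc (shift_coeff c s (n - s)) * a $ s)"

lemma shift_nth: "shift c a $ n = (\<Sum>s\<le>n. sc (shift_coeff c s (n - s)) * a $ s)"
  by (simp add: shift_def)

lemma shift_nth_0 [simp]: "shift c a $ 0 = a $ 0"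
  by (simp add: shift_nth shift_coeff_def)

text \<open>Vandermonde convolution, that is (u + c)^(-s-t) = (u + c)^(-s) (u + c)^(-t); this is
  what makes \<open>shift\<close> multiplicative.\<close>

lemma shift_coeff_add:
  "shift_coeff c (s + t) m = (\<Sum>k\<le>m. shift_coeff c s k * shift_coeff c t (m - k))"
proof -
  have "shift_coeff c (s + t) m = ((- of_nat s + - of_nat t) gchoose m) * c ^ m"
    by (simp add: shift_coeff_def)
  also have "\<dots> = (\<Sum>k\<le>m. ((- of_nat s gchoose k) * (- of_nat t gchoose (m - k))) * (c ^ k * c ^ (m - k)))"
    unfolding gbinomial_Vandermonde[symmetric] sum_distrib_right atLeast0AtMost
    by (rule sum.cong) (simp_all flip: power_add)
  finally show ?thesis
    by (simp add: shift_coeff_def mult_ac)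
qed

lemma shift_mult: "shift c (a * b) = shift c a * shift c b"
proof (rule fps_ext)
  fix n
  let ?g = "shift_coeff c"
  have "shift c (a * b) $ n =
      (\<Sum>s\<le>n. \<Sum>i\<le>s. \<Sum>k\<le>n-s. sc (?g i k) * a $ i * (sc (?g (s - i) (n - s - k)) * b $ (s - i)))"
    unfolding shift_nth
  proof (rule sum.cong[OF refl])
    fix s assume "s \<in> {..n}"
    have *: "sc (?g s (n - s)) * (a $ i * b $ (s - i)) =
       (\<Sum>k\<le>n-s. sc (?g i k) * a $ i * (sc (?g (s - i) (n - s - k)) * b $ (s - i)))" if "i \<le> s" for i
      using shift_coeff_add[of c i "s - i" "n - s"] that
      by (simp add: sc_sum sum_distrib_right sc_mult_mult)
    show "sc (?g s (n - s)) * (a * b) $ s =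
      (\<Sum>i\<le>s. \<Sum>k\<le>n-s. sc (?g i k) * a $ i * (sc (?g (s - i) (n - s - k)) * b $ (s - i)))"
      by (simp add: fps_mult_nth sum_distrib_left atLeast0AtMost *)
  qed
  \<comment> \<open>With p = i + k and j = s - i the triple sum is regrouped by the degree p that
    the shifted first factor contributes.\<close>
  also have "\<dots> = (\<Sum>p\<le>n. \<Sum>i\<le>p. \<Sum>j\<le>n-p. sc (?g i (p - i)) * a $ i * (sc (?g j (n - p - j)) * b $ j))"
    unfolding sum.Sigma[OF finite_atMost ballI[OF finite_atMost]]
      sum.Sigma[OF finite_atMost ballI[OF finite_SigmaI[OF finite_atMost finite_atMost]]]
    by (rule sum.reindex_bij_witness[where i = "\<lambda>(p, i, j). (i + j, i, p - i)"
          and j = "\<lambda>(s, i, k). (i + k, i, s - i)"]) (auto simp: add.commute)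
  also have "\<dots> = (shift c a * shift c b) $ n"
    by (simp add: fps_mult_nth shift_nth atLeast0AtMost sum_product)
  finally show "shift c (a * b) $ n = (shift c a * shift c b) $ n" .
qed

lemma shift_fps_const [simp]: "shift c (fps_const a) = fps_const a"
  by (rule fps_ext) (auto simp: shift_nth shift_coeff_def gbinomial_0_left sum.delta if_distrib
      gbinomial_0(2) gr0_conv_Suc cong: if_cong)

lemma calg_hom_shift: "calg_hom (shift c)"
  unfolding calg_hom_def
  by (auto simp: shift_mult sc_fps_def)
     (auto simp: fps_eq_iff shift_nth distrib_left sum.distrib)

lemma shift_fmap:
  assumes f: "calg_hom f" shows "shift c (fmap f a) = fmap f (shift c a)"
  by (simp add: fps_eq_iff shift_nth calg_hom_simps[OF f] calg_hom_sum[OF f])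

lemma shift_coeff_shift:
  assumes "t \<le> n"
  shows "(\<Sum>s=t..n. shift_coeff c s (n - s) * shift_coeff d t (s - t)) = shift_coeff (c + d) t (n - t)"
proof -
  have "(\<Sum>s=t..n. shift_coeff c s (n - s) * shift_coeff d t (s - t))
     = (\<Sum>k\<le>n-t. shift_coeff c (t + k) (n - t - k) * shift_coeff d t k)"
    by (rule sum.reindex_bij_witness[where i = "\<lambda>k. t + k" and j = "\<lambda>s. s - t"]) (use assms in auto)
  also have "\<dots> = (\<Sum>k\<le>n-t. ((- of_nat t) gchoose (n - t)) * (of_nat (n - t choose k) * d ^ k * c ^ (n - t - k)))"
  proof (rule sum.cong[OF refl])
    fix k assume k: "k \<in> {..n - t}"
    \<comment> \<open>Trinomial revision splits off a factor independent of \<open>k\<close>; what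
      remains to be summed is the binomial expansion of (c + d)^(n - t).\<close>
    have "((- of_nat t :: complex) gchoose (n - t)) * of_nat (n - t choose k)
       = ((- of_nat t) gchoose k) * ((- of_nat (t + k)) gchoose (n - t - k))"
      using gbinomial_trinomial_revision[of k "n - t" "- of_nat t :: complex"] k
      by (simp add: binomial_gbinomial)
    then show "shift_coeff c (t + k) (n - t - k) * shift_coeff d t k
       = ((- of_nat t) gchoose (n - t)) * (of_nat (n - t choose k) * d ^ k * c ^ (n - t - k))"
      unfolding shift_coeff_def mult.assoc[symmetric] by (simp only: mult_ac)
  qed
  also have "\<dots> = shift_coeff (c + d) t (n - t)"
    by (simp add: shift_coeff_def add.commute[of c d] binomial_ring flip: sum_distrib_left)
  finally show ?thesis .
qed

lemma shift_shift: "shift c (shift d a) = shift (c + d) a"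
proof (rule fps_ext)
  fix n
  have "shift c (shift d a) $ n = (\<Sum>s\<le>n. \<Sum>t\<le>s. sc (shift_coeff c s (n - s) * shift_coeff d t (s - t)) * a $ t)"
    by (simp add: shift_nth sum_distrib_left sc_mult mult.assoc)
  also have "\<dots> = (\<Sum>t\<le>n. \<Sum>s=t..n. sc (shift_coeff c s (n - s) * shift_coeff d t (s - t)) * a $ t)"
    unfolding sum.Sigma[OF finite_atMost ballI[OF finite_atMost]]
      sum.Sigma[OF finite_atMost ballI[OF finite_atLeastAtMost]]
    by (rule sum.reindex_bij_witness[where i = "\<lambda>(t, s). (s, t)" and j = "\<lambda>(s, t). (t, s)"]) auto
  also have "\<dots> = shift (c + d) a $ n"
    unfolding shift_nth
    by (intro sum.cong refl) (simp add: shift_coeff_shift flip: sum_distrib_right sc_sum)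
  finally show "shift c (shift d a) $ n = shift (c + d) a $ n" .
qed

lemma shift_zero [simp]: "shift 0 a = a"
proof (rule fps_ext)
  fix n
  have "shift 0 a $ n = (\<Sum>s\<le>n. if s = n then a $ s else 0)"
    unfolding shift_nth by (rule sum.cong) (auto simp: shift_coeff_def power_0_left)
  then show "shift 0 a $ n = a $ n" by simp
qed

text \<open>The identity 1/(u + c) = u^-1 / (1 + c u^-1) with the denominator cleared; it governs
  how \<open>lin\<close> and \<open>ep\<close> change under a shift.\<close>

lemma shift_fps_X: "(1 + sc c * fps_X) * shift c fps_X = (fps_X :: 'a::calg fps)"
proof (rule fps_ext)
  fix n
  have *: "((-1) gchoose m) = ((-1) ^ m :: complex)" for m
    using gbinomial_minus[of "1::complex" m] by (simp add: binomial_gbinomial[symmetric])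
  have nth: "shift c fps_X $ n = (if n = 0 then 0 else sc ((- c) ^ (n - 1)) :: 'a)" for n
  proof -
    have "shift c fps_X $ n = (\<Sum>s\<le>n. if s = 1 then sc (shift_coeff c s (n - s)) else 0 :: 'a)"
      unfolding shift_nth by (rule sum.cong) (auto simp: fps_X_def)
    then show ?thesis by (auto simp: shift_coeff_def * simp flip: power_mult_distrib)
  qed
  show "((1 + sc c * fps_X) * shift c fps_X) $ n = (fps_X :: 'a fps) $ n"
    by (cases n; cases "n - 1") (auto simp: distrib_right mult.assoc nth sc_minus simp flip: sc_mult)
qed

section \<open>Inverses of series with constant term one\<close>

definition finv :: "'a::ring_1 fps \<Rightarrow> 'a fps" where
  "finv a = fps_left_inverse a 1"

lemma finv_left: "a $ 0 = 1 \<Longrightarrow> finv a * a = 1"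
  by (simp add: finv_def fps_left_inverse)

lemma finv_right: "a $ 0 = 1 \<Longrightarrow> a * finv a = 1"
  unfolding finv_def by (rule fps_right_inverse'[of 1 a 1]) auto

lemma finv_nth_0 [simp]: "finv a $ 0 = 1"
  by (simp add: finv_def)

lemma finv_unique: "a $ 0 = 1 \<Longrightarrow> b * a = 1 \<Longrightarrow> b = finv a"
  by (metis finv_right mult.assoc mult_1 mult_1_right)

lemma finv_finv: "a $ 0 = 1 \<Longrightarrow> finv (finv a) = a"
  by (metis finv_nth_0 finv_right finv_unique)

lemma finv_calg_hom:
  assumes f: "calg_hom f" and a: "a $ 0 = 1" and fa: "f a $ 0 = 1"
  shows "f (finv a) = finv (f a)"
  by (rule finv_unique[OF fa]) (simp add: finv_left[OF a] calg_hom_one[OF f] flip: calg_hom_mult[OF f])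

lemma finv_shift: "a $ 0 = 1 \<Longrightarrow> shift c (finv a) = finv (shift c a)"
  by (rule finv_calg_hom[OF calg_hom_shift]) auto

lemma finv_fmap: "calg_hom f \<Longrightarrow> a $ 0 = 1 \<Longrightarrow> fmap f (finv a) = finv (fmap f a)"
  by (rule finv_calg_hom[OF calg_hom_fmap]) (auto simp: calg_hom_one)

section \<open>Series in two variables\<close>

text \<open>In \<open>'a fps fps\<close> the coefficients are series in \<open>u\<^sup>-\<^sup>1\<close> and the outer variable is \<open>v\<^sup>-\<^sup>1\<close>. Relations
  that are polynomial in \<open>u - v\<close> are cleared of denominators: \<open>lin c\<close> stands for \<open>(u - v + c) / (u v)\<close>
  and \<open>ep\<close> for \<open>1 / (u v)\<close>.\<close>

definition embU :: "'a::calg fps \<Rightarrow> 'a fps fps" where "embU a = fps_const a"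
definition embV :: "'a::calg fps \<Rightarrow> 'a fps fps" where "embV a = fmap fps_const a"
definition diag :: "'a::calg fps fps \<Rightarrow> 'a fps" where "diag F = Abs_fps (\<lambda>n. \<Sum>i\<le>n. F $ i $ (n - i))"
definition swap :: "'a::calg fps fps \<Rightarrow> 'a fps fps" where "swap F = Abs_fps (\<lambda>i. Abs_fps (\<lambda>j. F $ j $ i))"
definition ep :: "'a::calg fps fps" where "ep = fps_X * fps_const fps_X"
definition lin :: "complex \<Rightarrow> 'a::calg fps fps" where "lin c = fps_X - fps_const fps_X + sc c * ep"

lemma calg_hom_embU: "calg_hom embU"
  using calg_hom_fps_const by (simp add: calg_hom_def embU_def)

lemma calg_hom_embV: "calg_hom embV"
  using calg_hom_fmap[OF calg_hom_fps_const] by (simp add: calg_hom_def embV_def)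

lemma diag_nth: "diag F $ n = (\<Sum>i\<le>n. F $ i $ (n - i))"
  by (simp add: diag_def)

lemma diag_mult: "diag (F * G) = diag F * diag G"
proof (rule fps_ext)
  fix n
  have "diag (F * G) $ n = (\<Sum>s\<le>n. \<Sum>i\<le>s. \<Sum>k\<le>n-s. F $ i $ k * G $ (s - i) $ (n - s - k))"
    by (simp add: diag_nth fps_mult_nth fps_sum_nth atLeast0AtMost)
  also have "\<dots> = (\<Sum>p\<le>n. \<Sum>i\<le>p. \<Sum>j\<le>n-p. F $ i $ (p - i) * G $ j $ (n - p - j))"
    unfolding sum.Sigma[OF finite_atMost ballI[OF finite_atMost]]
      sum.Sigma[OF finite_atMost ballI[OF finite_SigmaI[OF finite_atMost finite_atMost]]]
    by (rule sum.reindex_bij_witness[where i = "\<lambda>(p, i, j). (i + j, i, p - i)"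
          and j = "\<lambda>(s, i, k). (i + k, i, s - i)"]) (auto simp: add.commute)
  also have "\<dots> = (diag F * diag G) $ n"
    by (simp add: fps_mult_nth diag_nth atLeast0AtMost sum_product)
  finally show "diag (F * G) $ n = (diag F * diag G) $ n" .
qed

lemma diag_embU [simp]: "diag (embU a) = a"
proof (rule fps_ext)
  fix n
  have "diag (embU a) $ n = (\<Sum>i\<le>n. if i = 0 then a $ n else 0)"
    unfolding diag_nth embU_def by (rule sum.cong) auto
  then show "diag (embU a) $ n = a $ n" by simp
qed

lemma diag_embV [simp]: "diag (embV a) = a"
proof (rule fps_ext)
  fix n
  have "diag (embV a) $ n = (\<Sum>i\<le>n. if i = n then a $ i else 0)"
    unfolding diag_nth embV_def by (rule sum.cong) auto
  then show "diag (embV a) $ n = a $ n" by simp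
qed

lemma calg_hom_diag: "calg_hom diag"
  unfolding calg_hom_def
proof (intro conjI allI)
  show "diag (F + G) = diag F + diag G" for F G :: "'a fps fps"
    by (simp add: fps_eq_iff diag_nth sum.distrib)
  show "diag (sc c) = (sc c :: 'a fps)" for c
    using diag_embU[of "sc c :: 'a fps"] by (simp add: calg_hom_sc[OF calg_hom_embU])
qed (rule diag_mult)

lemma swap_embU [simp]: "swap (embU a) = embV a"
  by (simp add: fps_eq_iff swap_def embU_def embV_def)

lemma swap_embV [simp]: "swap (embV a) = embU a"
  by (simp add: fps_eq_iff swap_def embU_def embV_def)

lemma calg_hom_swap: "calg_hom swap"
  unfolding calg_hom_def
proof (intro conjI allI)
  show "swap (F + G) = swap F + swap G" for F G :: "'a fps fps"
    by (simp add: fps_eq_iff swap_def)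
  show "swap (F * G) = swap F * swap G" for F G :: "'a fps fps"
    by (auto simp: fps_eq_iff swap_def fps_mult_nth fps_sum_nth intro: sum.swap)
  show "swap (sc c) = (sc c :: 'a fps fps)" for c
    using swap_embU[of "sc c :: 'a fps"] by (simp add: calg_hom_sc[OF calg_hom_embU] calg_hom_sc[OF calg_hom_embV])
qed

lemma shift_embU [simp]: "shift c (embU a) = embU a"
  by (simp add: embU_def)

lemma shift_embV [simp]: "shift c (embV a) = embV (shift c a)"
  by (simp add: embV_def shift_fmap[OF calg_hom_fps_const])

context ring_1
begin

text \<open>Defined inside the class \<open>ring_1\<close>, so that it makes sense for the opposite
  multiplication as well.\<close>

definition central :: "'a \<Rightarrow> bool" where "central z \<longleftrightarrow> (\<forall>a. a * z = z * a)"

lemma centralD: "central z \<Longrightarrow> a * z = z * a"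
  by (simp add: central_def)

lemma centralD': "central z \<Longrightarrow> a * (z * b) = z * (a * b)"
  by (metis central_def mult_assoc)

lemmas centralC = centralD centralD'

end

lemma central_X: "central (fps_X :: 'a::calg fps)"
  by (simp add: central_def fps_mult_fps_X_commute)

lemma central_const: "central z \<Longrightarrow> central (fps_const z)"
  by (simp add: central_def fps_eq_iff)

lemma central_sc: "central (sc c :: 'a::calg)"
  by (simp add: central_def sc_commute)

lemma central_mult: "central a \<Longrightarrow> central b \<Longrightarrow> central (a * b)"
  by (metis central_def mult.assoc)

lemma central_add: "central a \<Longrightarrow> central b \<Longrightarrow> central (a + b)"
  by (simp add: central_def algebra_simps)

lemma central_diff: "central a \<Longrightarrow> central b \<Longrightarrow> central (a - b)"
  by (simp add: central_def algebra_simps)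

lemma central_ep: "central (ep :: 'a::calg fps fps)"
  unfolding ep_def by (intro central_mult central_X central_const)

lemma central_lin: "central (lin c :: 'a::calg fps fps)"
  unfolding lin_def by (intro central_add central_diff central_mult central_X central_const central_sc central_ep)

lemma X_cancel: "fps_X * a = fps_X * b \<Longrightarrow> a = (b :: 'a::calg fps)"
proof (rule fps_ext)
  fix n assume "fps_X * a = fps_X * b"
  then have "(fps_X * a) $ Suc n = (fps_X * b) $ Suc n" by simp
  then show "a $ n = b $ n" by simp
qed

text \<open>The coefficient of v^-n in \<open>lin c * F\<close> is -u^-1 F_n plus multiples of
  F_(n-1), so the coefficients F_n vanish one after another. This replaces division by u - v +
  c.\<close>

lemma lin_cancel_0:
  fixes F :: "'a::calg fps fps"
  assumes "lin c * F = 0" shows "F = 0"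
proof (rule fps_ext)
  have "sc c * ep = fps_X * fps_const (sc c * fps_X :: 'a fps)"
    by (simp add: ep_def flip: sc_left_commute) (simp add: sc_fps_def[where 'a = "'a fps"])
  then have "fps_X * F - fps_const fps_X * F + fps_X * (fps_const (sc c * fps_X) * F) = 0"
    using assms by (simp add: lin_def distrib_right left_diff_distrib mult.assoc)
  then have eq: "fps_X * F + fps_X * (fps_const (sc c * fps_X) * F) = fps_const fps_X * F"
    by (simp add: diff_add_eq)
  have "F $ n = 0" for n
  proof (induction n)
    case 0
    have "fps_X * F $ 0 = fps_X * 0" using arg_cong[OF eq, of "\<lambda>G. G $ 0"] by simp
    then show ?case by (rule X_cancel)
  next
    case (Suc n)
    have "fps_X * F $ Suc n = fps_X * 0" using arg_cong[OF eq, of "\<lambda>G. G $ Suc n"] Suc by simp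
    then show ?case by (rule X_cancel)
  qed
  then show "F $ n = 0 $ n" for n by simp
qed

lemma lin_cancel: "lin c * F = lin c * G \<Longrightarrow> F = (G :: 'a::calg fps fps)"
  using lin_cancel_0[of c "F - G"] by (simp add: algebra_simps)

lemma diag_ep: "diag ep = (fps_X * fps_X :: 'a::calg fps)"
proof -
  have "fps_X = (embV fps_X :: 'a fps fps)" by (simp add: embV_def fps_eq_iff fps_X_def)
  then show ?thesis unfolding ep_def diag_mult by (metis diag_embU diag_embV embU_def)
qed

lemma diag_lin: "diag (lin c) = (sc c * (fps_X * fps_X) :: 'a::calg fps)"
proof -
  have "fps_X = (embV fps_X :: 'a fps fps)" by (simp add: embV_def fps_eq_iff fps_X_def)
  then show ?thesis
    by (simp add: lin_def calg_hom_simps[OF calg_hom_diag] diag_ep)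
       (metis diag_embU diag_embV embU_def right_minus_eq)
qed

lemma swap_ep [simp]: "swap ep = (ep :: 'a::calg fps fps)"
  and swap_lin [simp]: "swap (lin c) = (- lin (- c) :: 'a::calg fps fps)"
proof -
  have V: "fps_X = (embV fps_X :: 'a fps fps)" by (simp add: embV_def fps_eq_iff fps_X_def)
  have 1: "swap fps_X = (fps_const fps_X :: 'a fps fps)" "swap (fps_const fps_X) = (fps_X :: 'a fps fps)"
    by (metis V swap_embV embU_def) (metis V swap_embU embU_def)
  show e: "swap ep = (ep :: 'a::calg fps fps)"
    by (simp add: ep_def calg_hom_mult[OF calg_hom_swap] 1 fps_mult_fps_X_commute)
  show "swap (lin c) = (- lin (- c) :: 'a::calg fps fps)"
    by (simp add: lin_def calg_hom_simps[OF calg_hom_swap] e 1 sc_minus)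
qed

lemma shift_ep: "(1 + sc c * fps_X) * shift c ep = (ep :: 'a::calg fps fps)"
  using shift_fps_X[of c, where 'a = "'a fps"] by (simp add: ep_def shift_mult flip: mult.assoc)

text \<open>Under v -> v + c the numerator u - v + d becomes u - v + d - c and 1/(u v) becomes 1/(u
  (v + c)); the factor 1 + c/v restores the denominator u v.\<close>

lemma shift_lin: "(1 + sc c * fps_X) * shift c (lin d) = (lin (d - c) :: 'a::calg fps fps)"
proof -
  have "(1 + sc c * fps_X) * shift c (lin d) =
     (1 + sc c * fps_X) * shift c fps_X - (1 + sc c * fps_X) * fps_const fps_X
      + sc d * ((1 + sc c * fps_X) * shift c (ep :: 'a fps fps))"
    by (simp add: lin_def calg_hom_simps[OF calg_hom_shift] right_diff_distrib distrib_left
        centralD'[OF central_sc[of d]])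
  also have "\<dots> = lin (d - c)"
    unfolding shift_fps_X shift_ep by (simp add: lin_def ep_def sc_diff algebra_simps)
  finally show ?thesis .
qed

lemma shift_rel:
  assumes "lin c * P = ep * (Q :: 'a::calg fps fps)"
  shows "lin (c - d) * shift d P = ep * shift d Q"
proof -
  have "(1 + sc d * fps_X) * shift d (lin c * P) = (1 + sc d * fps_X) * shift d (ep * Q)"
    using assms by simp
  then show ?thesis by (simp add: shift_mult shift_lin shift_ep flip: mult.assoc)
qed

lemma diag_rel:
  assumes "lin c * P = ep * (Q :: 'a::calg fps fps)"
  shows "sc c * diag P = diag Q"
proof -
  have "fps_X * (fps_X * (sc c * diag P)) = fps_X * (fps_X * diag Q)"
    using arg_cong[OF assms, of diag]
    by (simp add: diag_mult diag_lin diag_ep mult.assoc centralD'[OF central_sc])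
  then show ?thesis by (blast dest: X_cancel)
qed

lemma swap_rel:
  assumes "lin c * P = ep * (Q :: 'a::calg fps fps)"
  shows "lin (- c) * swap P = - (ep * swap Q)"
  using arg_cong[OF assms, of swap] by (simp add: calg_hom_mult[OF calg_hom_swap] minus_equation_iff)

section \<open>Identities in rings with central elements\<close>

context ring_1
begin

lemma left_cancel: "y * x = 1 \<Longrightarrow> x * a = x * b \<Longrightarrow> a = b"
  by (metis mult_assoc mult_1_left)

lemma commute_left: "x * y = y * x \<Longrightarrow> x * (y * z) = y * (x * z)"
  by (metis mult_assoc)

text \<open>In these identities \<open>d\<close>, \<open>p\<close>, \<open>q\<close>,
  \<open>r\<close> play the roles of \<open>lin 0\<close>, \<open>ep\<close>,
  \<open>lin (- 1/2)\<close>, \<open>lin (1/2)\<close>, and a last letter \<open>u\<close> or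
  \<open>v\<close> marks the variable. Stating them for ring elements allows their reuse in the
  opposite ring. Here \<open>raw\<close> is the RTT entry for k(u) and k(v) e(v); its common left
  factor k(v) cancels.\<close>

lemma KE_of_raw:
  assumes d: "central d" and p: "central p" and k: "kv' * kv = 1" "ku * kv = kv * ku"
    and raw: "d * (ku * (kv * ev) - kv * ev * ku) = p * (ku * (kv * ev) - kv * (ku * eu))"
  shows "d * (ku * ev - ev * ku) = p * (ku * (ev - eu))"
proof (rule left_cancel[OF k(1)])
  show "kv * (d * (ku * ev - ev * ku)) = kv * (p * (ku * (ev - eu)))"
    using raw by (simp add: commute_left[OF k(2)] centralD'[OF d] centralD'[OF p] algebra_simps)
qed

lemma raw_of_KE:
  assumes d: "central d" and p: "central p" and k: "ku * kv = kv * ku"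
    and KE: "d * (ku * ev - ev * ku) = p * (ku * (ev - eu))"
  shows "d * (ku * (kv * ev) - kv * ev * ku) = p * (ku * (kv * ev) - kv * (ku * eu))"
proof -
  have "kv * (d * (ku * ev - ev * ku)) = kv * (p * (ku * (ev - eu)))" using KE by simp
  then show ?thesis by (simp add: commute_left[OF k] centralD'[OF d] centralD'[OF p] algebra_simps)
qed

text \<open>The RTT entry for t_(-1,-1)(u) and t_(0,0)(v) differs from the commutator of k_(-1) and
  k_0 by a combination of \<open>KE\<close>, \<open>KF\<close> and the commutator of
  \<open>ku\<close> with \<open>kv\<close>.\<close>

lemma k1_k2_commute_of_raw:
  assumes d: "central d" and p: "central p" and k: "ku * kv = kv * ku"
    and KE: "d * (ku * ev - ev * ku) = p * (ku * (ev - eu))"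
    and KF: "d * (ku * fv - fv * ku) = p * ((fu - fv) * ku)"
  shows "d * (ku * (k2 + fv * kv * ev) - (k2 + fv * kv * ev) * ku) - p * (fu * ku * (kv * ev) - fv * kv * (ku * eu))
    = d * (ku * k2 - k2 * ku)"
proof -
  have "d * (ku * (k2 + fv * kv * ev) - (k2 + fv * kv * ev) * ku) - p * (fu * ku * (kv * ev) - fv * kv * (ku * eu))
    - d * (ku * k2 - k2 * ku)
    = (d * (ku * fv - fv * ku) - p * ((fu - fv) * ku)) * (kv * ev)
     + fv * (kv * (d * (ku * ev - ev * ku) - p * (ku * (ev - eu))))
     + d * (fv * ((ku * kv - kv * ku) * ev)) - p * (fv * ((ku * kv - kv * ku) * ev))"
    by (simp add: algebra_simps centralC[OF d, of ku] centralC[OF d, of kv] centralC[OF d, of fv] centralC[OF p, of ku] centralC[OF p, of kv] centralC[OF p, of fv])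
  then show ?thesis unfolding KE KF k by simp
qed

lemma EF_of_raw:
  assumes d: "central d" and p: "central p" and k: "ku * kv = kv * ku"
    and KE: "d * (ku * ev - ev * ku) = p * (ku * (ev - eu))"
    and KE': "d * (eu * kv - kv * eu) = p * (kv * (eu - ev))"
    and KF: "d * (ku * fv - fv * ku) = p * ((fu - fv) * ku)"
  shows "d * (d * (ku * (eu * fv - fv * eu) * kv) - p * (mu * kv - mv * ku))
    = d * (d * (ku * eu * (fv * kv) - fv * kv * (ku * eu)) - p * ((mu + fu * ku * eu) * kv - (mv + fv * kv * ev) * ku))"
proof -
  \<comment> \<open>The defects \<open>a\<close>, \<open>b\<close>, \<open>c\<close> vanish. Keeping
    them as ring elements turns the claim into an identity that needs only centrality and
    \<open>k\<close>, with explicit coefficients at the defects.\<close>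
  define a b c where "a = d * (ku * ev - ev * ku) - p * (ku * (ev - eu))"
    and "b = d * (eu * kv - kv * eu) - p * (kv * (eu - ev))"
    and "c = d * (ku * fv - fv * ku) - p * ((fu - fv) * ku)"
  have 0: "a = 0" "b = 0" "c = 0" by (simp_all add: a_def b_def c_def KE KE' KF)
  have "d * (d * (ku * (eu * fv - fv * eu) * kv) - p * (mu * kv - mv * ku))
    - d * (d * (ku * eu * (fv * kv) - fv * kv * (ku * eu)) - p * ((mu + fu * ku * eu) * kv - (mv + fv * kv * ev) * ku))
    = p * (fu * (ku * b)) + p * (fv * (kv * a)) - (d * fv + p * (fu - fv)) * (ku * b) - c * (d * (eu * kv))"
    unfolding a_def b_def c_def
    by (simp add: algebra_simps k commute_left[OF k] centralC[OF d, of ku] centralC[OF d, of kv] centralC[OF d, of fv] centralC[OF d, of fu] centralC[OF d, of eu] centralC[OF d, of ev] centralC[OF p, of ku] centralC[OF p, of kv] centralC[OF p, of fv] centralC[OF p, of fu] centralC[OF p, of eu] centralC[OF p, of ev] centralC[OF p, of d])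
  then show ?thesis unfolding 0 by simp
qed

text \<open>Each exchange of e or f with k in the other variable consumes a factor \<open>d\<close>,
  hence the excess factor \<open>d * d\<close> on both sides, to be removed by
  \<open>lin_cancel\<close>. The two forms of EF take care of the products of e and f.\<close>

lemma raw22_of_EF:
  assumes d: "central d" and p: "central p" and k: "ku * kv = kv * ku" and m: "mu * kv = kv * mu"
    and KE: "d * (ku * ev - ev * ku) = p * (ku * (ev - eu))"
    and KE': "d * (eu * kv - kv * eu) = p * (kv * (eu - ev))"
    and KF: "d * (ku * fv - fv * ku) = p * ((fu - fv) * ku)"
    and KF': "d * (fu * kv - kv * fu) = p * ((fv - fu) * kv)"
    and EF: "d * (ku * (eu * fv - fv * eu) * kv) = p * (mu * kv - mv * ku)"
    and EF': "d * (kv * (ev * fu - fu * ev) * ku) = p * (mu * kv - mv * ku)"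
  shows "d * (d * (d * ((mu + fu * ku * eu) * kv - kv * (mu + fu * ku * eu)))) =
    d * (d * (p * (ku * eu * (fv * kv) - kv * ev * (fu * ku))))"
proof -
  define a b c e x y where "a = d * (ku * ev - ev * ku) - p * (ku * (ev - eu))"
    and "b = d * (eu * kv - kv * eu) - p * (kv * (eu - ev))"
    and "c = d * (ku * fv - fv * ku) - p * ((fu - fv) * ku)"
    and "e = d * (fu * kv - kv * fu) - p * ((fv - fu) * kv)"
    and "x = d * (ku * (eu * fv - fv * eu) * kv) - p * (mu * kv - mv * ku)"
    and "y = d * (kv * (ev * fu - fu * ev) * ku) - p * (mu * kv - mv * ku)"
  have 0: "a = 0" "b = 0" "c = 0" "e = 0" "x = 0" "y = 0"
    by (simp_all add: a_def b_def c_def e_def x_def y_def KE KE' KF KF' EF EF')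
  have 1: "d * (d * (p * (ku * eu * (fv * kv) - kv * ev * (fu * ku))))
     = d * p * x - d * p * y + p * (d * (ku * fv)) * (d * (eu * kv)) - p * (d * (kv * fu)) * (d * (ev * ku))"
    unfolding x_def y_def
    by (simp add: algebra_simps k commute_left[OF k] centralC[OF d, of ku] centralC[OF d, of kv] centralC[OF d, of fv] centralC[OF d, of fu] centralC[OF d, of eu] centralC[OF d, of ev] centralC[OF d, of mu] centralC[OF d, of mv] centralC[OF p, of ku] centralC[OF p, of kv] centralC[OF p, of fv] centralC[OF p, of fu] centralC[OF p, of eu] centralC[OF p, of ev] centralC[OF p, of mu] centralC[OF p, of mv] centralC[OF p, of d])
  have 2: "d * (ku * fv) = c + (d * fv + p * (fu - fv)) * ku" "d * (kv * fu) = (d * fu - p * (fv - fu)) * kv - e"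
    "d * (eu * kv) = b + kv * (d * eu + p * (eu - ev))" "d * (ev * ku) = ku * (d * ev - p * (ev - eu)) - a"
    unfolding a_def b_def c_def e_def by (simp_all add: algebra_simps centralC[OF d, of ku] centralC[OF d, of kv] centralC[OF d, of fv] centralC[OF d, of fu] centralC[OF p, of ku] centralC[OF p, of kv] centralC[OF p, of fv] centralC[OF p, of fu])
  have 3: "d * (d * (d * ((mu + fu * ku * eu) * kv - kv * (mu + fu * ku * eu)))) =
     d * d * (fu * (ku * (d * (eu * kv)))) - d * d * (d * (kv * fu) * (ku * eu))"
    by (simp add: algebra_simps m k commute_left[OF k] centralC[OF d, of ku] centralC[OF d, of kv] centralC[OF d, of fv] centralC[OF d, of fu] centralC[OF d, of eu] centralC[OF d, of ev] centralC[OF p, of ku] centralC[OF p, of kv] centralC[OF p, of fv] centralC[OF p, of fu] centralC[OF p, of eu] centralC[OF p, of ev])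
  show ?thesis unfolding 1 3 2 0
    by (simp add: algebra_simps k commute_left[OF k] centralC[OF d, of ku] centralC[OF d, of kv] centralC[OF d, of fv] centralC[OF d, of fu] centralC[OF d, of eu] centralC[OF d, of ev] centralC[OF p, of ku] centralC[OF p, of kv] centralC[OF p, of fv] centralC[OF p, of fu] centralC[OF p, of eu] centralC[OF p, of ev] centralC[OF p, of d])
qed

text \<open>\<open>A\<close> and \<open>B\<close> are the RTT entries of row (-1,-1) in the columns
  (0,0) and (-1,1), where Q contributes the same sum \<open>S\<close>. Eliminating \<open>S\<close>
  and moving k(u) and k(v) to the left relates the products of e to e_(-1,1).\<close>

lemma EE_step:
  assumes d: "central d" and p: "central p" and q: "central q" and k: "ku * kv = kv * ku"
    and KE: "d * (ku * ev - ev * ku) = p * (ku * (ev - eu))"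
    and KE': "d * (eu * kv - kv * eu) = p * (kv * (eu - ev))"
    and S: "S = kv * xv * ku + kv * ev * (ku * eu) + kv * (ku * xu)"
    and A: "q * ((d - p) * (ku * eu * (kv * ev) - kv * ev * (ku * eu))) = p * (d * S)"
    and B: "d * (q * (ku * (kv * xv) - kv * xv * ku)) - p * (q * (ku * (kv * xv) - kv * (ku * xu))) = p * (d * S)"
  shows "q * (kv * (ku * ((q + p) * ((d - p) * (((d + p) * eu - p * ev) * ev - ((d - p) * ev + p * eu) * eu)))))
    = q * (kv * (ku * (p * (d * ((d - p) * xv + (d + p) * xu + ((d - p) * ev + p * eu) * eu)))))"
proof -
  have 1: "d * (ev * ku) = ku * (d * ev - p * (ev - eu))" "d * (eu * kv) = kv * (d * eu + p * (eu - ev))"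
    using KE KE' by (simp_all add: algebra_simps centralC[OF d, of ku] centralC[OF d, of kv] centralC[OF p, of ku] centralC[OF p, of kv])
  have h1: "d * (ku * eu * (kv * ev) - kv * ev * (ku * eu)) =
     kv * (ku * (((d + p) * eu - p * ev) * ev - ((d - p) * ev + p * eu) * eu))"
  proof -
    have "d * (ku * eu * (kv * ev) - kv * ev * (ku * eu)) = ku * (d * (eu * kv)) * ev - kv * (d * (ev * ku)) * eu"
      by (simp add: algebra_simps centralC[OF d, of ku] centralC[OF d, of kv])
    then show ?thesis unfolding 1
      by (simp add: algebra_simps k commute_left[OF k] centralC[OF d, of ku] centralC[OF d, of kv] centralC[OF d, of fv] centralC[OF d, of fu] centralC[OF d, of eu] centralC[OF d, of ev] centralC[OF p, of ku] centralC[OF p, of kv] centralC[OF p, of fv] centralC[OF p, of fu] centralC[OF p, of eu] centralC[OF p, of ev])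
  qed
  have h2: "q * (kv * (ku * ((d - p) * xv + (d + p) * xu + ((d - p) * ev + p * eu) * eu))) = d * ((q + p) * S)"
  proof -
    \<comment> \<open>Expressing this term through \<open>S\<close> leaves e(v) k(u) as the only
      product still to be reordered.\<close>
    have "kv * xv * ku = S - kv * ev * (ku * eu) - kv * (ku * xu)" using S by (simp add: algebra_simps)
    with B have "d * (q * (ku * (kv * xv) - (S - kv * ev * (ku * eu) - kv * (ku * xu))))
       - p * (q * (ku * (kv * xv) - kv * (ku * xu))) = p * (d * S)" by simp
    then have "d * (q * (ku * (kv * xv) - S + kv * (ku * xu))) + q * (kv * (d * (ev * ku)) * eu)
       - p * (q * (ku * (kv * xv) - kv * (ku * xu))) = p * (d * S)"
      by (simp add: algebra_simps centralC[OF d, of kv] centralC[OF d, of ku] centralC[OF q, of kv] centralC[OF q, of ku] centralC[OF q, of d])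
    then show ?thesis unfolding 1
      by (simp add: algebra_simps k commute_left[OF k] centralC[OF d, of ku] centralC[OF d, of kv] centralC[OF d, of ev] centralC[OF d, of eu] centralC[OF p, of ku] centralC[OF p, of kv] centralC[OF p, of ev] centralC[OF p, of eu] centralC[OF q, of ku] centralC[OF q, of kv] centralC[OF q, of ev] centralC[OF q, of eu] centralC[OF q, of d] centralC[OF p, of d] centralC[OF q, of p])
  qed
  have "q * (kv * (ku * ((q + p) * ((d - p) * (((d + p) * eu - p * ev) * ev - ((d - p) * ev + p * eu) * eu)))))
     = (q + p) * (q * ((d - p) * (kv * (ku * (((d + p) * eu - p * ev) * ev - ((d - p) * ev + p * eu) * eu)))))"
    by (simp only: centralC[OF q, of kv] centralC[OF q, of ku] centralC[OF p, of kv] centralC[OF p, of ku] distrib_left distrib_right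
       left_diff_distrib right_diff_distrib mult_assoc centralC[OF d, of kv] centralC[OF d, of ku]) (simp add: algebra_simps centralC[OF q, of p] centralC[OF q, of d])
  also have "\<dots> = d * ((q + p) * (p * (d * S)))"
    unfolding h1[symmetric] A[symmetric] by (simp add: algebra_simps centralC[OF d, of ku] centralC[OF d, of kv] centralC[OF q, of p] centralC[OF q, of d] centralC[OF p, of d])
  also have "\<dots> = p * (d * (d * ((q + p) * S)))"
    by (simp add: algebra_simps centralC[OF q, of p] centralC[OF q, of d] centralC[OF p, of d])
  also have "\<dots> = q * (kv * (ku * (p * (d * ((d - p) * xv + (d + p) * xu + ((d - p) * ev + p * eu) * eu)))))"
    unfolding h2[symmetric]
    by (simp only: centralC[OF q, of kv] centralC[OF q, of ku] centralC[OF p, of kv] centralC[OF p, of ku] distrib_left distrib_right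
       left_diff_distrib right_diff_distrib mult_assoc centralC[OF d, of kv] centralC[OF d, of ku])
      (simp add: algebra_simps centralC[OF q, of p] centralC[OF q, of d])
  finally show ?thesis .
qed

text \<open>With 2 x = -e^2 and 2 r = 2 d + p, the relation \<open>R\<close>, doubled, becomes the
  quadratic relation of e multiplied by (d - p) (d + p).\<close>

lemma EE_final:
  assumes d: "central d" and p: "central p" and r: "central r" and rr: "r + r = d + d + p"
    and x: "xu + xu = - (eu * eu)" "xv + xv = - (ev * ev)"
    and R: "r * ((d - p) * (((d + p) * eu - p * ev) * ev - ((d - p) * ev + p * eu) * eu))
    = p * (d * ((d - p) * xv + (d + p) * xu + ((d - p) * ev + p * eu) * eu))"
  shows "(d - p) * ((d + p) * ((d + d) * (eu * ev - ev * eu) - p * ((eu - ev) * (eu - ev)))) = 0"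
proof -
  let ?W = "((d + p) * eu - p * ev) * ev - ((d - p) * ev + p * eu) * eu"
  have "(r + r) * ((d - p) * ?W) = p * (d * ((d - p) * (xv + xv) + (d + p) * (xu + xu)
      + ((d - p) * ev + p * eu) * eu + ((d - p) * ev + p * eu) * eu))"
    using arg_cong2[OF R R, of "(+)"] by (simp add: algebra_simps)
  then have 0: "(d + d + p) * ((d - p) * ?W) - p * (d * ((d - p) * - (ev * ev) + (d + p) * - (eu * eu)
      + ((d - p) * ev + p * eu) * eu + ((d - p) * ev + p * eu) * eu)) = 0" unfolding rr x by simp
  have "(d - p) * ((d + p) * ((d + d) * (eu * ev - ev * eu) - p * ((eu - ev) * (eu - ev)))) =
    (d + d + p) * ((d - p) * ?W) - p * (d * ((d - p) * - (ev * ev) + (d + p) * - (eu * eu)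
      + ((d - p) * ev + p * eu) * eu + ((d - p) * ev + p * eu) * eu))"
    by (simp add: algebra_simps centralC[OF d, of eu] centralC[OF d, of ev] centralC[OF p, of eu] centralC[OF p, of ev] centralC[OF p, of d])
  then show ?thesis unfolding 0 .
qed

text \<open>The elimination in reverse, for the column (-1,1). The factor 4 clears the halves in x =
  -e^2/2 and in \<open>q\<close>; the factor \<open>d * d\<close> pays for moving k(u) across
  e(v)^2.\<close>

lemma raw13_of_EE:
  assumes d: "central d" and p: "central p" and q: "central q" and k: "ku * kv = kv * ku"
    and qq: "q + q = d + d - p"
    and KE: "d * (ku * ev - ev * ku) = p * (ku * (ev - eu))"
    and x: "xu + xu = - (eu * eu)" "xv + xv = - (ev * ev)"
    and EE: "(d + d) * (eu * ev - ev * eu) = p * ((eu - ev) * (eu - ev))"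
    and S: "S = kv * xv * ku + kv * ev * (ku * eu) + kv * (ku * xu)"
    and B: "B = d * (q * (ku * (kv * xv) - kv * xv * ku)) - p * (q * (ku * (kv * xv) - kv * (ku * xu))) - p * (d * S)"
  shows "d * (d * (B + B + (B + B))) = 0"
proof -
  have 1: "d * (ev * ku) = ku * (d * ev - p * (ev - eu))"
    using KE by (simp add: algebra_simps centralC[OF d, of ku] centralC[OF d, of kv] centralC[OF p, of ku] centralC[OF p, of kv])
  let ?Y = "(d - p) * ev + p * eu"
  have 2: "d * (d * (kv * (ev * ev) * ku)) = kv * (ku * (?Y * ?Y))"
  proof -
    have "d * (d * (kv * (ev * ev) * ku)) = kv * (d * ev * (d * (ev * ku)))"
      by (simp add: algebra_simps centralC[OF d, of kv] centralC[OF d, of ev])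
    also have "\<dots> = kv * (d * ev * (ku * (d * ev - p * (ev - eu))))" unfolding 1 ..
    also have "\<dots> = kv * (d * (ev * ku) * (d * ev - p * (ev - eu)))" by (simp only: mult_assoc)
    finally show ?thesis unfolding 1 by (simp add: algebra_simps centralC[OF d, of kv] centralC[OF d, of ku] centralC[OF d, of ev] centralC[OF d, of eu] centralC[OF p, of kv] centralC[OF p, of ku] centralC[OF p, of ev] centralC[OF p, of eu])
  qed
  have 3: "d * (kv * ev * (ku * eu)) = kv * (ku * (?Y * eu))"
  proof -
    have "d * (kv * ev * (ku * eu)) = kv * (d * (ev * ku)) * eu" by (simp add: algebra_simps centralC[OF d, of kv])
    then show ?thesis unfolding 1 by (simp add: algebra_simps centralC[OF d, of kv] centralC[OF d, of ku] centralC[OF d, of ev] centralC[OF d, of eu] centralC[OF p, of kv] centralC[OF p, of ku] centralC[OF p, of ev] centralC[OF p, of eu])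
  qed
  let ?a = "- (ku * (kv * (ev * ev)))" and ?b = "- (kv * (ev * ev) * ku)" and ?c = "- (kv * (ku * (eu * eu)))"
    and ?e = "kv * ev * (ku * eu)"
  have "B + B = d * (q * (ku * (kv * (xv + xv)) - kv * (xv + xv) * ku))
     - p * (q * (ku * (kv * (xv + xv)) - kv * (ku * (xu + xu))))
     - p * (d * (kv * (xv + xv) * ku + (?e + ?e) + kv * (ku * (xu + xu))))"
    unfolding B S by (simp add: algebra_simps)
  then have BB: "B + B = d * (q * (?a - ?b)) - p * (q * (?a - ?c)) - p * (d * (?b + (?e + ?e) + ?c))"
    unfolding x by (simp add: algebra_simps)
  have BBBB: "B + B + (B + B) = d * ((q + q) * (?a - ?b)) - p * ((q + q) * (?a - ?c))
      - p * (d * (?b + (?e + ?e) + ?c)) - p * (d * (?b + (?e + ?e) + ?c))"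
    unfolding BB by (simp add: algebra_simps)
  have "d * (d * (B + B + (B + B))) = d * ((q + q) * (d * (d * ?a) + d * (d * (kv * (ev * ev) * ku)))) - p * ((q + q) * (d * (d * ?a) - d * (d * ?c)))
      - p * (d * (- (d * (d * (kv * (ev * ev) * ku))) + d * (d * ?e + d * ?e) + d * (d * ?c)))
      - p * (d * (- (d * (d * (kv * (ev * ev) * ku))) + d * (d * ?e + d * ?e) + d * (d * ?c)))"
    unfolding BBBB qq by (simp add: algebra_simps centralC[OF p, of d])
  also have "\<dots> = p * (d * ((d - p) * (kv * (ku * ((d + d) * (eu * ev - ev * eu) - p * ((eu - ev) * (eu - ev)))))))"
    unfolding qq 2 3
    by (simp add: algebra_simps k commute_left[OF k] centralC[OF d, of kv] centralC[OF d, of ku] centralC[OF d, of ev] centralC[OF d, of eu] centralC[OF p, of kv] centralC[OF p, of ku] centralC[OF p, of ev] centralC[OF p, of eu] centralC[OF p, of d])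
  finally show ?thesis unfolding EE by simp
qed

end

section \<open>The relations\<close>

lemma central_iff [simp]: "ring_1.central (\<lambda>a b. b * a) z \<longleftrightarrow> central (z :: 'a::ring_1)"
proof -
  have "class.ring_1 (1 :: 'a) (\<lambda>a b. b * a) (+) 0 (-) uminus"
    by standard (auto simp: algebra_simps)
  then show ?thesis
    by (auto simp: ring_1.central_def central_def)
qed

lemma opposite_ring_1: "class.ring_1 (1 :: 'a::ring_1) (\<lambda>a b. b * a) (+) 0 (-) uminus"
  by standard (auto simp: algebra_simps)

text \<open>Reversing all products exchanges the roles of \<open>e\<close> and \<open>f\<close>, so the lemmas about \<open>f\<close> are those about \<open>e\<close>
  read in the opposite ring.\<close>

lemmas KF_of_raw = ring_1.KE_of_raw[OF opposite_ring_1, unfolded central_iff]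
lemmas raw_of_KF = ring_1.raw_of_KE[OF opposite_ring_1, unfolded central_iff]
lemmas FF_step = ring_1.EE_step[OF opposite_ring_1, unfolded central_iff]
lemmas FF_final = ring_1.EE_final[OF opposite_ring_1, unfolded central_iff]
lemmas raw31_of_FF = ring_1.raw13_of_EE[OF opposite_ring_1, unfolded central_iff]

lemmas embU_simps = calg_hom_simps[OF calg_hom_embU]
lemmas embV_simps = calg_hom_simps[OF calg_hom_embV]
lemmas emb_simps = embU_simps embV_simps

abbreviation cmt :: "'a::ring_1 \<Rightarrow> 'a \<Rightarrow> 'a" where "cmt a b \<equiv> a * b - b * a"

text \<open>\<open>rel T i k j l\<close> is the entry with row \<open>(i, k)\<close> and column \<open>(j, l)\<close> of
  \<open>R(u - v) T\<^sub>1(u) T\<^sub>2(v) - T\<^sub>2(v) T\<^sub>1(u) R(u - v)\<close>, multiplied by \<open>(u - v) (u - v - 1/2) / (u v)\<^sup>2\<close>.\<close>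

definition rel :: "(idx3 \<Rightarrow> idx3 \<Rightarrow> 'a::calg fps) \<Rightarrow> idx3 \<Rightarrow> idx3 \<Rightarrow> idx3 \<Rightarrow> idx3 \<Rightarrow> 'a fps fps" where
  "rel T i k j l =
     lin 0 * (lin (- 1/2) * (cmt (embU (T i j)) (embV (T k l))))
     - ep * (lin (- 1/2) * (embU (T k j) * embV (T i l) - embV (T k j) * embU (T i l)))
     + ep * (lin 0 * ((if k = neg3 i then \<Sum>p\<in>idxs. embU (T p j) * embV (T (neg3 p) l) else 0)
                    - (if l = neg3 j then \<Sum>p\<in>idxs. embV (T k (neg3 p)) * embU (T i p) else 0)))"

definition rtt :: "(idx3 \<Rightarrow> idx3 \<Rightarrow> 'a::calg fps) \<Rightarrow> bool" where
  "rtt T \<longleftrightarrow> (\<forall>i j. T i j $ 0 = (if i = j then 1 else 0)) \<and> (\<forall>i k j l. rel T i k j l = 0)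
     \<and> (\<forall>i j. (\<Sum>m\<in>idxs. T i m * shift (1/2) (T (neg3 j) (neg3 m))) = (if i = j then 1 else 0))
     \<and> (\<forall>i j. (\<Sum>m\<in>idxs. shift (1/2) (T (neg3 m) (neg3 i)) * T m j) = (if i = j then 1 else 0))"

text \<open>The entries of the Gauss product F K E, multiplied out.\<close>

fun gmat :: "(gcomp \<Rightarrow> 'a::ring_1) \<Rightarrow> idx3 \<Rightarrow> idx3 \<Rightarrow> 'a" where
  "gmat g Im Im = g Km1"
| "gmat g Im I0 = g Km1 * g Em10"
| "gmat g Im Ip = g Km1 * g Em11"
| "gmat g I0 Im = g F0m1 * g Km1"
| "gmat g I0 I0 = g K0 + g F0m1 * g Km1 * g Em10"
| "gmat g I0 Ip = g F0m1 * g Km1 * g Em11 + g K0 * g E01"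
| "gmat g Ip Im = g F1m1 * g Km1"
| "gmat g Ip I0 = g F1m1 * g Km1 * g Em10 + g F10 * g K0"
| "gmat g Ip Ip = g K1 + g F1m1 * g Km1 * g Em11 + g F10 * g K0 * g E01"

fun drinfeld_gauss :: "'a::calg fps \<Rightarrow> 'a fps \<Rightarrow> 'a fps \<Rightarrow> gcomp \<Rightarrow> 'a fps" where
  "drinfeld_gauss e f H Km1 = finv (shift (- 1/2) H)"
| "drinfeld_gauss e f H K0 = finv (shift (- 1/2) H) * H"
| "drinfeld_gauss e f H K1 = H"
| "drinfeld_gauss e f H Em10 = e"
| "drinfeld_gauss e f H E01 = - shift (- 1/2) e"
| "drinfeld_gauss e f H Em11 = - (sc (1/2) * (e * e))"
| "drinfeld_gauss e f H F0m1 = f"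
| "drinfeld_gauss e f H F10 = - shift (- 1/2) f"
| "drinfeld_gauss e f H F1m1 = - (sc (1/2) * (f * f))"

text \<open>\<open>(u - v) [k(u), e(v)] = k(u) (e(v) - e(u))\<close>; for \<open>k(u) = H(u - 1/2)\<^sup>-\<^sup>1\<close> this is equivalent to the relations
  between \<open>h\<^sub>k\<close> and \<open>x\<^sup>-\<^sub>l\<close>, see \<open>KE_iff\<close> and \<open>HE_iff\<close>.\<close>

definition KE_rel :: "'a::calg fps \<Rightarrow> 'a fps \<Rightarrow> bool" where
  "KE_rel k e \<longleftrightarrow> lin 0 * (cmt (embU k) (embV e)) = ep * (embU k * (embV e - embU e))"

definition KF_rel :: "'a::calg fps \<Rightarrow> 'a fps \<Rightarrow> bool" where
  "KF_rel k f \<longleftrightarrow> lin 0 * (cmt (embU k) (embV f)) = ep * ((embU f - embV f) * embU k)"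

definition commuting :: "'a::calg fps \<Rightarrow> 'a fps \<Rightarrow> bool" where
  "commuting a b \<longleftrightarrow> embU a * embV b = embV b * embU a"

text \<open>The last two relations are doubled to avoid the scalar 1/2: the relation of e is (u - v)
  [e(u), e(v)] = (e(u) - e(v))^2 / 2. The equivalence with the defining relations is
  \<open>drinfeld_iff\<close>.\<close>

definition drinfeld :: "'a::calg fps \<Rightarrow> 'a fps \<Rightarrow> 'a fps \<Rightarrow> bool" where
  "drinfeld e f H \<longleftrightarrow> H $ 0 = 1 \<and> e $ 0 = 0 \<and> f $ 0 = 0 \<and> commuting H H
    \<and> KE_rel (finv (shift (- 1/2) H)) e \<and> KF_rel (finv (shift (- 1/2) H)) f
    \<and> lin 0 * (cmt (embU e) (embV f)) = ep * (embU H - embV H)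
    \<and> (lin 0 + lin 0) * (cmt (embU e) (embV e)) = ep * ((embU e - embV e) * (embU e - embV e))
    \<and> (lin 0 + lin 0) * (cmt (embU f) (embV f)) = - (ep * ((embU f - embV f) * (embU f - embV f)))"

subsection \<open>Specialisation\<close>

text \<open>The substitution \<open>v = u + c\<close>. It maps \<open>lin d\<close> to \<open>d - c\<close> times a central element that can be cancelled.\<close>

definition spec :: "complex \<Rightarrow> 'a::calg fps fps \<Rightarrow> 'a fps" where
  "spec c F = diag (shift c F)"

lemma calg_hom_spec: "calg_hom (spec c)"
  unfolding spec_def by (rule calg_hom_comp[OF calg_hom_diag calg_hom_shift])

lemmas spec_simps = calg_hom_simps[OF calg_hom_spec]

lemma spec_embU [simp]: "spec c (embU a) = a" and spec_embV [simp]: "spec c (embV a) = shift c a"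
  by (simp_all add: spec_def)

text \<open>Setting v = u + c in \<open>ep\<close> gives 1/(u (u + c)), which is u^-2 up to the unit
  1 + c u^-1.\<close>

lemma spec_ep_cancel:
  assumes "spec c ep * a = spec c ep * b" shows "a = (b :: 'a::calg fps)"
proof -
  have 1: "(1 + sc c * fps_X) * spec c ep = (fps_X * fps_X :: 'a fps)"
  proof -
    have "diag ((1 + sc c * fps_X) * shift c ep) = (fps_X * fps_X :: 'a fps)"
      by (simp only: shift_ep diag_ep)
    moreover have "diag (fps_X :: 'a fps fps) = fps_X"
      using diag_embV[of "fps_X :: 'a fps"] by (simp add: embV_def fmap_def fps_X_def if_distrib cong: if_cong)
    ultimately show ?thesis
      by (simp add: spec_def calg_hom_simps[OF calg_hom_diag])
  qed
  have "(1 + sc c * fps_X) * spec c ep * a = (1 + sc c * fps_X) * spec c ep * b"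
    using assms by (simp add: mult.assoc)
  then show ?thesis unfolding 1 mult.assoc by (blast dest: X_cancel)
qed

lemma spec_lin: "spec c (lin d) = sc (d - c) * spec c ep"
proof -
  have "ep * lin d = lin d * (ep :: 'a fps fps)" by (rule centralD[OF central_lin])
  then have "lin d * ep = ep * (lin d :: 'a fps fps)" by simp
  from shift_rel[OF this, of c] have "lin (d - c) * shift c ep = ep * shift c (lin d :: 'a fps fps)" .
  from diag_rel[OF this] show ?thesis by (simp add: spec_def)
qed

lemma spec_central_ep: "central (spec c ep :: 'a::calg fps)"
  unfolding central_def
proof
  fix a :: "'a fps"
  have "spec c (embU a * ep) = spec c (ep * embU a)" by (simp only: centralD[OF central_ep])
  then show "a * spec c ep = spec c ep * a" by (simp add: spec_simps)
qed

text \<open>The case c = d acts as a residue: the left side vanishes, and with it the value of Q at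
  v = u + d.\<close>

lemma spec_rel:
  assumes "lin d * P = ep * (Q :: 'a::calg fps fps)"
  shows "sc (d - c) * spec c P = spec c Q"
proof -
  have "spec c ep * (sc (d - c) * spec c P) = spec c ep * spec c Q"
    using arg_cong[OF assms, of "spec c"]
    by (simp add: spec_simps spec_lin mult.assoc centralD'[OF central_sc])
  then show ?thesis by (rule spec_ep_cancel)
qed

lemma commuting_swap:
  assumes "commuting a b" shows "commuting b a"
proof -
  have "swap (embV b * embU a) = swap (embU a * embV b)"
    using assms by (simp only: commuting_def)
  then show ?thesis by (simp add: commuting_def calg_hom_mult[OF calg_hom_swap])
qed

text \<open>Set v = u + d - c, then replace u by u + c.\<close>

lemma commuting_shift: "commuting a b \<Longrightarrow> shift c a * shift d b = shift d b * shift c a"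
proof -
  assume "commuting a b"
  then have "spec (d - c) (embU a * embV b) = spec (d - c) (embV b * embU a)"
    by (simp add: commuting_def)
  then have "shift c (a * shift (d - c) b) = shift c (shift (d - c) b * a)" by (simp add: spec_simps)
  then show ?thesis by (simp add: shift_mult shift_shift)
qed

lemma finv_commute: "a $ 0 = 1 \<Longrightarrow> a * b = b * a \<Longrightarrow> finv a * b = b * finv a"
  by (metis finv_left finv_right mult.assoc mult_1 mult_1_right)

lemma double_eq_zero: "a + a = 0 \<Longrightarrow> (a :: 'a::calg) = 0"
proof -
  assume a: "a + a = 0"
  have "sc (1/2 + 1/2) * a = sc (1/2) * (a + a)" by (simp only: sc_add distrib_right distrib_left)
  with a show ?thesis by simp
qed

lemma double_cancel: "a + a = b + b \<Longrightarrow> a = (b :: 'a::calg)"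
  using double_eq_zero[of "a - b"] by (simp add: algebra_simps)

lemma half_double: "sc (1/2) * a + sc (1/2) * a = (a :: 'a::calg)"
proof -
  have "sc (1/2) * a + sc (1/2) * a = sc (1/2 + 1/2) * a" by (simp only: sc_add distrib_right)
  then show ?thesis by simp
qed

text \<open>If q = 1 + a u^-n + ..., a shift leaves the leading coefficient a unchanged, so the
  product begins with 1 + 2 a u^-n.\<close>

lemma shift_square_one:
  fixes q :: "'a::calg fps"
  assumes q: "q * shift c q = 1" "q $ 0 = 1" shows "q = 1"
proof -
  have "n > 0 \<longrightarrow> q $ n = 0" for n
  proof (induction n rule: less_induct)
    case (less n)
    show ?case
    proof
      assume n: "n > 0"
      have "shift c q $ n = (\<Sum>s\<le>n. if s = n then q $ n else 0)"
        unfolding shift_nth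
      proof (rule sum.cong[OF refl])
        fix s assume "s \<in> {..n}"
        then show "sc (shift_coeff c s (n - s)) * q $ s = (if s = n then q $ n else 0)"
          using less n q(2) by (cases "s = 0"; cases "s = n")
            (auto simp: shift_coeff_def gbinomial_0_left)
      qed
      then have "shift c q $ n = q $ n" by simp
      moreover have "(q * shift c q) $ n = shift c q $ n + q $ n"
      proof -
        have "(q * shift c q) $ n = (\<Sum>i\<le>n. (if i = 0 then shift c q $ n else 0) + (if i = n then q $ n else 0))"
          unfolding fps_mult_nth atLeast0AtMost
          by (rule sum.cong) (use less n q(2) in auto)
        then show ?thesis by (simp add: sum.distrib)
      qed
      ultimately have "q $ n + q $ n = 0" using q(1) n by simp
      then show "q $ n = 0" by (rule double_eq_zero)
    qed
  qed
  then show ?thesis using q(2) by (auto simp: fps_eq_iff)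
qed

section \<open>From the RTT relations to the Drinfeld relations\<close>

lemma sum_idxs: "(\<Sum>m\<in>idxs. g m) = g Im + g I0 + g Ip"
  by (simp add: idxs_def add.assoc)

lemma lin_half: "lin (- 1/2) + ep = (lin (1/2) :: 'a::calg fps fps)"
proof -
  have "sc (- 1/2 + 1) * ep = sc (- 1/2) * ep + (ep :: 'a fps fps)" by (simp only: sc_add distrib_right sc_one mult_1_left)
  then show ?thesis by (simp add: lin_def add.assoc)
qed

lemma lin_minus_one: "lin (- 1) = (lin 0 - ep :: 'a::calg fps fps)"
  by (simp add: lin_def sc_minus)

lemma lin_one: "lin 1 = (lin 0 + ep :: 'a::calg fps fps)"
  by (simp add: lin_def)

lemma lin_half_double: "lin (1/2) + lin (1/2) = (lin 0 + lin 0 + ep :: 'a::calg fps fps)"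
  by (simp add: lin_def algebra_simps half_double)

lemma lin_minus_half_double: "lin (- 1/2) + lin (- 1/2) = (lin 0 + lin 0 - ep :: 'a::calg fps fps)"
  using lin_half_double[where 'a = 'a] by (simp flip: lin_half add: algebra_simps)

lemma minus_half_double: "- (sc (1/2) * w) + - (sc (1/2) * w) = - (w :: 'a::calg)"
proof -
  have "- (sc (1/2) * w) + - (sc (1/2) * w) = - (sc (1/2) * w + sc (1/2) * w)" by simp
  then show ?thesis by (simp only: half_double)
qed

lemma half_eqI: "z + z = - w \<Longrightarrow> z = - (sc (1/2) * w :: 'a::calg)"
  by (rule double_cancel) (simp only: minus_half_double)

lemma KE_rel_swap:
  assumes "KE_rel k e"
  shows "lin 0 * (cmt (embU e) (embV k)) = ep * (embV k * (embU e - embV e))"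
proof -
  have "lin 0 * (cmt (embV k) (embU e)) = - (ep * (embV k * (embU e - embV e)))"
    using swap_rel[OF assms[unfolded KE_rel_def]] by (simp add: calg_hom_simps[OF calg_hom_swap])
  then show ?thesis by (simp add: algebra_simps)
qed

lemma KF_rel_swap:
  assumes "KF_rel k f"
  shows "lin 0 * (cmt (embU f) (embV k)) = ep * ((embV f - embU f) * embV k)"
proof -
  have "lin 0 * (cmt (embV k) (embU f)) = - (ep * ((embV f - embU f) * embV k))"
    using swap_rel[OF assms[unfolded KF_rel_def]] by (simp add: calg_hom_simps[OF calg_hom_swap])
  then show ?thesis by (simp add: algebra_simps)
qed

text \<open>At v = u - 1 the term k(u) e(v) occurs on both sides and drops out.\<close>

lemma KE_rel_spec: "KE_rel k e \<Longrightarrow> shift (- 1) e * k = k * e"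
  unfolding KE_rel_def using spec_rel[of 0 "cmt (embU k) (embV e)" "embU k * (embV e - embU e)" "- 1"]
  by (simp add: spec_simps algebra_simps)

lemma KF_rel_spec: "KF_rel k f \<Longrightarrow> k * shift (- 1) f = f * k"
  unfolding KF_rel_def using spec_rel[of 0 "cmt (embU k) (embV f)" "(embU f - embV f) * embU k" "- 1"]
  by (simp add: spec_simps algebra_simps)

lemma commuting_shift_right:
  assumes "commuting a b" shows "commuting a (shift c b)"
  using arg_cong[OF assms[unfolded commuting_def], of "shift c"]
  by (simp add: commuting_def shift_mult)

lemma inverse_commute:
  fixes a :: "'b::ring_1"
  assumes "b * b' = 1" "b' * b = 1" "a * b = b * a" shows "a * b' = b' * a"
proof -
  have "a * b' = b' * (b * a) * b'" by (simp add: assms(2) flip: mult.assoc)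
  also have "\<dots> = b' * (a * (b * b'))" by (simp only: assms(3)[symmetric] mult.assoc)
  finally show ?thesis by (simp add: assms(1))
qed

lemma commuting_finv_right:
  assumes "commuting a b" "b $ 0 = 1" shows "commuting a (finv b)"
proof -
  have "embV b * embV (finv b) = 1" "embV (finv b) * embV b = 1"
    using assms(2) by (simp_all add: finv_left finv_right calg_hom_one[OF calg_hom_embV] flip: calg_hom_mult[OF calg_hom_embV])
  then show ?thesis
    using assms(1) unfolding commuting_def by (rule inverse_commute)
qed

lemma sc_two: "sc 2 * a = a + (a :: 'a::calg)"
proof -
  have "sc (1 + 1) * a = a + a" by (simp only: sc_add sc_one distrib_right mult_1_left)
  then show ?thesis by simp
qed

locale rtt_matrix =
  fixes T :: "idx3 \<Rightarrow> idx3 \<Rightarrow> 'a::calg fps"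
  assumes rtt: "rtt T"
begin

text \<open>Gauss factors: \<open>k\<close>, \<open>k2\<close> are k_(-1), k_0; \<open>e\<close>,
  \<open>x\<close> are e_(-1,0), e_(-1,1); \<open>f\<close>, \<open>y\<close> are f_(0,-1),
  f_(1,-1).\<close>

definition "k = T Im Im"
definition "e = finv k * T Im I0"
definition "x = finv k * T Im Ip"
definition "f = T I0 Im * finv k"
definition "y = T Ip Im * finv k"
definition "k2 = T I0 I0 - f * k * e"
definition "H = finv k * k2"

lemma T_nth_0: "T i j $ 0 = (if i = j then 1 else 0)"
  using rtt by (simp add: rtt_def)

lemma k_0 [simp]: "k $ 0 = 1" and e_0 [simp]: "e $ 0 = 0" and f_0 [simp]: "f $ 0 = 0"
  and k2_0 [simp]: "k2 $ 0 = 1" and H_0 [simp]: "H $ 0 = 1"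
  by (simp_all add: k_def e_def f_def k2_def H_def T_nth_0)

lemma k_inv [simp]: "finv k * k = 1" "k * finv k = 1" "finv k * (k * z) = z" "k * (finv k * z) = z"
  by (simp_all add: finv_left finv_right flip: mult.assoc)

lemma T_entries:
  "T Im Im = k" "T Im I0 = k * e" "T Im Ip = k * x" "T I0 Im = f * k" "T Ip Im = y * k" "T I0 I0 = k2 + f * k * e"
  by (simp_all add: e_def x_def f_def y_def k2_def mult.assoc) (simp add: k_def)

lemma embV_k_inv: "embV (finv k) * embV k = 1" "embV k * embV (finv k) = 1"
  and embU_k_inv: "embU (finv k) * embU k = 1" "embU k * embU (finv k) = 1"
  by (simp_all add: calg_hom_one[OF calg_hom_embU] calg_hom_one[OF calg_hom_embV]
      flip: calg_hom_mult[OF calg_hom_embU] calg_hom_mult[OF calg_hom_embV])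

lemma rel_zero: "rel T i m j l = 0"
  using rtt by (simp add: rtt_def)

text \<open>Where Q does not contribute, the factor u - v - 1/2 is common to all terms and cancels,
  which leaves a relation of gl_3 type.\<close>

lemma rel_noQ:
  assumes "m \<noteq> neg3 i" "l \<noteq> neg3 j"
  shows "lin 0 * (cmt (embU (T i j)) (embV (T m l)))
    = ep * (embU (T m j) * embV (T i l) - embV (T m j) * embU (T i l))"
proof -
  let ?C = "cmt (embU (T i j)) (embV (T m l))"
  let ?P = "embU (T m j) * embV (T i l) - embV (T m j) * embU (T i l)"
  have "lin 0 * (lin (- 1/2) * ?C) = ep * (lin (- 1/2) * ?P)"
    using rel_zero[of i m j l] assms by (simp add: rel_def)
  then have "lin (- 1/2) * (lin 0 * ?C) = lin (- 1/2) * (ep * ?P)"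
    by (simp only: centralD'[OF central_lin[of "- 1/2"]])
  then show ?thesis by (rule lin_cancel)
qed

text \<open>The permutation term is here the commutator itself, so the total factor is u - v - 1,
  which cancels.\<close>

lemma k_k: "commuting k k"
proof -
  have "lin (- 1) * (cmt (embU k) (embV k)) = 0"
    using rel_noQ[of Im Im Im Im] by (simp add: T_entries lin_minus_one algebra_simps)
  then show ?thesis using lin_cancel_0 by (fastforce simp: commuting_def)
qed

lemmas k_k' = k_k[unfolded commuting_def]

lemma KE: "KE_rel k e"
  unfolding KE_rel_def
  by (rule KE_of_raw[OF central_lin central_ep embV_k_inv(1) k_k'])
    (use rel_noQ[of Im Im Ip I0] rel_noQ[of Im Im I0 Im] in \<open>simp add: T_entries emb_simps\<close>)

lemma KF: "KF_rel k f"
proof -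
  have raw: "lin 0 * (embU k * (embV f * embV k) - embV f * embV k * embU k)
     = ep * (embU f * embU k * embV k - embV f * embV k * embU k)"
    using rel_noQ[of I0 Im Im Im] by (simp add: T_entries emb_simps)
  \<comment> \<open>The form required by the opposite ring: central factors stand on the
    right.\<close>
  have "(cmt (embV f) (embU k)) * lin 0 = (embV f - embU f) * embU k * ep"
  proof (rule KF_of_raw[OF central_lin central_ep embV_k_inv(2) k_k'[symmetric]])
    show "(embV f * embV k * embU k - embU k * (embV f * embV k)) * lin 0 =
      (embV f * embV k * embU k - embU f * embU k * embV k) * ep"
      using raw by (simp add: centralD[OF central_lin[of 0]] centralD[OF central_ep] algebra_simps)
  qed
  then show ?thesis
    by (simp add: KF_rel_def centralD[OF central_lin[of 0]] centralD[OF central_ep] algebra_simps)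
qed

lemma k_k2: "commuting k k2"
proof -
  have "lin 0 * (cmt (embU k) (embV k2)) = 0"
    using k1_k2_commute_of_raw[OF central_lin central_ep k_k' KE[unfolded KE_rel_def] KF[unfolded KF_rel_def],
        of "embV k2"] rel_noQ[of I0 Im I0 Im]
    by (simp add: T_entries emb_simps)
  then show ?thesis using lin_cancel_0 by (fastforce simp: commuting_def)
qed

lemma EF: "lin 0 * (cmt (embU e) (embV f)) = ep * (embU H - embV H)"
proof -
  let ?Z = "cmt (embU e) (embV f)"
  have "lin 0 * (lin 0 * (embU k * ?Z * embV k) - ep * (embU k2 * embV k - embV k2 * embU k)) = 0"
    using rel_noQ[of I0 Im Im I0]
    unfolding EF_of_raw[OF central_lin central_ep k_k' KE[unfolded KE_rel_def] KE_rel_swap[OF KE] KF[unfolded KF_rel_def]]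
    by (simp add: T_entries emb_simps)
  then have 1: "lin 0 * (embU k * ?Z * embV k) = ep * (embU k2 * embV k - embV k2 * embU k)"
    using lin_cancel_0 by fastforce
  have "embU (finv k) * (lin 0 * (embU k * ?Z * embV k)) * embV (finv k)
    = lin 0 * ((embU (finv k) * embU k) * ?Z * (embV k * embV (finv k)))"
    by (simp only: centralD'[OF central_lin[of 0]] mult.assoc)
  moreover have "embU (finv k) * (ep * (embU k2 * embV k - embV k2 * embU k)) * embV (finv k)
    = ep * (embU (finv k) * embU k2 * (embV k * embV (finv k)) - embU (finv k) * (embV k2 * embU k) * embV (finv k))"
    by (simp only: centralD'[OF central_ep] mult.assoc left_diff_distrib right_diff_distrib)
  moreover have "embU (finv k) * (embV k2 * embU k) * embV (finv k) = embV (finv k * k2)"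
  proof -
    have "embU (finv k) * (embV k2 * embU k) = embU (finv k) * embU k * embV k2"
      using k_k2 by (simp only: commuting_def mult.assoc)
    then have "embU (finv k) * (embV k2 * embU k) = embV k2" by (simp only: embU_k_inv mult_1_left)
    moreover have "k2 * finv k = finv k * k2"
      by (rule finv_commute[symmetric]) (use commuting_shift[OF k_k2, of 0 0] in auto)
    ultimately show ?thesis by (metis calg_hom_mult[OF calg_hom_embV])
  qed
  ultimately show ?thesis
    using 1 by (simp add: embU_k_inv embV_k_inv H_def emb_simps)
qed

lemma x_and_EE:
  shows x: "x + x = - (e * e)"
    and EE: "(lin 0 + lin 0) * (cmt (embU e) (embV e)) = ep * ((embU e - embV e) * (embU e - embV e))"
proof -
  define S where "S = embV k * embV x * embU k + embV k * embV e * (embU k * embU e) + embV k * (embU k * embU x)"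
  let ?L = "(lin 0 - ep) * embV x + (lin 0 + ep) * embU x + ((lin 0 - ep) * embV e + ep * embU e) * embU e"
  let ?W = "((lin 0 + ep) * embU e - ep * embV e) * embV e - ((lin 0 - ep) * embV e + ep * embU e) * embU e"
  have A: "lin (- 1/2) * ((lin 0 - ep) * (embU k * embU e * (embV k * embV e) - embV k * embV e * (embU k * embU e)))
      = ep * (lin 0 * S)"
    using rel_zero[of Im Im I0 I0] unfolding S_def
    by (simp add: rel_def sum_idxs T_entries emb_simps)
      (simp add: algebra_simps centralD'[OF central_lin[of 0], of "lin (- (1/2))"] centralD'[OF central_ep, of "lin (- (1/2))"])
  have B: "lin 0 * (lin (- 1/2) * (embU k * (embV k * embV x) - embV k * embV x * embU k))
      - ep * (lin (- 1/2) * (embU k * (embV k * embV x) - embV k * (embU k * embU x))) = ep * (lin 0 * S)"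
    using rel_zero[of Im Im Im Ip] unfolding S_def
    by (simp add: rel_def sum_idxs T_entries emb_simps) (simp add: algebra_simps)
  have "lin (- 1/2) * (embV k * (embU k * ((lin (- 1/2) + ep) * ((lin 0 - ep) * ?W))))
      = lin (- 1/2) * (embV k * (embU k * (ep * (lin 0 * ?L))))"
    by (rule EE_step[OF central_lin central_ep central_lin k_k' KE[unfolded KE_rel_def] KE_rel_swap[OF KE] S_def A B])
  then have "embV k * (embU k * ((lin (- 1/2) + ep) * ((lin 0 - ep) * ?W))) = embV k * (embU k * (ep * (lin 0 * ?L)))"
    by (rule lin_cancel)
  then have R: "lin (1/2) * ((lin 0 - ep) * ?W) = ep * (lin 0 * ?L)"
    unfolding lin_half by (rule left_cancel[OF embU_k_inv(1) left_cancel[OF embV_k_inv(1)]])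
  \<comment> \<open>At v = u - 1 the factor \<open>lin 0 - ep\<close> vanishes and with it the left
    side of \<open>R\<close>; on the right only 2 x + e^2 survives, times a power of
    \<open>spec (- 1) ep\<close>.\<close>
  have "spec (- 1) ep * (spec (- 1) ep * (spec (- 1) ep * (x + x + e * e))) = spec (- 1) (ep * (lin 0 * ?L))"
    by (simp add: spec_simps spec_lin flip: lin_minus_one lin_one)
      (simp add: distrib_right distrib_left mult.assoc sc_two)
  also have "\<dots> = spec (- 1) ep * (spec (- 1) ep * (spec (- 1) ep * 0))"
    unfolding R[symmetric] unfolding lin_minus_one[symmetric] by (simp add: spec_simps spec_lin)
  finally have x0: "x + x + e * e = 0" by (blast dest: spec_ep_cancel)
  then show x: "x + x = - (e * e)" by (simp add: eq_neg_iff_add_eq_0)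
  have xU: "embU x + embU x = - (embU e * embU e)" and xV: "embV x + embV x = - (embV e * embV e)"
    using arg_cong[OF x, of embU] arg_cong[OF x, of embV] by (simp_all add: emb_simps)
  have "(lin 0 - ep) * ((lin 0 + ep) * ((lin 0 + lin 0) * (cmt (embU e) (embV e))
     - ep * ((embU e - embV e) * (embU e - embV e)))) = 0"
    by (rule EE_final[OF central_lin central_ep central_lin lin_half_double xU xV R])
  then show "(lin 0 + lin 0) * (cmt (embU e) (embV e)) = ep * ((embU e - embV e) * (embU e - embV e))"
    unfolding lin_minus_one[symmetric] lin_one[symmetric] by (auto dest!: lin_cancel_0)
qed

lemma right_cancel: "z * w = 1 \<Longrightarrow> a * z = b * z \<Longrightarrow> a = (b :: 'b::ring_1)"
  by (metis mult.assoc mult_1_right)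

text \<open>The mirror image of \<open>x_and_EE\<close>, obtained in the opposite ring; central
  factors and cancelled powers of k therefore stand on the right.\<close>

lemma y_and_FF:
  shows y: "y + y = - (f * f)"
    and FF: "(lin 0 + lin 0) * (cmt (embU f) (embV f)) = - (ep * ((embU f - embV f) * (embU f - embV f)))"
proof -
  define S where "S = embU k * (embV y * embV k) + embU f * embU k * (embV f * embV k) + embU y * embU k * embV k"
  let ?L = "embV y * (lin 0 - ep) + embU y * (lin 0 + ep) + embU f * (embV f * (lin 0 - ep) + embU f * ep)"
  let ?W = "embV f * (embU f * (lin 0 + ep) - embV f * ep) - embU f * (embV f * (lin 0 - ep) + embU f * ep)"
  have 0: "(cmt (embV f) (embU k)) * lin 0 = (embV f - embU f) * embU k * ep"
    unfolding centralD[OF central_lin[of 0], of "_ - _"] centralD[OF central_ep, of "_ * embU k"]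
    using KF[unfolded KF_rel_def] by (simp add: algebra_simps)
  have 1: "(cmt (embV k) (embU f)) * lin 0 = (embU f - embV f) * embV k * ep"
    unfolding centralD[OF central_lin[of 0], of "_ - _"] centralD[OF central_ep, of "_ * embV k"]
    using KF_rel_swap[OF KF] by (simp add: algebra_simps)
  have "lin (- 1/2) * ((lin 0 - ep) * (embV f * embV k * (embU f * embU k) - embU f * embU k * (embV f * embV k)))
      = ep * (lin 0 * S)"
    using rel_zero[of I0 I0 Im Im] unfolding S_def
    by (simp add: rel_def sum_idxs T_entries emb_simps)
      (simp add: algebra_simps centralD'[OF central_lin[of 0], of "lin (- (1/2))"] centralD'[OF central_ep, of "lin (- (1/2))"])
  then have A: "(embV f * embV k * (embU f * embU k) - embU f * embU k * (embV f * embV k)) * (lin 0 - ep) * lin (- 1/2)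
      = S * lin 0 * ep"
    unfolding centralD[OF central_lin[of "- 1/2"], of "_ * _"] centralD[OF central_ep, of "_ * _"]
      centralD[OF central_lin[of 0], of S] centralD[OF central_lin[of "- 1", unfolded lin_minus_one], of "_ - _"] .
  have "lin 0 * (lin (- 1/2) * (embV y * embV k * embU k - embU k * (embV y * embV k)))
      - ep * (lin (- 1/2) * (embV y * embV k * embU k - embU y * embU k * embV k)) = ep * (lin 0 * S)"
    using rel_zero[of Im Ip Im Im] unfolding S_def
    by (simp add: rel_def sum_idxs T_entries emb_simps) (simp add: algebra_simps)
  then have B: "(embV y * embV k * embU k - embU k * (embV y * embV k)) * lin (- 1/2) * lin 0
      - (embV y * embV k * embU k - embU y * embU k * embV k) * lin (- 1/2) * ep = S * lin 0 * ep"
    unfolding centralD[OF central_lin[of "- 1/2"], of "_ - _"] centralD[OF central_ep, of "_ * _"]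
      centralD[OF central_lin[of 0], of S] centralD[OF central_lin[of 0], of "_ * _"] .
  have "?W * (lin 0 - ep) * (lin (- 1/2) + ep) * embU k * embV k * lin (- 1/2)
      = ?L * lin 0 * ep * embU k * embV k * lin (- 1/2)"
    by (rule FF_step[OF central_lin central_ep central_lin k_k'[symmetric] 0 1 S_def A B])
  then have "?W * (lin 0 - ep) * (lin (- 1/2) + ep) * embU k * embV k = ?L * lin 0 * ep * embU k * embV k"
    unfolding centralD[OF central_lin[of "- 1/2"], of "_ * embV k"] by (rule lin_cancel)
  then have R: "?W * (lin 0 - ep) * lin (1/2) = ?L * lin 0 * ep"
    unfolding lin_half by (rule right_cancel[OF embU_k_inv(2) right_cancel[OF embV_k_inv(2)]])
  have "spec (- 1) (?L * lin 0 * ep) = (y + y + f * f) * spec (- 1) ep * spec (- 1) ep * spec (- 1) ep"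
    by (simp add: spec_simps spec_lin flip: lin_minus_one lin_one)
      (simp add: distrib_right distrib_left mult.assoc sc_two centralC[OF central_sc[of 2], of y])
  also have "spec (- 1) (?L * lin 0 * ep) = 0"
    unfolding R[symmetric] unfolding lin_minus_one[symmetric] by (simp add: spec_simps spec_lin)
  finally have "spec (- 1) ep * (spec (- 1) ep * (spec (- 1) ep * (y + y + f * f))) = spec (- 1) ep * (spec (- 1) ep * (spec (- 1) ep * 0))"
    by (simp add: centralD[OF spec_central_ep, of "_ + _"] mult.assoc)
  then have y0: "y + y + f * f = 0" by (blast dest: spec_ep_cancel)
  then show y: "y + y = - (f * f)" by (simp add: eq_neg_iff_add_eq_0)
  have yU: "embU y + embU y = - (embU f * embU f)" and yV: "embV y + embV y = - (embV f * embV f)"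
    using arg_cong[OF y, of embU] arg_cong[OF y, of embV] by (simp_all add: emb_simps)
  let ?Z = "(cmt (embV f) (embU f)) * (lin 0 + lin 0) - (embU f - embV f) * (embU f - embV f) * ep"
  have "?Z * (lin 0 + ep) * (lin 0 - ep) = 0"
    by (rule FF_final[OF central_lin central_ep central_lin lin_half_double yU yV R])
  then have "lin (- 1) * (lin 1 * ?Z) = 0"
    unfolding lin_minus_one[symmetric] lin_one[symmetric] centralD[OF central_lin[of 1], of "_ - _"]
      centralD[OF central_lin[of "- 1"], of "_ * _"] .
  then have "?Z = 0" by (blast dest: lin_cancel_0)
  then show "(lin 0 + lin 0) * (cmt (embU f) (embV f)) = - (ep * ((embU f - embV f) * (embU f - embV f)))"
    unfolding centralD[OF central_add[OF central_lin[of 0] central_lin[of 0]], of "_ - _"]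
      centralD[OF central_ep, of "_ * _"] by (simp add: algebra_simps)
qed

subsection \<open>Consequences of unitarity\<close>

text \<open>\<open>b\<close>, \<open>h\<close>, \<open>k3\<close> are the remaining Gauss factors
  e_(0,1), f_(1,0), k_1.\<close>

definition "b = finv k2 * (T I0 Ip - f * k * x)"
definition "h = (T Ip I0 - y * k * e) * finv k2"
definition "k3 = T Ip Ip - y * k * x - h * k2 * b"

lemma k2_inv [simp]: "finv k2 * k2 = 1" "k2 * finv k2 = 1" "finv k2 * (k2 * z) = z" "k2 * (finv k2 * z) = z"
  by (simp_all add: finv_left finv_right flip: mult.assoc)

lemma T_entries':
  "T I0 Ip = f * k * x + k2 * b" "T Ip I0 = y * k * e + h * k2" "T Ip Ip = k3 + y * k * x + h * k2 * b"
  by (simp_all add: b_def h_def k3_def mult.assoc)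

lemma unitarity: "(\<Sum>m\<in>idxs. T i m * shift (1/2) (T (neg3 j) (neg3 m))) = (if i = j then 1 else 0)"
  using rtt by (simp add: rtt_def)

abbreviation "s \<equiv> shift (1/2)"

lemma shift_simps: "s (z + w) = s z + s w" "s (z * w) = s z * s w"
  by (rule calg_hom_simps[OF calg_hom_shift])+

lemma shift_e: "s (k * e) = shift (- 1/2) e * s k" and shift_f: "s (f * k) = s k * shift (- 1/2) f"
  unfolding KE_rel_spec[OF KE, symmetric] KF_rel_spec[OF KF, symmetric]
  by (simp_all add: shift_simps shift_shift)

lemma s_k_inv: "finv (s k) * s k = 1" "s k * finv (s k) = 1"
  by (simp_all add: finv_left finv_right)

text \<open>Row by row elimination in the third column of T(u) T^t(u + 1/2) = 1. The third column of
  T^t consists of the first row of T, so stripping F and K from the left factor leaves equations in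
  known Gauss factors that can be solved for k_1 and e_(0,1).\<close>

lemma third_column:
  shows k3: "k3 * s k = 1" and b: "b = - shift (- 1/2) e"
proof -
  have 1: "k * (s (k * x) + e * s (k * e) + x * s k) = 0"
    using unitarity[of Im Ip] by (simp add: sum_idxs T_entries distrib_left mult.assoc)
  have "finv k * (k * (s (k * x) + e * s (k * e) + x * s k)) = 0" unfolding 1 by simp
  then have G1: "s (k * x) + e * s (k * e) + x * s k = 0" by simp
  have "f * (k * (s (k * x) + e * s (k * e) + x * s k)) + k2 * (s (k * e) + b * s k) = 0"
    using unitarity[of I0 Ip] by (simp add: sum_idxs T_entries T_entries' distrib_left distrib_right mult.assoc add.assoc add.left_commute)
  then have "finv k2 * (k2 * (s (k * e) + b * s k)) = 0" unfolding 1 by simp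
  then have G2: "s (k * e) + b * s k = 0" by simp
  have "y * (k * (s (k * x) + e * s (k * e) + x * s k)) + h * (k2 * (s (k * e) + b * s k)) + k3 * s k = 1"
    using unitarity[of Ip Ip]
    by (simp add: sum_idxs T_entries T_entries' distrib_left distrib_right mult.assoc add.assoc add.left_commute add.commute)
  then show "k3 * s k = 1" unfolding G1 G2 by simp
  have "(shift (- 1/2) e + b) * s k = 0 * s k" using G2 by (simp add: shift_e distrib_right)
  then have "shift (- 1/2) e + b = 0" by (rule right_cancel[OF s_k_inv(2)])
  then show "b = - shift (- 1/2) e" by (simp add: eq_neg_iff_add_eq_0 add.commute)
qed

text \<open>The same elimination in the second column. The diagonal equation does not yet determine
  k_0, since it contains k_0 at u and at u + 1/2.\<close>

lemma second_column:
  shows h: "h = - shift (- 1/2) f" and k2_eq: "k2 * (s (k2 + f * k * e) + b * s (f * k)) = 1"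
proof -
  have 1: "k * (s (T I0 Ip) + e * s (k2 + f * k * e) + x * s (f * k)) = 0"
    using unitarity[of Im I0] by (simp add: sum_idxs T_entries distrib_left mult.assoc)
  have 2: "f * (k * (s (T I0 Ip) + e * s (k2 + f * k * e) + x * s (f * k))) + k2 * (s (k2 + f * k * e) + b * s (f * k)) = 1"
    using unitarity[of I0 I0]
    by (simp add: sum_idxs T_entries T_entries'(1)[of ] distrib_left distrib_right mult.assoc add.assoc add.left_commute shift_simps)
  then show k2_eq: "k2 * (s (k2 + f * k * e) + b * s (f * k)) = 1" unfolding 1 by simp
  have "y * (k * (s (T I0 Ip) + e * s (k2 + f * k * e) + x * s (f * k))) + h * (k2 * (s (k2 + f * k * e) + b * s (f * k))) + k3 * s (f * k) = 0"
    using unitarity[of Ip I0]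
    by (simp add: sum_idxs T_entries T_entries' distrib_left distrib_right mult.assoc add.assoc add.left_commute add.commute shift_simps)
  then have "h + k3 * s (f * k) = 0" unfolding 1 k2_eq by simp
  then have "h + (k3 * s k) * shift (- 1/2) f = 0" by (simp add: shift_f mult.assoc)
  then show "h = - shift (- 1/2) f" unfolding k3 by (simp add: eq_neg_iff_add_eq_0)
qed

text \<open>The products of e and f in the diagonal equation are removed by EF at v = u - 1, shifted
  by 1/2: [e(u + 1/2), f(u - 1/2)] = H(u + 1/2) - H(u - 1/2).\<close>

lemma k2_shift: "k2 * (s k * shift (- 1/2) H) = 1"
proof -
  have "e * shift (- 1) f - shift (- 1) f * e = H - shift (- 1) H"
    using spec_rel[OF EF, of "- 1"] by (simp add: spec_simps)
  then have "s (e * shift (- 1) f - shift (- 1) f * e) = s (H - shift (- 1) H)" by (rule arg_cong)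
  then have 1: "s e * shift (- 1/2) f - shift (- 1/2) f * s e = s H - shift (- 1/2) H"
    by (simp add: calg_hom_simps[OF calg_hom_shift] shift_shift)
  have "s (f * k * e) + b * s (f * k) = s (f * k) * s e - shift (- 1/2) e * s k * shift (- 1/2) f"
    unfolding b shift_simps(2)[of "f * k" e] by (simp add: shift_f mult.assoc)
  also have "\<dots> = - (s k * (s e * shift (- 1/2) f - shift (- 1/2) f * s e))"
    unfolding shift_e[symmetric] shift_f by (simp add: shift_simps algebra_simps)
  finally have "s k2 + (s (f * k * e) + b * s (f * k)) = s k2 - s k * (s H - shift (- 1/2) H)"
    unfolding 1 by simp
  moreover have "s k * s H = s k2"
    unfolding shift_simps(2)[symmetric] H_def by simp
  ultimately show ?thesis using k2_eq by (simp add: shift_simps algebra_simps)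
qed

lemma H_eq: "H = finv (s k)"
proof -
  let ?m = "shift (- 1/2) :: 'a fps \<Rightarrow> 'a fps"
  have m_inv: "finv (?m k) * ?m k = 1" "?m k * finv (?m k) = 1" by (simp_all add: finv_left finv_right)
  have c1: "k * ?m k2 = ?m k2 * k" using commuting_shift[OF k_k2, of 0 "- 1/2"] by simp
  have c2: "?m k * ?m k2 = ?m k2 * ?m k" by (rule commuting_shift[OF k_k2])
  have c3: "finv k * ?m k2 = ?m k2 * finv k" by (rule finv_commute[OF _ c1]) simp
  have c4: "finv (?m k) * ?m k2 = ?m k2 * finv (?m k)" by (rule finv_commute[OF _ c2]) simp
  have mH: "?m H = finv (?m k) * ?m k2"
    by (simp add: H_def shift_mult finv_shift)
  \<comment> \<open>The defect of the claimed formula k_0(u) = k_(-1)(u) k_(-1)(u + 1/2)^-1.\<close>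
  define q where "q = k2 * s k * finv k"
  have "q * ?m q = k2 * s k * finv k * (?m k2 * k * finv (?m k))"
    by (simp add: q_def shift_mult shift_shift finv_shift)
  also have "\<dots> = k2 * (s k * ((finv k * ?m k2) * (k * finv (?m k))))" by (simp only: mult.assoc)
  also have "\<dots> = k2 * (s k * (?m k2 * ((finv k * k) * finv (?m k))))" by (simp only: c3 mult.assoc)
  also have "\<dots> = 1" using k2_shift unfolding mH c4 by simp
  finally have "q = 1" by (rule shift_square_one) (simp add: q_def)
  then have "q * k = k" by simp
  then have "k2 * s k = k" by (simp add: q_def mult.assoc)
  then have "H * s k = 1" by (simp add: H_def mult.assoc)
  then show ?thesis by (rule finv_unique[rotated]) simp
qed

lemma k_eq: "finv (shift (- 1/2) H) = k"
  by (simp add: H_eq finv_shift shift_shift finv_finv)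

lemma drinfeld: "drinfeld e f H"
proof -
  have *: "commuting z (finv (s k))" if "commuting z k" for z
    using commuting_finv_right[OF commuting_shift_right[OF that, of "1/2"]] by simp
  have "commuting H H"
    unfolding H_eq by (rule *) (rule commuting_swap, rule *, rule k_k)
  then show ?thesis
    unfolding drinfeld_def k_eq by (simp add: KE KF EF EE FF)
qed

lemma T_eq: "T = gmat (drinfeld_gauss e f H)"
proof -
  have K0: "k * H = k2" by (simp add: H_def)
  have K1: "k3 = H" unfolding H_eq by (rule finv_unique[OF _ k3]) simp
  have X: "x = - (sc (1/2) * (e * e))" "y = - (sc (1/2) * (f * f))"
    by (rule half_eqI, rule x) (rule half_eqI, rule y)
  have "T i j = gmat (drinfeld_gauss e f H) i j" for i j
    using k_eq by (cases i; cases j) (simp_all add: T_entries T_entries' K0 K1 X b h)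
  then show ?thesis by blast
qed

end

section \<open>From the Drinfeld relations to the RTT relations\<close>

subsection \<open>Equivariance\<close>

context ring_1
begin

lemma mult_eq_left: "z * a = b \<Longrightarrow> z * (a * w) = b * w"
  by (simp flip: mult_assoc)

text \<open>Here \<open>z\<close> is the zero mode of e, a suffix \<open>s\<close> or
  \<open>m\<close> marks the argument u + 1/2 or u - 1/2, and the conclusions are the commutators of
  \<open>z\<close> with the entries of T other than t_(-1,-1). The proof rewrites until
  \<open>z\<close> stands to the right of every factor.\<close>

lemma equivariance:
  assumes two: "\<forall>a b::'a. a + a = b + b \<longrightarrow> a = b"
    and k: "z * k = k * z - k * e" and H: "z * H = H * z + es * H" and e: "z * e = e * z - x"
    and em: "z * em = em * z - xm" and f: "z * f = f * z + 1 - H" and fm: "z * fm = fm * z + 1 - Hm"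
    and x: "x + x = - (e * e)" and xm: "xm + xm = - (em * em)" and y: "y + y = - (f * f)"
    and He: "e * H + H * e = es * H + es * H" and Hem: "H * em = es * H"
    and Hf: "f * H + H * f = H * fs + H * fs" and Hfm: "fm * H = H * fs"
    and ee: "e * em + e * em = e * e + em * em"
    and ex: "e * x = x * e" and k2: "k * H = k2" "H * k = k2" "Hm * k2 = H"
  shows "z * (k * e) - k * e * z = k * x"
    and "z * (k * x) - k * x * z = 0"
    and "z * (f * k) - f * k * z = k - (k2 + f * k * e)"
    and "z * (k2 + f * k * e) - (k2 + f * k * e) * z = (f * k * x - k2 * em) + k * e"
    and "z * (f * k * x - k2 * em) - (f * k * x - k2 * em) * z = k * x"
    and "z * (y * k) - y * k * z = - (y * k * e - fm * k2) - f * k"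
    and "z * (y * k * e - fm * k2) - (y * k * e - fm * k2) * z
       = (H + y * k * x + fm * k2 * em) - (k2 + f * k * e)"
    and "z * (H + y * k * x + fm * k2 * em) - (H + y * k * x + fm * k2 * em) * z
       = - (f * k * x - k2 * em)"
proof -
  have x': "- x = e * e + x"
    using x by (simp add: eq_neg_iff_add_eq_0 neg_eq_iff_add_eq_0 add_ac)
  have ze: "z * e = e * z + e * e + x" using e x' by (metis add_assoc diff_conv_add_uminus)
  \<comment> \<open>The commutators with x, y and \<open>em\<close> are computed for doubles,
    because the relations available express 2 x, 2 y, 2 xm and 2 e em by products;
    \<open>two\<close> then halves them.\<close>
  have zx: "z * x = x * z + e * x"
  proof (rule two[rule_format])
    have "z * x + z * x = z * (x + x)" by (simp add: distrib_left)
    also have "\<dots> = (x + x) * z + (x * e + e * x)"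
      unfolding x by (simp add: algebra_simps e mult_eq_left[OF e])
    finally show "z * x + z * x = x * z + e * x + (x * z + e * x)"
      by (simp add: algebra_simps ex)
  qed
  have zy: "z * y = y * z + fm * H - f"
  proof (rule two[rule_format])
    have "z * y + z * y = z * (y + y)" by (simp add: distrib_left)
    also have "\<dots> = (y + y) * z - (f + f) + (f * H + H * f)"
      unfolding y by (simp add: algebra_simps f mult_eq_left[OF f])
    finally show "z * y + z * y = y * z + fm * H - f + (y * z + fm * H - f)"
      unfolding Hf unfolding Hfm by (simp add: algebra_simps)
  qed
  have zk2: "z * k2 = k2 * z + k2 * e - k2 * em"
  proof -
    have "z * k2 = k * H * z + k * (es * H + es * H) - k * e * H - k * (es * H)"
      unfolding k2(1)[symmetric] by (simp add: mult_eq_left[OF k] H algebra_simps)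
    also have "\<dots> = k2 * z + k2 * e - k2 * em"
      unfolding He[symmetric] unfolding Hem[symmetric] k2(1)[symmetric] by (simp add: algebra_simps)
    finally show ?thesis .
  qed
  have zH: "z * H = H * z + H * em" using H Hem by simp
  have zem: "z * em = em * z - x - e * em + em * em"
  proof (rule two[rule_format])
    have "z * em + z * em = em * z + em * z - (xm + xm)" unfolding em by (simp add: algebra_simps)
    also have "\<dots> = em * z + em * z + e * e + em * em - e * e" unfolding xm by (simp add: algebra_simps)
    also have "\<dots> = em * z + em * z + (e * e - (e * em + e * em)) + em * em + em * em"
      unfolding ee by (simp add: algebra_simps)
    also have "e * e = - (x + x)" unfolding x by simp
    finally show "z * em + z * em = em * z - x - e * em + em * em + (em * z - x - e * em + em * em)"
      by (simp add: algebra_simps)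
  qed
  note rules = k mult_eq_left[OF k] ze mult_eq_left[OF ze] zx zy mult_eq_left[OF zy] zk2 mult_eq_left[OF zk2]
    zH zem f mult_eq_left[OF f] fm mult_eq_left[OF fm] k2(2,3) mult_eq_left[OF k2(2)] mult_eq_left[OF k2(3)]
  show "z * (k * e) - k * e * z = k * x"
    "z * (k * x) - k * x * z = 0"
    "z * (f * k) - f * k * z = k - (k2 + f * k * e)"
    "z * (k2 + f * k * e) - (k2 + f * k * e) * z = (f * k * x - k2 * em) + k * e"
    "z * (f * k * x - k2 * em) - (f * k * x - k2 * em) * z = k * x"
    "z * (y * k) - y * k * z = - (y * k * e - fm * k2) - f * k"
    "z * (y * k * e - fm * k2) - (y * k * e - fm * k2) * z
       = (H + y * k * x + fm * k2 * em) - (k2 + f * k * e)"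
    "z * (H + y * k * x + fm * k2 * em) - (H + y * k * x + fm * k2 * em) * z
       = - (f * k * x - k2 * em)"
    by (simp_all add: algebra_simps rules)
qed

end

lemmas equivariance_opposite = ring_1.equivariance[OF opposite_ring_1]

text \<open>Compares the coefficients of v^-1. Applied to the Drinfeld relations it produces the
  commutators with the zero modes.\<close>

lemma first_mode:
  assumes "lin 0 * P = ep * (Q :: 'a::calg fps fps)" and "P $ 0 = 0"
  shows "P $ 1 = - (Q $ 0)"
proof -
  have "fps_X * P - fps_const fps_X * P = fps_X * (fps_const fps_X * Q)"
    using assms(1) by (simp add: lin_def ep_def left_diff_distrib mult.assoc)
  then have "(fps_X * P - fps_const fps_X * P) $ 1 = (fps_X * (fps_const fps_X * Q)) $ 1" by (rule arg_cong)
  then have "- (fps_X * P $ 1) = fps_X * Q $ 0" using assms(2) by simp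
  then have "fps_X * P $ 1 = fps_X * (- (Q $ 0))" by (simp add: minus_equation_iff)
  then show ?thesis by (rule X_cancel)
qed

lemma embU_mult_nth: "(embU a * F) $ n = a * F $ n" and mult_embU_nth: "(F * embU a) $ n = F $ n * a"
  by (simp_all add: embU_def)

lemma embV_nth: "embV a $ n = fps_const (a $ n)"
  by (simp add: embV_def)

lemma embU_nth_0: "embU a $ 0 = a"
  by (simp add: embU_def)

lemma double_cancel_all: "\<forall>a b :: 'a::calg. a + a = b + b \<longrightarrow> a = b"
  using double_cancel by blast

locale drinfeld_alg =
  fixes e f H :: "'a::calg fps"
  assumes drinfeld: "drinfeld e f H"
begin

definition "k = finv (shift (- 1/2) H)"
abbreviation "s \<equiv> shift (1/2) :: 'a fps \<Rightarrow> 'a fps"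
abbreviation "sm \<equiv> shift (- (1/2)) :: 'a fps \<Rightarrow> 'a fps"
text \<open>The zero modes x^-_0 and x^+_0 as constant series, hence invariant under shifts.\<close>

definition "E = fps_const (e $ 1)"
definition "F = fps_const (f $ 1)"
definition "x = - (sc (1/2) * (e * e))"
definition "y = - (sc (1/2) * (f * f))"
definition "k2 = k * H"

lemma nth_0 [simp]: "H $ 0 = 1" "e $ 0 = 0" "f $ 0 = 0" "k $ 0 = 1" "k2 $ 0 = 1" "x $ 0 = 0" "y $ 0 = 0"
  using drinfeld by (simp_all add: drinfeld_def k_def k2_def x_def y_def)

lemma HH: "commuting H H"
  and KE: "KE_rel k e" and KF: "KF_rel k f"
  and EF: "lin 0 * (cmt (embU e) (embV f)) = ep * (embU H - embV H)"
  and EE: "(lin 0 + lin 0) * (cmt (embU e) (embV e)) = ep * ((embU e - embV e) * (embU e - embV e))"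
  and FF: "(lin 0 + lin 0) * (cmt (embU f) (embV f)) = - (ep * ((embU f - embV f) * (embU f - embV f)))"
  using drinfeld by (simp_all add: drinfeld_def k_def)

lemma s_k: "s k = finv H" and sm_H: "sm H = finv k"
  by (simp_all add: k_def finv_shift shift_shift finv_finv)

lemma inv [simp]: "s k * H = 1" "H * s k = 1" "sm H * k = 1" "k * sm H = 1"
  by (simp_all only: s_k sm_H finv_left finv_right nth_0)

lemma inv_left [simp]: "s k * (H * z) = z" "H * (s k * z) = z" "sm H * (k * z) = z" "k * (sm H * z) = z"
  by (simp_all only: inv mult_1_left flip: mult.assoc)

lemma kH: "commuting k H" and kk: "commuting k k"
proof -
  have *: "commuting z k" if "commuting z H" for z
    unfolding k_def using commuting_finv_right[OF commuting_shift_right[OF that]] by simp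
  show "commuting k H" by (rule commuting_swap, rule *, rule HH)
  then show "commuting k k" by (rule *)
qed

lemma k2_eq: "k * H = k2" "H * k = k2" "sm H * k2 = H"
proof -
  show "k * H = k2" "H * k = k2" using commuting_shift[OF kH, of 0 0] by (simp_all add: k2_def)
  have "sm H * k2 = (sm H * k) * H" by (simp only: k2_def mult.assoc)
  then show "sm H * k2 = H" by (simp only: inv mult_1_left)
qed

lemma x_double: "x + x = - (e * e)" and y_double: "y + y = - (f * f)"
  unfolding x_def y_def by (rule minus_half_double)+

lemma shift_hom: "shift c (a + b) = shift c a + shift c b" "shift c (a * b) = shift c a * shift c b"
   "shift c (a - b) = shift c a - shift c b" "shift c (- a) = - shift c a" "shift c (1::'a fps) = 1"
  by (rule calg_hom_simps[OF calg_hom_shift])+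

lemma shift_E [simp]: "shift c E = E" and shift_F [simp]: "shift c F = F"
  by (simp_all add: E_def F_def)

lemma E_k: "E * k = k * E - k * e"
  using first_mode[OF KE[unfolded KE_rel_def]]
  by (simp add: embU_mult_nth mult_embU_nth embV_nth embU_nth_0 E_def) (simp add: algebra_simps)

lemma F_k: "k * F = F * k - f * k"
  using first_mode[OF KF[unfolded KF_rel_def]]
  by (simp add: embU_mult_nth mult_embU_nth embV_nth embU_nth_0 F_def) (simp add: algebra_simps)

lemma E_f: "E * f = f * E + 1 - H"
proof -
  have "lin 0 * (cmt (embU f) (embV e)) = ep * (embV H - embU H)"
    using arg_cong[OF EF, of swap] by (simp add: calg_hom_simps[OF calg_hom_swap] algebra_simps)
  from first_mode[OF this] show ?thesis
    by (simp add: embU_mult_nth mult_embU_nth embV_nth embU_nth_0 E_def) (simp add: algebra_simps)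
qed

lemma F_e: "e * F = F * e + 1 - H"
  using first_mode[OF EF]
  by (simp add: embU_mult_nth mult_embU_nth embV_nth embU_nth_0 F_def) (simp add: algebra_simps)

lemma E_e: "E * e = e * E - x"
proof -
  have "lin 0 * (cmt (embU e) (embV e) + (cmt (embU e) (embV e)))
     = ep * ((embU e - embV e) * (embU e - embV e))"
    using EE by (simp add: algebra_simps)
  from first_mode[OF this] have "e * E - E * e + (e * E - E * e) = - (e * e)"
    by (simp add: embU_mult_nth mult_embU_nth embV_nth embU_nth_0 E_def)
  from this[folded x_double] have "e * E - E * e = x" by (rule double_cancel)
  then show ?thesis by (simp add: algebra_simps)
qed

lemma F_f: "f * F = F * f - y"
proof -
  have "lin 0 * (cmt (embV f) (embU f) + (cmt (embV f) (embU f)))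
     = ep * ((embU f - embV f) * (embU f - embV f))"
    using FF by (simp add: algebra_simps neg_eq_iff_add_eq_0 eq_neg_iff_add_eq_0)
  from first_mode[OF this] have "F * f - f * F + (F * f - f * F) = - (f * f)"
    by (simp add: embU_mult_nth mult_embU_nth embV_nth embU_nth_0 F_def)
  from this[folded y_double] have "F * f - f * F = y" by (rule double_cancel)
  then show ?thesis by (simp add: algebra_simps)
qed

lemma E_sk: "E * s k = s k * E - s k * s e" and E_em: "E * sm e = sm e * E - sm x" and E_fm: "E * sm f = sm f * E + 1 - sm H"
  using arg_cong[OF E_k, of s] arg_cong[OF E_e, of sm] arg_cong[OF E_f, of sm]
  by (simp_all add: shift_hom)

lemma F_sk: "s k * F = F * s k - s f * s k" and F_fm: "sm f * F = F * sm f - sm y" and F_em: "sm e * F = F * sm e + 1 - sm H"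
  using arg_cong[OF F_k, of s] arg_cong[OF F_f, of sm] arg_cong[OF F_e, of sm]
  by (simp_all add: shift_hom)

lemma conj_inverse: "a * b = 1 \<Longrightarrow> b * a = 1 \<Longrightarrow> z * a = a * z - a * w \<Longrightarrow> z * b = b * z + w * (b :: 'b::ring_1)"
proof -
  assume a: "a * b = 1" "b * a = 1" and z: "z * a = a * z - a * w"
  have "b * (z * a) * b = b * (a * z - a * w) * b" unfolding z ..
  then have "b * z * (a * b) = (b * a) * z * b - (b * a) * w * b" by (simp add: algebra_simps)
  then show ?thesis by (simp add: a)
qed

lemma E_H: "E * H = H * E + s e * H"
  by (rule conj_inverse[OF inv(1,2) E_sk])

lemma F_H: "H * F = F * H + H * s f"
proof -
  have "H * (s k * F) * H = H * (F * s k - s f * s k) * H" unfolding F_sk ..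
  then have "(H * s k) * F * H = H * F * (s k * H) - H * s f * (s k * H)" by (simp add: algebra_simps)
  then show ?thesis by (simp add: algebra_simps)
qed

text \<open>The relation \<open>KE\<close> at v = u + c, shifted by 1/2 so that \<open>s k\<close>
  is H(u)^-1. The values c = -1 and c = -1/2 give the two exchange rules of H with e that
  equivariance needs.\<close>

lemma KE_shift: "sc (- c) * (s k * shift (c + 1/2) e - shift (c + 1/2) e * s k) = s k * (shift (c + 1/2) e - s e)"
proof -
  have "s (sc (0 - c) * spec c (cmt (embU k) (embV e))) = s (spec c (embU k * (embV e - embU e)))"
    unfolding spec_rel[OF KE[unfolded KE_rel_def]] ..
  then show ?thesis by (simp add: spec_simps shift_hom shift_shift calg_hom_sc[OF calg_hom_shift] add.commute)
qed

lemma KF_shift: "sc (- c) * (s k * shift (c + 1/2) f - shift (c + 1/2) f * s k) = (s f - shift (c + 1/2) f) * s k"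
proof -
  have "s (sc (0 - c) * spec c (cmt (embU k) (embV f))) = s (spec c ((embU f - embV f) * embU k))"
    unfolding spec_rel[OF KF[unfolded KF_rel_def]] ..
  then show ?thesis by (simp add: spec_simps shift_hom shift_shift calg_hom_sc[OF calg_hom_shift] add.commute)
qed

lemma H_em: "H * sm e = s e * H"
proof -
  have "sm e * s k = s k * s e" using KE_shift[of "- 1"] by (simp add: algebra_simps)
  then have "H * (sm e * s k) * H = H * (s k * s e) * H" by simp
  then have "H * sm e * (s k * H) = (H * s k) * s e * H" by (simp only: mult.assoc)
  then show ?thesis by simp
qed

lemma fm_H: "sm f * H = H * s f"
proof -
  have "s k * sm f = s f * s k" using KF_shift[of "- 1"] by (simp add: algebra_simps)
  then have "H * (s k * sm f) * H = H * (s f * s k) * H" by simp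
  then have "(H * s k) * sm f * H = H * s f * (s k * H)" by (simp only: mult.assoc)
  then show ?thesis by simp
qed

lemma H_e: "e * H + H * e = s e * H + s e * H"
proof -
  have "sc (1/2) * (s k * e - e * s k) = s k * (e - s e)" using KE_shift[of "- 1/2"] by simp
  then have "s k * e - e * s k = s k * (e - s e) + s k * (e - s e)"
    using half_double[of "s k * e - e * s k"] by simp
  then have "H * (s k * e - e * s k) * H = H * (s k * (e - s e) + s k * (e - s e)) * H" by simp
  then have "(H * s k) * e * H - H * e * (s k * H) = (H * s k) * (e - s e + (e - s e)) * H"
    by (simp add: algebra_simps)
  then show ?thesis by (simp add: algebra_simps)
qed

lemma f_H: "f * H + H * f = H * s f + H * s f"
proof -
  have "sc (1/2) * (s k * f - f * s k) = (s f - f) * s k" using KF_shift[of "- 1/2"] by simp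
  then have "s k * f - f * s k = (s f - f) * s k + (s f - f) * s k"
    using half_double[of "s k * f - f * s k"] by simp
  then have "H * (s k * f - f * s k) * H = H * ((s f - f) * s k + (s f - f) * s k) * H" by simp
  then have "(H * s k) * f * H - H * f * (s k * H) = H * (s f - f + (s f - f)) * (s k * H)"
    by (simp add: algebra_simps)
  then show ?thesis by (simp add: algebra_simps)
qed

lemmas H_e' = trans[OF add.commute H_e] and f_H' = trans[OF add.commute f_H]

text \<open>The quadratic relation of e at v = u - 1/2.\<close>

lemma e_em: "e * sm e + e * sm e = e * e + sm e * sm e"
proof -
  have "lin 0 * (cmt (embU e) (embV e) + (cmt (embU e) (embV e)))
     = ep * ((embU e - embV e) * (embU e - embV e))"
    using EE by (simp add: algebra_simps)
  from spec_rel[OF this, of "- 1/2"] have "sc (1/2) * (e * sm e - sm e * e) + sc (1/2) * (e * sm e - sm e * e) = (e - sm e) * (e - sm e)"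
    by (simp add: spec_simps distrib_left)
  then have "e * sm e - sm e * e = (e - sm e) * (e - sm e)" by (simp only: half_double)
  then show ?thesis by (simp add: algebra_simps)
qed

lemma f_fm: "sm f * f + sm f * f = f * f + sm f * sm f"
proof -
  have "lin 0 * (cmt (embV f) (embU f) + (cmt (embV f) (embU f)))
     = ep * ((embU f - embV f) * (embU f - embV f))"
    using FF by (simp add: algebra_simps neg_eq_iff_add_eq_0 eq_neg_iff_add_eq_0)
  from spec_rel[OF this, of "- 1/2"] have "sc (1/2) * (sm f * f - f * sm f) + sc (1/2) * (sm f * f - f * sm f) = (f - sm f) * (f - sm f)"
    by (simp add: spec_simps distrib_left)
  then have "sm f * f - f * sm f = (f - sm f) * (f - sm f)" by (simp only: half_double)
  then show ?thesis by (simp add: algebra_simps)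
qed

lemma sm_x_double: "sm x + sm x = - (sm e * sm e)" and sm_y_double: "sm y + sm y = - (sm f * sm f)"
  using arg_cong[OF x_double, of sm] arg_cong[OF y_double, of sm] by (simp_all add: shift_hom)

lemma e_x: "e * x = x * e" and f_y: "y * f = f * y"
  by (simp_all add: x_def y_def sc_left_commute mult.assoc)

lemmas E_equivariance = equivariance[OF double_cancel_all E_k E_H E_e E_em E_f E_fm x_double sm_x_double y_double
  H_e H_em f_H fm_H e_em e_x k2_eq]

lemma k2_fm: "k2 * sm H = H"
proof -
  have "H * sm H = sm H * H" using commuting_shift[OF HH, of 0 "- (1/2)"] by simp
  then show ?thesis by (simp add: k2_def mult.assoc)
qed

lemmas F_equivariance = equivariance_opposite[OF double_cancel_all F_k F_H F_f F_fm F_e F_em y_double sm_y_double x_double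
  f_H' fm_H H_e' H_em f_fm f_y k2_eq(2,1) k2_fm]

end

section \<open>Matrices over the index set and equivariance under the zero modes\<close>

definition mm :: "(idx3 \<Rightarrow> idx3 \<Rightarrow> 'a::ring_1) \<Rightarrow> (idx3 \<Rightarrow> idx3 \<Rightarrow> 'a) \<Rightarrow> idx3 \<Rightarrow> idx3 \<Rightarrow> 'a" where
  "mm A B i j = (\<Sum>m\<in>idxs. A i m * B m j)"

definition mone :: "idx3 \<Rightarrow> idx3 \<Rightarrow> 'a::ring_1" where
  "mone i j = (if i = j then 1 else 0)"

lemma in_idxs [simp]: "i \<in> idxs" by (cases i) (simp_all add: idxs_def)
lemma finite_idxs [simp]: "finite idxs" by (simp add: idxs_def)

lemma mm_assoc: "mm (mm A B) C = mm A (mm B C)"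
  by (intro ext) (simp add: mm_def sum_idxs algebra_simps)

lemma mm_one [simp]: "mm mone A = A" "mm A mone = A"
proof -
  have "mm mone A i j = A i j" "mm A mone i j = A i j" for i j
    by (cases i; cases j; simp add: mm_def mone_def sum_idxs)+
  then show "mm mone A = A" "mm A mone = A" by blast+
qed

text \<open>Here \<open>a b c\<close> stand for the inverses of the diagonal Gauss factors.\<close>

fun ginv :: "(gcomp \<Rightarrow> 'a::ring_1) \<Rightarrow> 'a \<Rightarrow> 'a \<Rightarrow> 'a \<Rightarrow> idx3 \<Rightarrow> idx3 \<Rightarrow> 'a" where
  "ginv g a b c Ip Ip = c"
| "ginv g a b c I0 Ip = - (g E01 * c)"
| "ginv g a b c Im Ip = (g Em10 * g E01 - g Em11) * c"
| "ginv g a b c Ip I0 = - (c * g F10)"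
| "ginv g a b c I0 I0 = b + g E01 * c * g F10"
| "ginv g a b c Im I0 = - (g Em10 * b) - (g Em10 * g E01 - g Em11) * c * g F10"
| "ginv g a b c Ip Im = c * (g F10 * g F0m1 - g F1m1)"
| "ginv g a b c I0 Im = - (b * g F0m1) - g E01 * c * (g F10 * g F0m1 - g F1m1)"
| "ginv g a b c Im Im = a + g Em10 * b * g F0m1 + (g Em10 * g E01 - g Em11) * c * (g F10 * g F0m1 - g F1m1)"

lemma gmat_ginv:
  assumes "a * g Km1 = 1" "g Km1 * a = 1" "b * g K0 = 1" "g K0 * b = 1" "c * g K1 = 1" "g K1 * c = 1"
  shows "mm (gmat g) (ginv g a b c) = mone" and "mm (ginv g a b c) (gmat g) = mone"
proof -
  have *: "a * (g Km1 * z) = z" "g Km1 * (a * z) = z" "b * (g K0 * z) = z" "g K0 * (b * z) = z"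
    "c * (g K1 * z) = z" "g K1 * (c * z) = z" for z
    by (simp_all add: assms flip: mult.assoc)
  have "mm (gmat g) (ginv g a b c) i j = mone i j" for i j
    by (cases i; cases j) (simp_all add: mm_def mone_def sum_idxs algebra_simps assms *)
  then show "mm (gmat g) (ginv g a b c) = mone" by blast
  have "mm (ginv g a b c) (gmat g) i j = mone i j" for i j
    by (cases i; cases j) (simp_all add: mm_def mone_def sum_idxs algebra_simps assms *)
  then show "mm (ginv g a b c) (gmat g) = mone" by blast
qed

text \<open>The action of the zero modes of \<open>x\<^sup>-\<close> and \<open>x\<^sup>+\<close> on matrices, as right minus left multiplication by a
  constant nilpotent matrix.\<close>

definition "actE t i j = (if j = Im then - t i I0 else if j = I0 then t i Ip else (0::'a::ring_1))
   + (if i = I0 then t Im j else if i = Ip then - t I0 j else 0)"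
definition "actF t i j = (if i = Im then t I0 j else if i = I0 then - t Ip j else (0::'a::ring_1))
   + (if j = I0 then - t i Im else if j = Ip then t i I0 else 0)"

definition equivariant :: "((idx3 \<Rightarrow> idx3 \<Rightarrow> 'a::ring_1) \<Rightarrow> idx3 \<Rightarrow> idx3 \<Rightarrow> 'a) \<Rightarrow> 'a \<Rightarrow> (idx3 \<Rightarrow> idx3 \<Rightarrow> 'a) \<Rightarrow> bool" where
  "equivariant act z t \<longleftrightarrow> (\<forall>i j. z * t i j - t i j * z = act t i j)"

definition "NE = (\<lambda>i j. if i = I0 \<and> j = Im then - 1 else if i = Ip \<and> j = I0 then 1 else (0::'a::ring_1))"
definition "NF = (\<lambda>i j. if i = Im \<and> j = I0 then - 1 else if i = I0 \<and> j = Ip then 1 else (0::'a::ring_1))"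

lemma actE_eq: "actE t i j = mm t NE i j - mm NE t i j" and actF_eq: "actF t i j = mm t NF i j - mm NF t i j"
  by (cases i; cases j; simp add: actE_def actF_def mm_def sum_idxs NE_def NF_def)+

text \<open>Equivariance says that z + N commutes with t; then it commutes with the inverse of t as
  well.\<close>

lemma equivariant_inverse:
  assumes "mm t r = mone" "mm r t = mone" and t: "equivariant (\<lambda>t i j. mm t N i j - mm N t i j) z t"
  shows "equivariant (\<lambda>t i j. mm t N i j - mm N t i j) z r"
proof -
  let ?z = "\<lambda>i j. z * mone i j :: 'a"
  have z: "mm ?z a i j = z * a i j" "mm a ?z i j = a i j * z" for a i j
    by (cases i; cases j; simp add: mm_def mone_def sum_idxs)+
  have add: "mm a (\<lambda>i j. b i j + c i j) = (\<lambda>i j. mm a b i j + mm a c i j)"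
    "mm (\<lambda>i j. b i j + c i j) a = (\<lambda>i j. mm b a i j + mm c a i j)" for a b c :: "idx3 \<Rightarrow> idx3 \<Rightarrow> 'a"
    by (simp_all add: mm_def fun_eq_iff algebra_simps sum.distrib)
  have "(\<lambda>i j. mm ?z t i j + mm N t i j) = (\<lambda>i j. mm t ?z i j + mm t N i j)"
    using t by (auto simp: equivariant_def fun_eq_iff z algebra_simps)
  then have "mm (mm r (\<lambda>i j. mm ?z t i j + mm N t i j)) r = mm (mm r (\<lambda>i j. mm t ?z i j + mm t N i j)) r"
    by simp
  then have "(\<lambda>i j. mm r ?z i j + mm r N i j) = (\<lambda>i j. mm ?z r i j + mm N r i j)"
    by (simp add: add mm_assoc assms(1)) (simp add: assms(2) flip: mm_assoc)
  then show ?thesis by (auto simp: equivariant_def fun_eq_iff z algebra_simps)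
qed

text \<open>Transposition reverses the products with the nilpotent matrix and sends that matrix to
  its negative; the two signs cancel.\<close>

lemma equivariant_transpose:
  assumes "equivariant actE z t" shows "equivariant actE z (\<lambda>i j. t (neg3 j) (neg3 i))"
  unfolding equivariant_def
proof (intro allI)
  fix i j show "z * t (neg3 j) (neg3 i) - t (neg3 j) (neg3 i) * z = actE (\<lambda>i j. t (neg3 j) (neg3 i)) i j"
    using assms[unfolded equivariant_def, rule_format, of "neg3 j" "neg3 i"]
    by (cases i; cases j) (simp_all add: actE_def)
qed

lemma equivariant_transpose':
  assumes "equivariant actF z t" shows "equivariant actF z (\<lambda>i j. t (neg3 j) (neg3 i))"
  unfolding equivariant_def
proof (intro allI)
  fix i j show "z * t (neg3 j) (neg3 i) - t (neg3 j) (neg3 i) * z = actF (\<lambda>i j. t (neg3 j) (neg3 i)) i j"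
    using assms[unfolded equivariant_def, rule_format, of "neg3 j" "neg3 i"]
    by (cases i; cases j) (simp_all add: actF_def)
qed

lemma equivariant_diff:
  "equivariant actE z t \<Longrightarrow> equivariant actE z r \<Longrightarrow> equivariant actE z (\<lambda>i j. t i j - r i j)"
  "equivariant actF z t \<Longrightarrow> equivariant actF z r \<Longrightarrow> equivariant actF z (\<lambda>i j. t i j - r i j)"
  by (auto simp: equivariant_def actE_def actF_def algebra_simps)

text \<open>As an \<open>so(3)\<close>-module the matrix space is generated by its lower right block.\<close>

lemma equivariant_zero:
  assumes E: "equivariant actE z t" and F: "equivariant actF w t"
    and 0: "t I0 I0 = 0" "t I0 Ip = 0" "t Ip I0 = 0" "t Ip Ip = 0"
  shows "t i j = 0"
proof -
  have *: "z * t i j - t i j * z = actE t i j" "w * t i j - t i j * w = actF t i j" for i j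
    using E F by (auto simp: equivariant_def)
  have 1: "t Im I0 = 0" "t Im Ip = 0" using *(1)[of I0 I0] *(1)[of I0 Ip] by (simp_all add: actE_def 0)
  have 2: "t I0 Im = 0" "t Ip Im = 0" using *(2)[of I0 I0] *(2)[of Ip I0] by (simp_all add: actF_def 0)
  have "t Im Im = 0" using *(2)[of Im I0] by (simp add: actF_def 0 1)
  with 0 1 2 show ?thesis by (cases i; cases j) simp_all
qed

context drinfeld_alg
begin

definition "T = gmat (drinfeld_gauss e f H)"

lemma T_entries: "T Im Im = k" "T Im I0 = k * e" "T Im Ip = k * x" "T I0 Im = f * k" "T I0 I0 = k2 + f * k * e"
  "T I0 Ip = f * k * x - k2 * sm e" "T Ip Im = y * k" "T Ip I0 = y * k * e - sm f * k2"
  "T Ip Ip = H + y * k * x + sm f * k2 * sm e"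
  by (simp_all add: T_def k_def k2_def x_def y_def)

lemma T_nth_0: "T i j $ 0 = (if i = j then 1 else 0)"
  by (cases i; cases j) (simp_all add: T_entries)

lemma T_equivariant_E: "equivariant actE E T"
  unfolding equivariant_def
proof (intro allI)
  fix i j show "E * T i j - T i j * E = actE T i j"
    using E_equivariance E_k by (cases i; cases j) (simp_all add: T_entries actE_def)
qed

lemma T_equivariant_F: "equivariant actF F T"
  unfolding equivariant_def
proof (intro allI)
  fix i j
  have "k * F - F * k = - (f * k)" using F_k by (simp add: algebra_simps)
  note F_equivariance' = this F_equivariance[unfolded mult.assoc]
  have "T i j * F - F * T i j = - actF T i j"
    by (cases i; cases j) (simp_all add: T_entries actF_def mult.assoc F_equivariance')
  then show "F * T i j - T i j * F = actF T i j" by (metis minus_diff_eq minus_minus)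
qed

definition "R = ginv (drinfeld_gauss e f H) (finv k) (finv k2) (s k)"

lemma T_R: "mm T R = mone" and R_T: "mm R T = mone"
proof -
  have "drinfeld_gauss e f H Km1 = k" "drinfeld_gauss e f H K0 = k2" "drinfeld_gauss e f H K1 = H"
    by (simp_all add: k_def k2_def)
  then show "mm T R = mone" "mm R T = mone"
    unfolding T_def R_def by (intro gmat_ginv; simp only: finv_left finv_right nth_0 inv)+
qed

lemma se_fm: "s e * sm f - sm f * s e = s H - sm H"
proof -
  have "e * shift (- 1) f - shift (- 1) f * e = H - shift (- 1) H"
    using spec_rel[OF EF, of "- 1"] by (simp add: spec_simps)
  then have "s (e * shift (- 1) f - shift (- 1) f * e) = s (H - shift (- 1) H)" by (rule arg_cong)
  then show ?thesis by (simp add: calg_hom_simps[OF calg_hom_shift] shift_shift)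
qed

text \<open>\<open>R\<close> is the inverse of T computed from its Gauss factors. Its difference
  from T^t(u + 1/2) is equivariant under both zero modes, so only the lower right block is compared;
  EF enters through the entry (0,0).\<close>

lemma R_eq: "R i j = s (T (neg3 j) (neg3 i))"
proof -
  let ?t = "\<lambda>i j. R i j - s (T (neg3 j) (neg3 i))"
  have ske: "s (k * e) = sm e * s k" "s (f * k) = s k * sm f"
    using arg_cong[OF KE_rel_spec[OF KE], of s] arg_cong[OF KF_rel_spec[OF KF], of s]
    by (simp_all add: shift_hom shift_shift)
  have sT: "equivariant actE E (\<lambda>i j. s (T i j))" "equivariant actF F (\<lambda>i j. s (T i j))"
    unfolding equivariant_def
  proof safe
    fix i j
    show "E * s (T i j) - s (T i j) * E = actE (\<lambda>i j. s (T i j)) i j"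
      using arg_cong[OF T_equivariant_E[unfolded equivariant_def, rule_format, of i j], of s]
      by (cases i; cases j) (simp_all add: actE_def shift_hom calg_hom_zero[OF calg_hom_shift])
    show "F * s (T i j) - s (T i j) * F = actF (\<lambda>i j. s (T i j)) i j"
      using arg_cong[OF T_equivariant_F[unfolded equivariant_def, rule_format, of i j], of s]
      by (cases i; cases j) (simp_all add: actF_def shift_hom calg_hom_zero[OF calg_hom_shift])
  qed
  have E: "equivariant actE E ?t"
    using equivariant_inverse[OF T_R R_T T_equivariant_E[unfolded actE_eq[abs_def]]]
    by (intro equivariant_diff equivariant_transpose sT) (simp add: actE_eq[abs_def])
  have F: "equivariant actF F ?t"
    using equivariant_inverse[OF T_R R_T T_equivariant_F[unfolded actF_eq[abs_def]]]
    by (intro equivariant_diff equivariant_transpose' sT) (simp add: actF_eq[abs_def])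
  have R: "R Ip Ip = s k" "R I0 Ip = sm e * s k" "R Ip I0 = s k * sm f" "R I0 I0 = finv k2 + sm e * s k * sm f"
    by (simp_all add: R_def)
  have "finv k2 = s k * sm H"
  proof (rule finv_unique[symmetric])
    have "s k * sm H * k2 = s k * (sm H * k2)" by (simp only: mult.assoc)
    then show "s k * sm H * k2 = 1" by (simp add: k2_eq)
  qed simp
  moreover have "s (k2 + f * k * e) = s k * s H + s k * sm f * s e"
    by (simp add: shift_hom ske(2)[unfolded shift_hom] k2_def)
  moreover have "sm e * s k * sm f = s k * (s e * sm f)"
    unfolding ske(1)[symmetric] by (simp add: shift_hom mult.assoc)
  moreover have "s e * sm f = sm f * s e + s H - sm H" using se_fm by (simp add: algebra_simps)
  ultimately have 1: "?t I0 I0 = 0" by (simp add: R T_entries algebra_simps)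
  have 2: "?t I0 Ip = 0" "?t Ip I0 = 0" "?t Ip Ip = 0"
    unfolding R neg3.simps T_entries ske by simp_all
  have "?t i j = 0" by (rule equivariant_zero[OF E F 1 2])
  then show ?thesis by simp
qed

lemma unitarity:
  "(\<Sum>m\<in>idxs. T i m * s (T (neg3 j) (neg3 m))) = (if i = j then 1 else 0)"
  "(\<Sum>m\<in>idxs. s (T (neg3 m) (neg3 i)) * T m j) = (if i = j then 1 else 0)"
  using fun_cong[OF fun_cong[OF T_R], of i j] fun_cong[OF fun_cong[OF R_T], of i j]
  by (simp_all add: mm_def mone_def R_eq)

end

subsection \<open>Equivariance of the RTT relations\<close>

text \<open>The relation as a linear function of the two products: \<open>B\<close> stands for
  T_1(u) T_2(v) and \<open>C\<close> for T_2(v) T_1(u). Separating them makes the invariance of R(u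
  - v) a statement about arbitrary tensors.\<close>

definition relB :: "(idx3 \<Rightarrow> idx3 \<Rightarrow> idx3 \<Rightarrow> idx3 \<Rightarrow> 'a::calg fps fps) \<Rightarrow> (idx3 \<Rightarrow> idx3 \<Rightarrow> idx3 \<Rightarrow> idx3 \<Rightarrow> 'a fps fps)
    \<Rightarrow> idx3 \<Rightarrow> idx3 \<Rightarrow> idx3 \<Rightarrow> idx3 \<Rightarrow> 'a fps fps" where
  "relB B C i k j l = lin 0 * (lin (- 1/2) * (B i k j l - C i k j l)) - ep * (lin (- 1/2) * (B k i j l - C i k l j))
     + ep * (lin 0 * ((if k = neg3 i then \<Sum>p\<in>idxs. B p (neg3 p) j l else 0)
                    - (if l = neg3 j then \<Sum>p\<in>idxs. C i k p (neg3 p) else 0)))"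

lemma rel_eq_relB:
  "rel T = relB (\<lambda>i k j l. embU (T i j) * embV (T k l)) (\<lambda>i k j l. embV (T k l) * embU (T i j))"
  by (intro ext) (simp add: rel_def relB_def)

definition act4E :: "(idx3 \<Rightarrow> idx3 \<Rightarrow> idx3 \<Rightarrow> idx3 \<Rightarrow> 'a::ring_1) \<Rightarrow> idx3 \<Rightarrow> idx3 \<Rightarrow> idx3 \<Rightarrow> idx3 \<Rightarrow> 'a" where
  "act4E X i k j l = actE (\<lambda>i j. X i k j l) i j + actE (\<lambda>k l. X i k j l) k l"

definition act4F :: "(idx3 \<Rightarrow> idx3 \<Rightarrow> idx3 \<Rightarrow> idx3 \<Rightarrow> 'a::ring_1) \<Rightarrow> idx3 \<Rightarrow> idx3 \<Rightarrow> idx3 \<Rightarrow> idx3 \<Rightarrow> 'a" where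
  "act4F X i k j l = actF (\<lambda>i j. X i k j l) i j + actF (\<lambda>k l. X i k j l) k l"

text \<open>The nilpotent matrix lies in so_3, so its action on the tensor product commutes with P
  and Q.\<close>

lemma relB_act4E: "relB (act4E B) (act4E C) i k j l = act4E (relB B C) i k j l"
  by (cases i; cases k; cases j; cases l)
     (simp_all add: relB_def act4E_def actE_def sum_idxs right_diff_distrib distrib_left)

lemma relB_act4F: "relB (act4F B) (act4F C) i k j l = act4F (relB B C) i k j l"
  by (cases i; cases k; cases j; cases l)
     (simp_all add: relB_def act4F_def actF_def sum_idxs right_diff_distrib distrib_left)

lemma relB_commutator:
  "z * relB B C i k j l - relB B C i k j l * z =
    relB (\<lambda>i k j l. z * B i k j l - B i k j l * z) (\<lambda>i k j l. z * C i k j l - C i k j l * z) i k j l"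
proof -
  have *: "z * (lin c * w) = lin c * (z * w)" "z * (ep * w) = ep * (z * w)" for c w
    by (rule centralD'[OF central_lin] centralD'[OF central_ep])+
  show ?thesis
    by (simp add: relB_def sum_idxs distrib_left distrib_right left_diff_distrib right_diff_distrib * mult.assoc)
qed

lemma rel_equivariant_E:
  assumes "equivariant actE z (\<lambda>i j. embU (T i j))" "equivariant actE z (\<lambda>i j. embV (T i j))"
  shows "z * rel T i k j l - rel T i k j l * z = act4E (rel T) i k j l"
proof -
  have "z * (embU (T i j) * embV (T k l)) - embU (T i j) * embV (T k l) * z
     = act4E (\<lambda>i k j l. embU (T i j) * embV (T k l)) i k j l"
    "z * (embV (T k l) * embU (T i j)) - embV (T k l) * embU (T i j) * z
     = act4E (\<lambda>i k j l. embV (T k l) * embU (T i j)) i k j l" for i k j l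
  proof -
    have "z * (embU (T i j) * embV (T k l)) - embU (T i j) * embV (T k l) * z
      = actE (\<lambda>i j. embU (T i j)) i j * embV (T k l) + embU (T i j) * actE (\<lambda>i j. embV (T i j)) k l"
      "z * (embV (T k l) * embU (T i j)) - embV (T k l) * embU (T i j) * z
      = actE (\<lambda>i j. embV (T i j)) k l * embU (T i j) + embV (T k l) * actE (\<lambda>i j. embU (T i j)) i j"
      by (simp_all add: algebra_simps flip: assms[unfolded equivariant_def, rule_format])
    then show "z * (embU (T i j) * embV (T k l)) - embU (T i j) * embV (T k l) * z
     = act4E (\<lambda>i k j l. embU (T i j) * embV (T k l)) i k j l"
    "z * (embV (T k l) * embU (T i j)) - embV (T k l) * embU (T i j) * z
     = act4E (\<lambda>i k j l. embV (T k l) * embU (T i j)) i k j l"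
      by (simp_all add: act4E_def actE_def distrib_left distrib_right)
  qed
  then show ?thesis
    unfolding rel_eq_relB relB_commutator by (simp flip: relB_act4E)
qed

lemma rel_equivariant_F:
  assumes "equivariant actF z (\<lambda>i j. embU (T i j))" "equivariant actF z (\<lambda>i j. embV (T i j))"
  shows "z * rel T i k j l - rel T i k j l * z = act4F (rel T) i k j l"
proof -
  have "z * (embU (T i j) * embV (T k l)) - embU (T i j) * embV (T k l) * z
     = act4F (\<lambda>i k j l. embU (T i j) * embV (T k l)) i k j l"
    "z * (embV (T k l) * embU (T i j)) - embV (T k l) * embU (T i j) * z
     = act4F (\<lambda>i k j l. embV (T k l) * embU (T i j)) i k j l" for i k j l
  proof -
    have "z * (embU (T i j) * embV (T k l)) - embU (T i j) * embV (T k l) * z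
      = actF (\<lambda>i j. embU (T i j)) i j * embV (T k l) + embU (T i j) * actF (\<lambda>i j. embV (T i j)) k l"
      "z * (embV (T k l) * embU (T i j)) - embV (T k l) * embU (T i j) * z
      = actF (\<lambda>i j. embV (T i j)) k l * embU (T i j) + embV (T k l) * actF (\<lambda>i j. embU (T i j)) i j"
      by (simp_all add: algebra_simps flip: assms[unfolded equivariant_def, rule_format])
    then show "z * (embU (T i j) * embV (T k l)) - embU (T i j) * embV (T k l) * z
     = act4F (\<lambda>i k j l. embU (T i j) * embV (T k l)) i k j l"
    "z * (embV (T k l) * embU (T i j)) - embV (T k l) * embU (T i j) * z
     = act4F (\<lambda>i k j l. embV (T k l) * embU (T i j)) i k j l"
      by (simp_all add: act4F_def actF_def distrib_left distrib_right)
  qed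
  then show ?thesis
    unfolding rel_eq_relB relB_commutator by (simp flip: relB_act4F)
qed

text \<open>The zero mode of e raises the column index \<open>j\<close> from -1 to 0 to 1, then the
  zero mode of f raises the row index \<open>i\<close>; the other terms of each commutator are
  already known to vanish.\<close>

lemma rel_zero_of_first_row:
  assumes E: "equivariant actE z (\<lambda>i j. embU (T i j))" "equivariant actE z (\<lambda>i j. embV (T i j))"
    and F: "equivariant actF w (\<lambda>i j. embU (T i j))" "equivariant actF w (\<lambda>i j. embV (T i j))"
    and 0: "\<And>k l. rel T Im k Im l = 0"
  shows "rel T i k j l = 0"
proof -
  note * = rel_equivariant_E[OF E] and ** = rel_equivariant_F[OF F]
  have 1: "rel T Im k I0 l = 0" for k l
    using *[of Im k Im l] by (cases k; cases l) (simp_all add: act4E_def actE_def 0)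
  have 2: "rel T Im k Ip l = 0" for k l
    using *[of Im k I0 l] by (cases k; cases l) (simp_all add: act4E_def actE_def 0 1)
  have 3: "rel T Im k j l = 0" for k j l
    using 0 1 2 by (cases j) simp_all
  have 4: "rel T I0 k j l = 0" for k j l
    using **[of Im k j l] by (cases k; cases j; cases l) (simp_all add: act4F_def actF_def 3)
  have 5: "rel T Ip k j l = 0" for k j l
    using **[of I0 k j l] by (cases k; cases j; cases l) (simp_all add: act4F_def actF_def 3 4)
  show ?thesis using 3 4 5 by (cases i) simp_all
qed

subsection \<open>Crossing symmetry\<close>

lemma sandwich:
  assumes "mm t r = mone" "mm r t = mone"
  shows "mm (mm r (\<lambda>i j. mm a t i j - mm t b i j)) r k l = mm r a k l - mm b r k l"
proof -
  have "mm (mm r (\<lambda>i j. mm a t i j - mm t b i j)) r = (\<lambda>k l. mm r (mm a (mm t r)) k l - mm (mm r t) (mm b r) k l)"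
    by (simp add: mm_def sum_idxs fun_eq_iff algebra_simps)
  then show ?thesis by (simp add: assms)
qed

text \<open>Conjugating the matrix of relations with first row and column index \<open>-1\<close> by \<open>T(v)\<^sup>-\<^sup>1\<close>, which is
  \<open>T\<^sup>t(v + 1/2)\<close>, gives the relations with the two tensor factors exchanged, at \<open>v + 1/2\<close>. The function
  \<open>flip\<close> performs this change of variables.\<close>

definition "flip F = shift (1/2) (swap F)"

lemma flip_simps: "flip (a + b) = flip a + flip b" "flip (a * b) = flip a * flip b" "flip (a - b) = flip a - flip b" "flip 0 = 0"
  "flip (embU c) = embV (shift (1/2) c)" "flip (embV c) = embU c"
  by (simp_all add: flip_def calg_hom_simps[OF calg_hom_shift] calg_hom_simps[OF calg_hom_swap])

text \<open>\<open>flip\<close> sends u - v + c to -(u - v - c - 1/2), so it exchanges u - v and u -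
  v - 1/2 up to sign, and with them the denominators of P and Q. The factor \<open>w\<close> clears
  the shifted denominator v + 1/2, once for each of the two factors.\<close>

lemma flip_lin:
  fixes F :: "'a::calg fps fps"
  defines "w \<equiv> 1 + sc (1/2) * fps_X"
  shows "w * (w * flip (lin c * (lin d * F))) = lin (- c - 1/2) * (lin (- d - 1/2) * flip F)"
    and "w * (w * flip (ep * (lin d * F))) = - (ep * (lin (- d - 1/2) * flip F))"
proof -
  have w: "central w" unfolding w_def
    using central_add[OF central_sc[of 1] central_mult[OF central_sc central_X]] by simp
  have 1: "w * flip (lin c) = - lin (- c - 1/2)" for c
    unfolding w_def flip_def by (simp add: calg_hom_minus[OF calg_hom_shift]) (simp only: shift_lin)
  have 2: "w * flip ep = (ep :: 'a fps fps)"
    unfolding w_def flip_def swap_ep by (rule shift_ep)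
  have "w * (w * (x * (y * z))) = (w * x) * ((w * y) * z)" for x y z
    by (simp only: mult.assoc centralD'[OF w, of x])
  then have "w * (w * flip (lin c * (lin d * F))) = (w * flip (lin c)) * ((w * flip (lin d)) * flip F)"
    "w * (w * flip (ep * (lin d * F))) = (w * flip ep) * ((w * flip (lin d)) * flip F)"
    by (simp_all only: flip_simps)
  then show "w * (w * flip (lin c * (lin d * F))) = lin (- c - 1/2) * (lin (- d - 1/2) * flip F)"
    "w * (w * flip (ep * (lin d * F))) = - (ep * (lin (- d - 1/2) * flip F))"
    unfolding 1 2 by simp_all
qed

lemma crossing:
  fixes T R :: "idx3 \<Rightarrow> idx3 \<Rightarrow> 'a::calg fps"
  assumes TR: "mm T R = mone" "mm R T = mone" and R: "\<And>i j. R i j = shift (1/2) (T (neg3 j) (neg3 i))"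
  defines "w \<equiv> (1 + sc (1/2) * fps_X :: 'a fps fps)"
  shows "mm (mm (\<lambda>i j. embV (R i j)) (\<lambda>k l. rel T Im k Im l)) (\<lambda>i j. embV (R i j)) k l
     = w * (w * flip (rel T (neg3 l) Im (neg3 k) Im))"
proof -
  let ?a = "embU (T Im Im)" and ?t = "\<lambda>i j. embV (T i j)" and ?r = "\<lambda>i j. embV (R i j)"
  have V: "mm ?t ?r = mone" "mm ?r ?t = mone"
  proof -
    have "mm ?t ?r i j = embV (mm T R i j)" "mm ?r ?t i j = embV (mm R T i j)" for i j
      by (simp_all add: mm_def sum_idxs emb_simps)
    then show "mm ?t ?r = mone" "mm ?r ?t = mone"
      by (simp_all add: fun_eq_iff TR mone_def emb_simps)
  qed
  \<comment> \<open>The relations have the form A T(v) - T(v) B, with A and B built from entries of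
    T(u) and central factors; the three summands come from the identity, P and Q. Multiplying by
    T(v)^-1 on both sides leaves T(v)^-1 A - B T(v)^-1.\<close>
  define A where "A i j = (if i = j then lin 0 * (lin (- 1/2) * ?a) else 0)
     - (if j = Im then ep * (lin (- 1/2) * embU (T i Im)) else 0)
     + (if i = Ip then ep * (lin 0 * embU (T (neg3 j) Im)) else 0)" for i j
  define B where "B i j = (if i = j then lin 0 * (lin (- 1/2) * ?a) else 0)
     - (if i = Im then ep * (lin (- 1/2) * embU (T Im j)) else 0)
     + (if j = Ip then ep * (lin 0 * embU (T Im (neg3 i))) else 0)" for i j
  have *: "embV z * (lin c * u) = lin c * (embV z * u)" "embV z * (ep * u) = ep * (embV z * u)" for z u and c
    by (rule centralD'[OF central_lin] centralD'[OF central_ep])+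
  have "rel T Im k Im l = mm A ?t k l - mm ?t B k l" for k l
    by (cases k; cases l)
       (simp_all add: rel_def mm_def sum_idxs A_def B_def distrib_left distrib_right left_diff_distrib right_diff_distrib mult.assoc *)
  then have "mm (mm ?r (\<lambda>k l. rel T Im k Im l)) ?r k l = mm ?r A k l - mm B ?r k l"
    using sandwich[OF V, of A B k l] by simp
  also have "\<dots> = w * (w * flip (rel T (neg3 l) Im (neg3 k) Im))"
  proof -
    have "flip (x - y + z) = flip x - flip y + flip z" for x y z :: "'a fps fps"
      by (simp add: flip_simps)
    then have "w * (w * flip (lin 0 * (lin (- 1/2) * x) - ep * (lin (- 1/2) * y) + ep * (lin 0 * z)))
      = lin (- 1/2) * (lin 0 * flip x) + ep * (lin 0 * flip y) - ep * (lin (- 1/2) * flip z)" for x y z :: "'a fps fps"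
      unfolding w_def by (simp only: distrib_left right_diff_distrib flip_lin) simp
    then have "w * (w * flip (rel T K Im L Im)) = lin (- 1/2) * (lin 0 * flip (cmt (embU (T K L)) (embV (T Im Im))))
     + ep * (lin 0 * flip (embU (T Im L) * embV (T K Im) - embV (T Im L) * embU (T K Im)))
     - ep * (lin (- 1/2) * flip ((if Im = neg3 K then \<Sum>p\<in>idxs. embU (T p L) * embV (T (neg3 p) Im) else 0)
                    - (if Im = neg3 L then \<Sum>p\<in>idxs. embV (T Im (neg3 p)) * embU (T K p) else 0)))" for K L
      unfolding rel_def .
    moreover have "lin (- (1/2)) * (lin 0 * u) = lin 0 * (lin (- (1/2)) * u :: 'a fps fps)" for u
      by (rule centralD'[OF central_lin])
    ultimately show ?thesis
      by (cases k; cases l)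
         (simp_all add: mm_def sum_idxs A_def B_def flip_simps R distrib_left distrib_right left_diff_distrib right_diff_distrib mult.assoc *)
  qed
  finally show ?thesis .
qed

text \<open>The outer factors are the lower right block of the inverse of a matrix with a Gauss decomposition, hence
  invertible.\<close>

lemma block_zero:
  fixes p q r t :: "'b::ring_1"
  assumes c: "c * c' = 1" "c' * c = 1" and b: "b * b' = 1" "b' * b = 1"
    and 0: "(b + m * c * n) * p * (b + m * c * n) + (b + m * c * n) * q * (c * n) + m * c * r * (b + m * c * n) + m * c * t * (c * n) = 0"
      "(b + m * c * n) * p * (m * c) + (b + m * c * n) * q * c + m * c * r * (m * c) + m * c * t * c = 0"
      "c * n * p * (b + m * c * n) + c * n * q * (c * n) + c * r * (b + m * c * n) + c * t * (c * n) = 0"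
      "c * n * p * (m * c) + c * n * q * c + c * r * (m * c) + c * t * c = 0"
  shows "p = 0 \<and> q = 0 \<and> r = 0 \<and> t = 0"
proof -
  let ?M = "b + m * c * n"
  \<comment> \<open>The entries of the invertible block times the unknown matrix. Cancelling the
    block on the right makes them vanish, cancelling it on the left then makes the matrix
    vanish.\<close>
  define P where "P = ?M * p + m * c * r"
  define Q where "Q = ?M * q + m * c * t"
  define P' where "P' = c * n * p + c * r"
  define Q' where "Q' = c * n * q + c * t"
  have 1: "P * ?M + Q * (c * n) = 0" "P * (m * c) + Q * c = 0" "P' * ?M + Q' * (c * n) = 0" "P' * (m * c) + Q' * c = 0"
    using 0 by (simp_all add: P_def Q_def P'_def Q'_def algebra_simps)
  have zero: "X = 0 \<and> Y = 0" if "X * ?M + Y * (c * n) = 0" "X * (m * c) + Y * c = 0" for X Y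
  proof -
    have "X * b + (X * (m * c) + Y * c) * n = 0" using that(1) by (simp add: algebra_simps)
    then have "X * b * b' = 0" using that(2) by simp
    then have X: "X = 0" by (simp add: mult.assoc b)
    then have "Y * c * c' = 0" using that(2) by simp
    with X show ?thesis by (simp add: mult.assoc c)
  qed
  have 2: "P = 0" "Q = 0" "P' = 0" "Q' = 0" using zero[OF 1(1,2)] zero[OF 1(3,4)] by auto
  have zero': "X = 0 \<and> Y = 0" if "?M * X + m * c * Y = 0" "c * n * X + c * Y = 0" for X Y
  proof -
    have "b * X + m * (c * n * X + c * Y) = 0" using that(1) by (simp add: algebra_simps)
    then have "b' * (b * X) = 0" using that(2) by simp
    then have X: "X = 0" by (simp add: b flip: mult.assoc)
    then have "c' * (c * Y) = 0" using that(2) by simp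
    with X show ?thesis by (simp add: c flip: mult.assoc)
  qed
  show ?thesis using zero'[of p r] zero'[of q t] 2 by (simp add: P_def Q_def P'_def Q'_def)
qed

section \<open>Verification of the RTT relations that contain k(u) or k(v)\<close>

context drinfeld_alg
begin

lemma T_emb:
  "embU (T Im Im) = embU k" "embU (T Im I0) = embU k * embU e" "embU (T Im Ip) = embU k * embU x"
  "embU (T I0 Im) = embU f * embU k" "embU (T Ip Im) = embU y * embU k"
  "embU (T I0 I0) = embU k2 + embU f * embU k * embU e"
  "embV (T Im Im) = embV k" "embV (T Im I0) = embV k * embV e" "embV (T Im Ip) = embV k * embV x"
  "embV (T I0 Im) = embV f * embV k" "embV (T Ip Im) = embV y * embV k"
  "embV (T I0 I0) = embV k2 + embV f * embV k * embV e"
  by (simp_all add: T_entries emb_simps)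

lemmas kk' = kk[unfolded commuting_def]
lemmas KE' = KE[unfolded KE_rel_def] and KE_swap = KE_rel_swap[OF KE]
lemmas KF' = KF[unfolded KF_rel_def] and KF_swap = KF_rel_swap[OF KF]

lemma commuting_k2: "commuting k2 k" "commuting H k"
proof -
  show H: "commuting H k" by (rule commuting_swap[OF kH])
  have "embU k * embU H * embV k = embU k * (embV k * embU H)" using H by (simp only: commuting_def mult.assoc)
  also have "\<dots> = (embV k * embU k) * embU H" using kk by (simp only: commuting_def flip: mult.assoc)
  finally show "commuting k2 k" by (simp add: commuting_def k2_def emb_simps mult.assoc)
qed

lemma rel_noQ_zeroI:
  assumes "lin 0 * (embU (t i j) * embV (t m l) - embV (t m l) * embU (t i j))
    = ep * (embU (t m j) * embV (t i l) - embV (t m j) * embU (t i l))"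
    and "m \<noteq> neg3 i" "l \<noteq> neg3 j"
  shows "rel t i m j l = (0 :: 'b::calg fps fps)"
proof -
  let ?C = "embU (t i j) * embV (t m l) - embV (t m l) * embU (t i j)"
  have "lin 0 * (lin (- 1/2) * ?C) = lin (- 1/2) * (lin 0 * ?C)" by (rule centralD'[OF central_lin, symmetric])
  also have "\<dots> = ep * (lin (- 1/2) * (embU (t m j) * embV (t i l) - embV (t m j) * embU (t i l)))"
    unfolding assms(1) by (rule centralD'[OF central_ep])
  finally show ?thesis using assms(2,3) by (simp add: rel_def)
qed

text \<open>The digits in these names are the indices i, j, k, l of t_ij(u) and t_kl(v), with 1, 2,
  3 for -1, 0, 1.\<close>

lemma rel_1112: "rel T Im Im Im I0 = 0"
  using raw_of_KE[OF central_lin central_ep kk' KE'] by (intro rel_noQ_zeroI) (simp_all add: T_emb)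

lemma rel_1111: "rel T Im Im Im Im = 0"
  using kk' by (intro rel_noQ_zeroI) (simp_all add: T_emb)

lemma rel_1121: "rel T Im I0 Im Im = 0"
proof (rule rel_noQ_zeroI)
  have "(cmt (embV f) (embU k)) * lin 0 = (embV f - embU f) * embU k * ep"
    unfolding centralD[OF central_lin[of 0], of "_ - _"] centralD[OF central_ep, of "_ * embU k"]
    using KF' by (simp add: algebra_simps)
  from raw_of_KF[OF central_lin central_ep kk'[symmetric] this]
  show "lin 0 * (cmt (embU (T Im Im)) (embV (T I0 Im)))
    = ep * (embU (T I0 Im) * embV (T Im Im) - embV (T I0 Im) * embU (T Im Im))"
    unfolding centralD[OF central_lin[of 0], of "_ - _"] centralD[OF central_ep, of "_ - _"] T_emb
    by (simp add: algebra_simps)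
qed simp_all

lemma lin0_lin0_double_zero: "lin 0 * (lin 0 * (B + B + (B + B))) = 0 \<Longrightarrow> B = (0 :: 'b::calg fps fps)"
  by (meson double_eq_zero lin_cancel_0)

lemma emb_doubles:
  "embU x + embU x = - (embU e * embU e)" "embV x + embV x = - (embV e * embV e)"
  "embU y + embU y = - (embU f * embU f)" "embV y + embV y = - (embV f * embV f)"
  using arg_cong[OF x_double, of embU] arg_cong[OF x_double, of embV] arg_cong[OF y_double, of embU] arg_cong[OF y_double, of embV]
  by (simp_all add: emb_simps)

lemma rel_1113: "rel T Im Im Im Ip = 0"
proof (rule lin0_lin0_double_zero, rule raw13_of_EE[OF central_lin central_ep central_lin kk' lin_minus_half_double KE'
      emb_doubles(1,2) EE refl])
  show "rel T Im Im Im Ip = lin 0 * (lin (- 1/2) * (embU k * (embV k * embV x) - embV k * embV x * embU k))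
     - ep * (lin (- 1/2) * (embU k * (embV k * embV x) - embV k * (embU k * embU x)))
     - ep * (lin 0 * (embV k * embV x * embU k + embV k * embV e * (embU k * embU e) + embV k * (embU k * embU x)))"
    by (simp add: rel_def sum_idxs T_emb) (simp add: algebra_simps)
qed

lemma rel_1131: "rel T Im Ip Im Im = 0"
proof -
  let ?S = "embU k * (embV y * embV k) + embU f * embU k * (embV f * embV k) + embU y * embU k * embV k"
  define B where "B = (embV y * embV k * embU k - embU k * (embV y * embV k)) * lin (- 1/2) * lin 0
     - (embV y * embV k * embU k - embU y * embU k * embV k) * lin (- 1/2) * ep - ?S * lin 0 * ep"
  have 1: "(cmt (embV f) (embU k)) * lin 0 = (embV f - embU f) * embU k * ep"
    unfolding centralD[OF central_lin[of 0], of "_ - _"] centralD[OF central_ep, of "_ * embU k"]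
    using KF' by (simp add: algebra_simps)
  have 2: "(cmt (embV f) (embU f)) * (lin 0 + lin 0) = (embU f - embV f) * (embU f - embV f) * ep"
    unfolding centralD[OF central_add[OF central_lin[of 0] central_lin[of 0]], of "_ - _"] centralD[OF central_ep, of "_ * _"]
    using FF by (simp add: algebra_simps neg_eq_iff_add_eq_0 eq_neg_iff_add_eq_0)
  have "(B + B + (B + B)) * lin 0 * lin 0 = 0"
    unfolding B_def by (rule raw31_of_FF[OF central_lin central_ep central_lin kk'[symmetric] lin_minus_half_double 1
      emb_doubles(3,4) 2 refl refl])
  then have "lin 0 * (lin 0 * (B + B + (B + B))) = 0"
    by (simp only: centralD[OF central_lin[of 0], of "B + B + (B + B)"] centralD[OF central_lin[of 0], of "lin 0 * (B + B + (B + B))"])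
  then have "B = 0" by (rule lin0_lin0_double_zero)
  moreover have "rel T Im Ip Im Im = - B"
    unfolding B_def centralD[OF central_lin[of "- 1/2"], of "_ - _"] centralD[OF central_ep, of "_ * _"]
      centralD[OF central_lin[of 0], of ?S] centralD[OF central_lin[of 0], of "_ * _"]
    by (simp add: rel_def sum_idxs T_emb) (simp add: algebra_simps)
  ultimately show ?thesis by simp
qed

lemma EF_k: "lin 0 * (embU k * (cmt (embU e) (embV f)) * embV k) = ep * (embU k2 * embV k - embV k2 * embU k)"
proof -
  have "lin 0 * (embU k * (cmt (embU e) (embV f)) * embV k)
     = embU k * (lin 0 * (cmt (embU e) (embV f))) * embV k"
    by (simp only: mult.assoc centralD'[OF central_lin[of 0], of "embU k"])
  also have "\<dots> = ep * (embU k * embU H * embV k - embU k * (embV H * embV k))"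
    unfolding EF by (simp add: mult.assoc centralD'[OF central_ep, of "embU k"] algebra_simps)
  also have "embV H * embV k = embV k2" by (simp add: k2_eq flip: calg_hom_mult[OF calg_hom_embV])
  also have "embU k * embV k2 = embV k2 * embU k"
    using commuting_swap[OF commuting_k2(1)] by (simp add: commuting_def)
  finally show ?thesis by (simp add: k2_def emb_simps)
qed

lemma EF_k_swap: "lin 0 * (embV k * (cmt (embV e) (embU f)) * embU k) = ep * (embU k2 * embV k - embV k2 * embU k)"
proof -
  have "- (lin 0 * (embV k * (cmt (embV e) (embU f)) * embU k)) = ep * (embV k2 * embU k - embU k2 * embV k)"
    using arg_cong[OF EF_k, of swap] by (simp add: calg_hom_simps[OF calg_hom_swap])
  then show ?thesis by (simp add: minus_equation_iff right_diff_distrib)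
qed

text \<open>This and the next two relations contain t_(-1,-1)(v) instead of t_(-1,-1)(u). Together
  with \<open>rel_1111\<close> they are what crossing needs to reach the entries with k and l in {0,
  1}.\<close>

lemma rel_2211: "rel T I0 Im I0 Im = 0"
proof (rule rel_noQ_zeroI)
  have "lin 0 * (lin 0 * (lin 0 * (cmt (embU (T I0 I0)) (embV (T Im Im)))))
     = lin 0 * (lin 0 * (ep * (embU (T Im I0) * embV (T I0 Im) - embV (T Im I0) * embU (T I0 Im))))"
    unfolding T_emb
    using raw22_of_EF[OF central_lin central_ep kk' commuting_k2(1)[unfolded commuting_def] KE' KE_swap KF' KF_swap EF_k EF_k_swap] .
  then show "lin 0 * (cmt (embU (T I0 I0)) (embV (T Im Im)))
     = ep * (embU (T Im I0) * embV (T I0 Im) - embV (T Im I0) * embU (T I0 Im))"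
    by (blast dest: lin_cancel)
qed simp_all

lemma rel_1211: "rel T Im Im I0 Im = 0"
proof (rule rel_noQ_zeroI)
  have 1: "lin 0 * (embU e * embV k) = embV k * (lin 0 * embU e + ep * (embU e - embV e))"
    and 2: "lin 0 * (embV e * embU k) = embU k * (lin 0 * embV e - ep * (embV e - embU e))"
    using KE' KE_swap by (simp_all add: algebra_simps centralC[OF central_lin[of 0], of "embV k"] centralC[OF central_lin[of 0], of "embU k"]
       centralC[OF central_ep, of "embV k"]  centralC[OF central_ep, of "embU k"])
  have "lin 0 * (lin 0 * (embU k * embU e * embV k - embV k * (embU k * embU e)))
    = lin 0 * (embU k * (lin 0 * (embU e * embV k)) - lin 0 * (embV k * (embU k * embU e)))"
    by (simp add: right_diff_distrib mult.assoc centralC[OF central_lin[of 0], of "embU k"])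
  also have "\<dots> = ep * (embU k * (lin 0 * (embU e * embV k)) - embV k * (lin 0 * (embV e * embU k)))"
    unfolding 1 2
    by (simp add: algebra_simps kk' commute_left[OF kk'] centralC[OF central_lin[of 0], of "embV k"] centralC[OF central_lin[of 0], of "embU k"]
       centralC[OF central_ep, of "embV k"] centralC[OF central_ep, of "embU k"] centralC[OF central_ep, of "lin 0"])
  also have "\<dots> = lin 0 * (ep * (embU k * embU e * embV k - embV k * embV e * embU k))"
    by (simp add: algebra_simps centralC[OF central_lin[of 0], of "embV k"] centralC[OF central_lin[of 0], of "embU k"] centralC[OF central_ep, of "lin 0"])
  finally show "lin 0 * (cmt (embU (T Im I0)) (embV (T Im Im)))
     = ep * (embU (T Im I0) * embV (T Im Im) - embV (T Im I0) * embU (T Im Im))"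
    unfolding T_emb by (rule lin_cancel)
qed simp_all

lemma rel_2111: "rel T I0 Im Im Im = 0"
proof (rule rel_noQ_zeroI)
  have 1: "lin 0 * (embV k * embU f) = (lin 0 * embU f - ep * (embV f - embU f)) * embV k"
    and 2: "lin 0 * (embU k * embV f) = (lin 0 * embV f + ep * (embU f - embV f)) * embU k"
    using KF' KF_swap by (simp_all add: algebra_simps)
  have "lin 0 * (lin 0 * (embU f * embU k * embV k - embV k * (embU f * embU k)))
    = lin 0 * (lin 0 * (embU f * embU k * embV k) - lin 0 * (embV k * embU f) * embU k)"
    by (simp add: right_diff_distrib mult.assoc)
  also have "\<dots> = ep * (lin 0 * (embU k * embV f) * embV k - lin 0 * (embV k * embU f) * embU k)"
    unfolding 1 2
    by (simp add: algebra_simps kk' commute_left[OF kk'] centralC[OF central_ep, of "lin 0"])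
  also have "\<dots> = lin 0 * (ep * (embU k * (embV f * embV k) - embV k * (embU f * embU k)))"
    by (simp add: algebra_simps centralC[OF central_ep, of "lin 0"])
  finally show "lin 0 * (cmt (embU (T I0 Im)) (embV (T Im Im)))
     = ep * (embU (T Im Im) * embV (T I0 Im) - embV (T Im Im) * embU (T I0 Im))"
    unfolding T_emb by (rule lin_cancel)
qed simp_all

text \<open>Once the first row and column of this matrix of relations vanish, conjugation by T(v)^-1
  involves only the lower right block of that inverse, which \<open>block_zero\<close>
  cancels.\<close>

lemma rel_first_row: "rel T Im i Im j = 0"
proof -
  let ?D = "\<lambda>i j. rel T Im i Im j" and ?r = "\<lambda>i j. embV (R i j)"
  have 1: "?D i j = 0" if "i = Im \<or> j = Im" for i j
    using that rel_1111 rel_1112 rel_1113 rel_1121 rel_1131 by (cases i; cases j) auto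
  have 2: "mm (mm ?r ?D) ?r i j = 0" if "i \<noteq> Im" "j \<noteq> Im" for i j
    unfolding crossing[OF T_R R_T R_eq] using that rel_1111 rel_2211 rel_1211 rel_2111
    by (cases i; cases j) (simp_all add: flip_simps)
  let ?b = "embV (finv k2)" and ?c = "embV (s k)" and ?m = "embV (sm e)" and ?n = "embV (sm f)"
  have R: "?r I0 I0 = ?b + ?m * ?c * ?n" "?r I0 Ip = ?m * ?c" "?r Ip I0 = ?c * ?n" "?r Ip Ip = ?c"
    by (simp_all add: R_def emb_simps)
  have inverses: "?c * embV H = 1" "embV H * ?c = 1" "?b * embV k2 = 1" "embV k2 * ?b = 1"
    by (simp_all add: finv_left finv_right calg_hom_one[OF calg_hom_embV] flip: calg_hom_mult[OF calg_hom_embV])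
  have "?D I0 I0 = 0 \<and> ?D I0 Ip = 0 \<and> ?D Ip I0 = 0 \<and> ?D Ip Ip = 0"
    using 2[of I0 I0] 2[of I0 Ip] 2[of Ip I0] 2[of Ip Ip]
    by (intro block_zero[OF inverses]) (simp_all add: mm_def sum_idxs 1 R distrib_right algebra_simps)
  with 1 show ?thesis by (cases i; cases j) auto
qed

lemma rtt: "rtt T"
proof -
  have emb: "equivariant actE (embU E) (\<lambda>i j. embU (T i j))" "equivariant actE (embU E) (\<lambda>i j. embV (T i j))"
    "equivariant actF (embU F) (\<lambda>i j. embU (T i j))" "equivariant actF (embU F) (\<lambda>i j. embV (T i j))"
  proof -
    \<comment> \<open>A constant series is the same in both variables, so one element acts on T(u)
      and on T(v).\<close>
    have const: "embU E = embV E" "embU F = embV F"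
      by (simp_all add: E_def F_def embU_def embV_def fps_eq_iff)
    have "cmt (embU E) (embU (T i j)) = actE (\<lambda>i j. embU (T i j)) i j"
      "cmt (embV E) (embV (T i j)) = actE (\<lambda>i j. embV (T i j)) i j"
      "cmt (embU F) (embU (T i j)) = actF (\<lambda>i j. embU (T i j)) i j"
      "cmt (embV F) (embV (T i j)) = actF (\<lambda>i j. embV (T i j)) i j" for i j
      using arg_cong[OF T_equivariant_E[unfolded equivariant_def, rule_format, of i j], of embU]
        arg_cong[OF T_equivariant_E[unfolded equivariant_def, rule_format, of i j], of embV]
        arg_cong[OF T_equivariant_F[unfolded equivariant_def, rule_format, of i j], of embU]
        arg_cong[OF T_equivariant_F[unfolded equivariant_def, rule_format, of i j], of embV]
      by (simp_all add: actE_def actF_def emb_simps split: if_splits)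
    then show "equivariant actE (embU E) (\<lambda>i j. embU (T i j))" "equivariant actE (embU E) (\<lambda>i j. embV (T i j))"
      "equivariant actF (embU F) (\<lambda>i j. embU (T i j))" "equivariant actF (embU F) (\<lambda>i j. embV (T i j))"
      by (simp_all add: equivariant_def const)
  qed
  have "rel T i k j l = 0" for i k j l
    by (rule rel_zero_of_first_row[OF emb rel_first_row])
  then show ?thesis by (simp add: rtt_def T_nth_0 unitarity)
qed

end

section \<open>Presented algebras\<close>

lemma poly_mapping_induct [case_names single sum]:
  fixes p :: "'a \<Rightarrow>\<^sub>0 'b::monoid_add"
  assumes single: "\<And>k v. P (Poly_Mapping.single k v)" and sum: "\<And>p q. P p \<Longrightarrow> P q \<Longrightarrow> P (p + q)"
  shows "P p"
proof (induction p rule: update_induct)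
  case const
  show ?case using single[of undefined 0] by simp
next
  case (update p k v)
  have "Poly_Mapping.update k v p = p + Poly_Mapping.single k v"
    using update(1) by (intro poly_mapping_eqI) (auto simp: lookup_update lookup_add lookup_single when_def in_keys_iff)
  then show ?case using sum[OF update(3) single] by simp
qed

instantiation complex :: calg
begin
definition sc_complex :: "complex \<Rightarrow> complex" where "sc_complex c = c"
instance by standard (simp_all add: sc_complex_def)
end

instantiation poly_mapping :: (monoid_add, calg) calg
begin
definition sc_poly_mapping :: "complex \<Rightarrow> 'a \<Rightarrow>\<^sub>0 'b" where "sc_poly_mapping c = Poly_Mapping.single 0 (sc c)"
instance
proof
  fix c d :: complex and p :: "'a \<Rightarrow>\<^sub>0 'b"
  show "sc (c + d) = (sc c + sc d :: 'a \<Rightarrow>\<^sub>0 'b)" by (simp add: sc_poly_mapping_def sc_add single_add)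
  show "sc (c * d) = (sc c * sc d :: 'a \<Rightarrow>\<^sub>0 'b)" by (simp add: sc_poly_mapping_def sc_mult mult_single)
  show "sc 1 = (1 :: 'a \<Rightarrow>\<^sub>0 'b)" by (simp add: sc_poly_mapping_def)
  show "sc c * p = p * sc c"
  proof (induction p rule: poly_mapping_induct)
    case (single k v)
    then show ?case by (simp add: sc_poly_mapping_def mult_single sc_commute)
  next
    case (sum p q)
    then show ?case by (simp add: distrib_left distrib_right)
  qed
qed
end

lemma sc_eq_fa_scal: "sc c = fa_scal c"
  by (simp add: sc_poly_mapping_def fa_scal_def sc_complex_def)

fun word_eval :: "('g \<Rightarrow> 'a::monoid_mult) \<Rightarrow> 'g word \<Rightarrow> 'a" where
  "word_eval \<phi> (Word l) = prod_list (map \<phi> l)"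

lemma word_eval_add: "word_eval \<phi> (v + w) = word_eval \<phi> v * word_eval \<phi> w"
  by (cases v; cases w) simp

lemma word_eval_zero [simp]: "word_eval \<phi> 0 = 1"
  by (simp add: zero_word_def)

text \<open>The homomorphism out of the free algebra that is determined by the images of the
  generators.\<close>

definition fa_eval :: "('g \<Rightarrow> 'a::calg) \<Rightarrow> 'g fa \<Rightarrow> 'a" where
  "fa_eval \<phi> p = (\<Sum>w\<in>Poly_Mapping.keys p. sc (Poly_Mapping.lookup p w) * word_eval \<phi> w)"

lemma fa_eval_superset:
  assumes "finite A" "Poly_Mapping.keys p \<subseteq> A"
  shows "fa_eval \<phi> p = (\<Sum>w\<in>A. sc (Poly_Mapping.lookup p w) * word_eval \<phi> w)"
  unfolding fa_eval_def by (rule sum.mono_neutral_left) (use assms in \<open>auto simp: in_keys_iff\<close>)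

lemma fa_eval_add: "fa_eval \<phi> (p + q) = fa_eval \<phi> p + fa_eval \<phi> q"
proof -
  let ?A = "Poly_Mapping.keys p \<union> Poly_Mapping.keys q"
  show ?thesis
    by (simp add: fa_eval_superset[of ?A] Poly_Mapping.keys_add lookup_add sc_add distrib_right sum.distrib)
qed

lemma fa_eval_single: "fa_eval \<phi> (Poly_Mapping.single w c) = sc c * word_eval \<phi> w"
  by (simp add: fa_eval_superset[of "{w}"])

lemma fa_eval_mult: "fa_eval \<phi> (p * q) = fa_eval \<phi> p * fa_eval \<phi> q"
proof (induction p rule: poly_mapping_induct)
  case (single w c)
  show ?case
  proof (induction q rule: poly_mapping_induct)
    case (single v d)
    show ?case by (simp add: mult_single fa_eval_single word_eval_add sc_mult_mult)
  next
    case (sum p q)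
    then show ?case by (simp add: distrib_left fa_eval_add)
  qed
next
  case (sum p q)
  then show ?case by (simp add: distrib_right fa_eval_add)
qed

lemma calg_hom_fa_eval: "calg_hom (fa_eval \<phi>)"
  by (simp add: calg_hom_def fa_eval_add fa_eval_mult sc_eq_fa_scal fa_scal_def fa_eval_single)

lemmas fa_eval_simps = calg_hom_simps[OF calg_hom_fa_eval]

lemma fa_eval_gen [simp]: "fa_eval \<phi> (fa_gen g) = \<phi> g"
  by (simp add: fa_gen_def fa_eval_single)

lemma calg_hom_eq_on_generators:
  fixes \<phi> \<psi> :: "'g fa \<Rightarrow> 'a::calg"
  assumes \<phi>: "calg_hom \<phi>" and \<psi>: "calg_hom \<psi>" and eq: "\<And>g. \<phi> (fa_gen g) = \<psi> (fa_gen g)"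
  shows "\<phi> p = \<psi> p"
proof (induction p rule: poly_mapping_induct)
  case (single w c)
  obtain l where w: "w = Word l" by (cases w)
  have "\<phi> (Poly_Mapping.single (Word l) c) = \<psi> (Poly_Mapping.single (Word l) c)"
  proof (induction l arbitrary: c)
    case Nil
    have "Poly_Mapping.single (Word []) c = (sc c :: 'g fa)"
      by (simp add: sc_eq_fa_scal fa_scal_def zero_word_def)
    then show ?case by (simp add: calg_hom_sc[OF \<phi>] calg_hom_sc[OF \<psi>])
  next
    case (Cons g l)
    have "Poly_Mapping.single (Word (g # l)) c = fa_gen g * Poly_Mapping.single (Word l) c"
      by (simp add: fa_gen_def mult_single)
    then show ?case using Cons by (simp add: calg_hom_mult[OF \<phi>] calg_hom_mult[OF \<psi>] eq)
  qed
  then show ?case by (simp add: w)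
next
  case (sum p q)
  then show ?case by (simp add: calg_hom_add[OF \<phi>] calg_hom_add[OF \<psi>])
qed

lemma ring_fa_ring: "ring (fa_ring :: 'g fa ring)"
proof (intro ringI)
  show "abelian_group (fa_ring :: 'g fa ring)"
    by (intro abelian_groupI) (auto simp: fa_ring_def add.assoc add.commute intro: exI[of _ "- x" for x])
  show "Group.monoid (fa_ring :: 'g fa ring)"
    by (intro monoidI) (auto simp: fa_ring_def mult.assoc)
qed (auto simp: fa_ring_def algebra_simps)

lemma fa_ring_simps [simp]: "carrier fa_ring = UNIV" "a \<otimes>\<^bsub>fa_ring\<^esub> b = a * b" "a \<oplus>\<^bsub>fa_ring\<^esub> b = a + b"
  "\<one>\<^bsub>fa_ring\<^esub> = 1" "\<zero>\<^bsub>fa_ring\<^esub> = 0"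
  by (simp_all add: fa_ring_def)

lemma fa_ring_minus: "\<ominus>\<^bsub>fa_ring\<^esub> a = - (a :: 'g fa)" "a \<ominus>\<^bsub>fa_ring\<^esub> b = a - (b :: 'g fa)"
proof -
  interpret ring "fa_ring :: 'g fa ring" by (rule ring_fa_ring)
  show 1: "\<ominus>\<^bsub>fa_ring\<^esub> a = - a" for a :: "'g fa"
    by (rule minus_equality) simp_all
  show "a \<ominus>\<^bsub>fa_ring\<^esub> b = a - b" by (simp add: a_minus_def 1)
qed

lemma ideal_genideal: "ideal (genideal fa_ring S) (fa_ring :: 'g fa ring)"
  by (rule ring.genideal_ideal[OF ring_fa_ring]) simp

lemma ideal_kernel:
  fixes \<phi> :: "'g fa \<Rightarrow> 'a::calg"
  assumes "calg_hom \<phi>" shows "ideal {p. \<phi> p = 0} fa_ring"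
proof (rule idealI[OF ring_fa_ring])
  show "subgroup {p. \<phi> p = 0} (add_monoid fa_ring)"
  proof
    show "inv\<^bsub>add_monoid fa_ring\<^esub> x \<in> {p. \<phi> p = 0}" if "x \<in> {p. \<phi> p = 0}" for x
      using that fa_ring_minus(1)[of x] by (simp add: a_inv_def calg_hom_minus[OF assms])
  qed (auto simp: calg_hom_simps[OF assms])
qed (auto simp: calg_hom_simps[OF assms])

lemma genideal_subset_kernel:
  assumes "calg_hom \<phi>" "\<And>s. s \<in> S \<Longrightarrow> \<phi> s = 0" and "p \<in> genideal fa_ring S"
  shows "\<phi> p = 0"
  using ring.genideal_minimal[OF ring_fa_ring ideal_kernel[OF assms(1)], of S] assms(2,3) by auto

lemma cls_eq_iff: "cls S p = cls S q \<longleftrightarrow> p - q \<in> genideal fa_ring S"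
  using ring.quotient_eq_iff_same_a_r_cos[OF ring_fa_ring ideal_genideal, of p q S]
  by (simp add: cls_def fa_ring_minus)

lemma cls_ring_hom: "cls S \<in> ring_hom fa_ring (presented S)"
  using ideal.rcos_ring_hom[OF ideal_genideal, of S] by (simp add: cls_def[abs_def] presented_def)

lemma cls_add: "cls S (p + q) = cls S p \<oplus>\<^bsub>presented S\<^esub> cls S q"
  and cls_mult: "cls S (p * q) = cls S p \<otimes>\<^bsub>presented S\<^esub> cls S q"
  and cls_one: "cls S 1 = \<one>\<^bsub>presented S\<^esub>"
  using ring_hom_add[OF cls_ring_hom, of p q] ring_hom_mult[OF cls_ring_hom, of p q] ring_hom_one[OF cls_ring_hom]
  by simp_all

lemma ring_presented: "ring (presented S)"
  unfolding presented_def by (rule ideal.quotient_is_ring[OF ideal_genideal])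

lemma carrier_presented: "carrier (presented S) = range (cls S)"
  by (auto simp: presented_def FactRing_def A_RCOSETS_defs cls_def a_r_coset_def)

lemma cls_zero: "cls S 0 = \<zero>\<^bsub>presented S\<^esub>"
proof -
  interpret ring_hom_ring fa_ring "presented S" "cls S"
    by (rule ring_hom_ringI2[OF ring_fa_ring ring_presented cls_ring_hom])
  show ?thesis using hom_zero by simp
qed

text \<open>Attaches the relations to the type of generators, so that each presented algebra becomes
  a type. The class \<open>ring_1\<close> demands 0 \<noteq> 1, hence the requirement that the ideal
  be proper.\<close>

class presentation =
  fixes rels :: "'a fa set"
  assumes proper: "1 \<notin> genideal fa_ring (rels :: 'a fa set)"

quotient_type (overloaded) 'g palg = "'g::presentation fa" / "\<lambda>p q. cls rels p = cls rels q"
  by (auto simp: equivp_def fun_eq_iff)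

instantiation palg :: (presentation) calg
begin

lift_definition zero_palg :: "'a palg" is 0 .
lift_definition one_palg :: "'a palg" is 1 .
lift_definition plus_palg :: "'a palg \<Rightarrow> 'a palg \<Rightarrow> 'a palg" is "(+)" by (simp add: cls_add)
lift_definition times_palg :: "'a palg \<Rightarrow> 'a palg \<Rightarrow> 'a palg" is "(*)" by (simp add: cls_mult)
lift_definition uminus_palg :: "'a palg \<Rightarrow> 'a palg" is "uminus"
  unfolding cls_eq_iff using additive_subgroup.a_inv_closed[OF ideal.axioms(1)[OF ideal_genideal]]
  by (metis fa_ring_minus(1) minus_diff_eq minus_diff_minus)
lift_definition minus_palg :: "'a palg \<Rightarrow> 'a palg \<Rightarrow> 'a palg" is "(-)"
proof -
  fix p q p' q' :: "'a fa"
  assume "cls rels p = cls rels q" "cls rels p' = cls rels q'"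
  then have "p - q \<in> genideal fa_ring rels" "q' - p' \<in> genideal fa_ring rels"
    unfolding cls_eq_iff[symmetric] by simp_all
  then have "(p - q) + (q' - p') \<in> genideal fa_ring rels"
    using additive_subgroup.a_closed[OF ideal.axioms(1)[OF ideal_genideal]] by fastforce
  then show "cls rels (p - p') = cls rels (q - q')" by (simp add: cls_eq_iff algebra_simps)
qed
lift_definition sc_palg :: "complex \<Rightarrow> 'a palg" is sc .

instance
proof
  show "(0 :: 'a palg) \<noteq> 1"
  proof (transfer, rule)
    assume "cls rels (0 :: 'a fa) = cls rels 1"
    then have "(1 - 0 :: 'a fa) \<in> genideal fa_ring rels" unfolding cls_eq_iff[symmetric] by simp
    then show False using proper[where 'a = 'a] by simp
  qed
  show "sc c * a = a * sc c" for c and a :: "'a palg"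
    by transfer (simp only: sc_commute)
qed (transfer, simp add: algebra_simps sc_add sc_mult)+

end

text \<open>The bridge between the type \<open>palg\<close> and the carrier of the ring record
  \<open>presented rels\<close>.\<close>

lift_definition coset :: "'g::presentation palg \<Rightarrow> 'g fa set" is "cls rels" by simp
definition pcls :: "'g fa \<Rightarrow> 'g::presentation palg" where "pcls = abs_palg"

lemma pcls_eq_iff: "pcls p = pcls q \<longleftrightarrow> cls rels p = cls rels q"
  by (simp add: pcls_def palg.abs_eq_iff)

lemma coset_pcls: "coset (pcls p) = cls rels p"
  by (simp add: pcls_def coset.abs_eq)

lemma pcls_surj: "\<exists>p. a = pcls p"
  by (induction a rule: palg.abs_induct) (auto simp: pcls_def)

lemma coset_inj: "coset a = coset b \<longleftrightarrow> a = b"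
  using pcls_surj[of a] pcls_surj[of b] by (auto simp: coset_pcls pcls_eq_iff)

lemma calg_hom_pcls: "calg_hom pcls"
  by (simp add: calg_hom_def pcls_def plus_palg.abs_eq times_palg.abs_eq sc_palg.abs_eq)

lemma pcls_eq_zero:
  assumes "p \<in> rels" shows "pcls p = 0"
proof -
  have "p - 0 \<in> genideal fa_ring rels"
    using ring.genideal_self[OF ring_fa_ring, of rels] assms by auto
  then have "pcls p = pcls 0" unfolding pcls_eq_iff cls_eq_iff .
  then show ?thesis by (simp add: calg_hom_zero[OF calg_hom_pcls])
qed

lemma carrier_eq_range_coset: "carrier (presented rels) = range coset"
proof -
  have "cls rels p \<in> range coset" for p :: "'a fa" by (metis coset_pcls rangeI)
  moreover have "coset a \<in> range (cls rels)" for a :: "'a palg"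
    using pcls_surj[of a] by (auto simp: coset_pcls)
  ultimately show ?thesis unfolding carrier_presented by blast
qed

lemma coset_add: "coset (a + b) = coset a \<oplus>\<^bsub>presented rels\<^esub> coset b"
  and coset_mult: "coset (a * b) = coset a \<otimes>\<^bsub>presented rels\<^esub> coset b"
proof -
  obtain p q where [simp]: "a = pcls p" "b = pcls q" using pcls_surj by metis
  show "coset (a + b) = coset a \<oplus>\<^bsub>presented rels\<^esub> coset b"
    by (simp add: coset_pcls cls_add flip: calg_hom_add[OF calg_hom_pcls])
  show "coset (a * b) = coset a \<otimes>\<^bsub>presented rels\<^esub> coset b"
    by (simp add: coset_pcls cls_mult flip: calg_hom_mult[OF calg_hom_pcls])
qed

lemma coset_one: "coset 1 = \<one>\<^bsub>presented rels\<^esub>"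
  and coset_zero: "coset 0 = \<zero>\<^bsub>presented rels\<^esub>"
  by (simp_all add: coset_pcls cls_one cls_zero flip: calg_hom_one[OF calg_hom_pcls] calg_hom_zero[OF calg_hom_pcls])

text \<open>The universal property of the presented algebra: evaluation kills the ideal, so any
  representative of a class may be evaluated.\<close>

lemma ex_palg_hom:
  fixes \<phi> :: "'g::presentation \<Rightarrow> 'a::calg"
  assumes "\<And>p. p \<in> rels \<Longrightarrow> fa_eval \<phi> p = 0"
  shows "\<exists>\<Phi>. calg_hom \<Phi> \<and> (\<forall>g. \<Phi> (pcls (fa_gen g)) = \<phi> g)"
proof -
  have *: "fa_eval \<phi> p = fa_eval \<phi> q" if "pcls p = (pcls q :: 'g palg)" for p q
  proof -
    have "p - q \<in> genideal fa_ring rels" using that by (simp add: pcls_eq_iff cls_eq_iff)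
    then have "fa_eval \<phi> (p - q) = 0"
      using genideal_subset_kernel[OF calg_hom_fa_eval, of rels \<phi>] assms by blast
    then show ?thesis by (simp add: fa_eval_simps)
  qed
  define \<Phi> where "\<Phi> a = fa_eval \<phi> (SOME p. a = pcls p)" for a
  have \<Phi>: "\<Phi> (pcls p) = fa_eval \<phi> p" for p
    unfolding \<Phi>_def by (rule *) (metis (mono_tags, lifting) someI)
  have "calg_hom \<Phi>"
    unfolding calg_hom_def
  proof (intro conjI allI)
    fix a b :: "'g palg" obtain p q where [simp]: "a = pcls p" "b = pcls q" using pcls_surj by metis
    show "\<Phi> (a + b) = \<Phi> a + \<Phi> b"
      by (simp add: \<Phi> fa_eval_add flip: calg_hom_add[OF calg_hom_pcls])
    show "\<Phi> (a * b) = \<Phi> a * \<Phi> b"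
      by (simp add: \<Phi> fa_eval_mult flip: calg_hom_mult[OF calg_hom_pcls])
    show "\<Phi> (sc c) = sc c" for c
      by (simp add: \<Phi> fa_eval_simps flip: calg_hom_sc[OF calg_hom_pcls])
  qed
  with \<Phi> show ?thesis by (metis fa_eval_gen)
qed

lemma palg_hom_eq:
  assumes "calg_hom \<Phi>" "calg_hom \<Psi>" "\<And>g. \<Phi> (pcls (fa_gen g)) = \<Psi> (pcls (fa_gen g))"
  shows "\<Phi> a = \<Psi> a"
proof -
  obtain p where "a = pcls p" using pcls_surj by metis
  then show ?thesis
    using calg_hom_eq_on_generators[OF calg_hom_comp[OF assms(1) calg_hom_pcls] calg_hom_comp[OF assms(2) calg_hom_pcls] assms(3)]
    by simp
qed

section \<open>Coefficients of the Drinfeld relations\<close>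

declare fps_mult_nth_0 [simp del] fps_mult_nth_1' [simp del]

lemma emb_mult_nth: "(embU a * embV b) $ n $ m = a $ m * b $ n" "(embV b * embU a) $ n $ m = b $ n * a $ m"
  by (simp_all add: embU_mult_nth mult_embU_nth embV_nth)

lemma embU_nth: "embU a $ n $ m = (if n = 0 then a $ m else 0)" and embV_nth_nth: "embV a $ n $ m = (if m = 0 then a $ n else 0)"
  by (simp_all add: embU_def embV_def)

text \<open>The outer index counts powers of v^-1, the inner one powers of u^-1.\<close>

lemma lin_mult_nth:
  "(lin c * F) $ 0 $ 0 = 0" "(lin c * F) $ 0 $ Suc m = - F $ 0 $ m" "(lin c * F) $ Suc n $ 0 = F $ n $ 0"
  "(lin c * F) $ Suc n $ Suc m = F $ n $ Suc m - F $ Suc n $ m + sc c * F $ n $ m"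
  by (simp_all add: lin_def ep_def distrib_right left_diff_distrib mult.assoc)

lemma ep_mult_nth:
  "(ep * F) $ 0 $ m = 0" "(ep * F) $ n $ 0 = 0" "(ep * F) $ Suc n $ Suc m = F $ n $ m"
  by (cases n; simp add: ep_def mult.assoc)+

lemma lin_ep_iff:
  "lin c * P = ep * (Q :: 'a::calg fps fps) \<longleftrightarrow> (\<forall>m. P $ 0 $ m = 0) \<and> (\<forall>n. P $ n $ 0 = 0)
     \<and> (\<forall>n m. P $ n $ Suc m - P $ Suc n $ m + sc c * P $ n $ m = Q $ n $ m)"
  (is "?l \<longleftrightarrow> ?r")
proof
  assume l: ?l
  have "P $ 0 $ m = 0" for m
    using arg_cong[OF l, of "\<lambda>F. F $ 0 $ Suc m"] by (simp add: lin_mult_nth ep_mult_nth)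
  moreover have "P $ n $ 0 = 0" for n
    using arg_cong[OF l, of "\<lambda>F. F $ Suc n $ 0"] by (simp add: lin_mult_nth ep_mult_nth)
  moreover have "P $ n $ Suc m - P $ Suc n $ m + sc c * P $ n $ m = Q $ n $ m" for n m
    using arg_cong[OF l, of "\<lambda>F. F $ Suc n $ Suc m"] by (simp add: lin_mult_nth ep_mult_nth)
  ultimately show ?r by blast
next
  assume r: ?r
  have "(lin c * P) $ n $ m = (ep * Q) $ n $ m" for n m
    using r by (cases n; cases m) (simp_all add: lin_mult_nth ep_mult_nth)
  then show ?l by (simp add: fps_eq_iff)
qed

definition drinfeld_coeffs :: "'a::calg fps \<Rightarrow> 'a fps \<Rightarrow> 'a fps \<Rightarrow> bool" where
  "drinfeld_coeffs e f H \<longleftrightarrow> (\<forall>k l. H $ k * H $ l = H $ l * H $ k)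
    \<and> (\<forall>k l. cmt (f $ Suc k) (e $ Suc l) = H $ Suc (k + l))
    \<and> (\<forall>k l. cmt (H $ Suc k) (f $ Suc l) - (cmt (H $ k) (f $ Suc (Suc l)))
          = sc (1/2) * (H $ k * f $ Suc l + f $ Suc l * H $ k))
    \<and> (\<forall>k l. cmt (H $ Suc k) (e $ Suc l) - (cmt (H $ k) (e $ Suc (Suc l)))
          = - (sc (1/2) * (H $ k * e $ Suc l + e $ Suc l * H $ k)))
    \<and> (\<forall>k l. cmt (f $ Suc (Suc k)) (f $ Suc l) - (cmt (f $ Suc k) (f $ Suc (Suc l)))
          = sc (1/2) * (f $ Suc k * f $ Suc l + f $ Suc l * f $ Suc k))
    \<and> (\<forall>k l. cmt (e $ Suc (Suc k)) (e $ Suc l) - (cmt (e $ Suc k) (e $ Suc (Suc l)))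
          = - (sc (1/2) * (e $ Suc k * e $ Suc l + e $ Suc l * e $ Suc k)))"

lemma commuting_iff: "commuting a b \<longleftrightarrow> (\<forall>k l. a $ k * b $ l = b $ l * a $ k)"
  by (auto simp: commuting_def fps_eq_iff emb_mult_nth)

text \<open>For positive m and n, [e_(m+1), f_n] = [e_m, f_(n+1)], so the commutator depends only on
  the sum of the indices; the boundary terms from H(u) and H(v) fix its value.\<close>

lemma EF_iff:
  fixes e f H :: "'a::calg fps"
  assumes 0: "e $ 0 = 0" "f $ 0 = 0"
  shows "lin 0 * (cmt (embU e) (embV f)) = ep * (embU H - embV H)
    \<longleftrightarrow> (\<forall>k l. cmt (f $ Suc k) (e $ Suc l) = H $ Suc (k + l))" (is "?l \<longleftrightarrow> ?r")
proof
  assume ?l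
  then have *: "cmt (e $ Suc m) (f $ n) - (cmt (e $ m) (f $ Suc n))
      = (if n = 0 then H $ m else 0) - (if m = 0 then H $ n else 0)" for n m
    unfolding lin_ep_iff by (simp add: emb_mult_nth embU_nth embV_nth_nth)
  have "cmt (f $ Suc k) (e $ Suc l) = H $ Suc (k + l)" for k l
  proof (induction k arbitrary: l)
    case 0
    show ?case using *[of "Suc l" 0] assms by simp
  next
    case (Suc k)
    show ?case using *[of "Suc l" "Suc k"] Suc[of "Suc l"] by (simp add: algebra_simps)
  qed
  then show ?r by blast
next
  assume r: ?r
  have r': "cmt (e $ Suc l) (f $ Suc k) = - (H $ Suc (k + l))" for k l
    unfolding r[rule_format, symmetric] by simp
  have "cmt (e $ Suc m) (f $ n) - (cmt (e $ m) (f $ Suc n))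
      = (if n = 0 then H $ m else 0) - (if m = 0 then H $ n else 0)" for n m
    by (cases n; cases m) (simp_all add: assms r')
  then show ?l unfolding lin_ep_iff by (simp add: emb_mult_nth embU_nth embV_nth_nth assms)
qed

text \<open>Used with d = 1 for e and with d = -1 for f.\<close>

lemma EE_iff:
  fixes e :: "'a::calg fps"
  assumes 0: "e $ 0 = 0"
  shows "lin 0 * ((cmt (embU e) (embV e)) + (cmt (embU e) (embV e)))
      = sc d * (ep * ((embU e - embV e) * (embU e - embV e)))
    \<longleftrightarrow> (\<forall>k l. cmt (e $ Suc (Suc k)) (e $ Suc l) - (cmt (e $ Suc k) (e $ Suc (Suc l)))
          = - (sc (d/2) * (e $ Suc k * e $ Suc l + e $ Suc l * e $ Suc k)))" (is "?l \<longleftrightarrow> ?r")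
proof -
  let ?P = "cmt (embU e) (embV e)"
  let ?Q = "\<lambda>G. sc d * (embU G + embV G - embU e * embV e - embV e * embU e)"
  have sq: "(embU e - embV e) * (embU e - embV e) = embU (e * e) + embV (e * e) - embU e * embV e - embV e * embU e"
    by (simp add: emb_simps algebra_simps)
  have comm: "sc d * (ep * z) = ep * (sc d * z)" for z :: "'a fps fps" by (rule centralD'[OF central_ep])
  have half: "sc (d/2) * z + sc (d/2) * z = sc d * z" for z :: 'a
    using sc_add[of "d/2" "d/2", where 'a = 'a] by (simp flip: distrib_right)
  have step: "(z + z = - (sc d * w)) \<longleftrightarrow> (z = - (sc (d/2) * w))" for z w :: 'a
  proof
    assume "z + z = - (sc d * w)"
    also have "\<dots> = - (sc (d/2) * w) + - (sc (d/2) * w)" unfolding half[symmetric] by simp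
    finally show "z = - (sc (d/2) * w)" by (rule double_cancel)
  next
    assume "z = - (sc (d/2) * w)"
    then have "z + z = - (sc (d/2) * w + sc (d/2) * w)" by simp
    then show "z + z = - (sc d * w)" unfolding half .
  qed
  show ?thesis
  proof
    assume l: ?l
    then have *: "(cmt (e $ Suc m) (e $ n)) + (cmt (e $ Suc m) (e $ n))
      - ((cmt (e $ m) (e $ Suc n)) + (cmt (e $ m) (e $ Suc n)))
      = sc d * ((if n = 0 then (e * e) $ m else 0) + (if m = 0 then (e * e) $ n else 0) - e $ m * e $ n - e $ n * e $ m)" for n m
      unfolding sq comm lin_ep_iff by (simp add: emb_mult_nth embU_nth embV_nth_nth)
    show ?r
    proof (intro allI)
      fix k l
      show "cmt (e $ Suc (Suc k)) (e $ Suc l) - (cmt (e $ Suc k) (e $ Suc (Suc l)))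
          = - (sc (d/2) * (e $ Suc k * e $ Suc l + e $ Suc l * e $ Suc k))"
        unfolding step[symmetric] using *[of "Suc k" "Suc l"] by (simp add: algebra_simps)
    qed
  next
    assume r: ?r
    \<comment> \<open>The coefficient relations say nothing about the boundary terms, which a priori
      form a series \<open>G\<close> made from the first coefficient. The resulting relation at v =
      u then forces G = d e^2.\<close>
    define G where "G = (fps_const (e $ 1) * e - e * fps_const (e $ 1)) + (fps_const (e $ 1) * e - e * fps_const (e $ 1))"
    have G: "G $ n = cmt (e $ 1) (e $ n) + (cmt (e $ 1) (e $ n))" for n by (simp add: G_def)
    have r': "(cmt (e $ Suc (Suc m)) (e $ Suc n)) + (cmt (e $ Suc (Suc m)) (e $ Suc n))
      - ((cmt (e $ Suc m) (e $ Suc (Suc n))) + (cmt (e $ Suc m) (e $ Suc (Suc n))))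
      = - (sc d * (e $ Suc m * e $ Suc n + e $ Suc n * e $ Suc m))" for n m
    proof -
      let ?z = "cmt (e $ Suc (Suc m)) (e $ Suc n) - (cmt (e $ Suc m) (e $ Suc (Suc n)))"
      have "?z + ?z = - (sc d * (e $ Suc m * e $ Suc n + e $ Suc n * e $ Suc m))"
        unfolding step using r by blast
      then show ?thesis by (simp add: algebra_simps)
    qed
    have "lin 0 * (?P + ?P) = ep * (embU G + embV G - sc d * (embU e * embV e + embV e * embU e))"
    proof -
      have "(cmt (e $ Suc m) (e $ n)) + (cmt (e $ Suc m) (e $ n))
      - ((cmt (e $ m) (e $ Suc n)) + (cmt (e $ m) (e $ Suc n)))
      = ((if n = 0 then G $ m else 0) + (if m = 0 then G $ n else 0) - sc d * (e $ m * e $ n + e $ n * e $ m))" for n m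
        using r' by (cases n; cases m) (simp_all add: assms G)
      then show ?thesis unfolding lin_ep_iff by (simp add: emb_mult_nth embU_nth embV_nth_nth assms)
    qed
    note this and spec_rel[OF this, of 0]
    moreover from this(2) have "G + G = sc d * (e * e) + sc d * (e * e)"
      by (simp add: spec_simps distrib_left)
    then have "G = sc d * (e * e)" by (rule double_cancel)
    ultimately show ?l unfolding sq comm by (simp add: emb_simps algebra_simps)
  qed
qed

text \<open>Exchange u and v, shift v by 1/2 so that k(v + 1/2) = H(v)^-1, multiply by H(v) on both
  sides, and exchange back.\<close>

lemma KE_iff:
  assumes H: "H $ 0 = 1"
  shows "KE_rel (finv (shift (- 1/2) H)) e \<longleftrightarrow>
     lin (1/2) * (cmt (embU H) (embV e)) = ep * ((embU (shift (1/2) e) - embV e) * embU H)" (is "?l \<longleftrightarrow> ?r")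
proof -
  define k where "k = finv (shift (- 1/2) H)"
  let ?K = "embV (shift (1/2) k)" and ?h = "embV H" and ?e' = "embV (shift (1/2) e)"
  have K: "shift (1/2) k = finv H" "shift (1/2) (finv k) = H" by (simp_all add: k_def finv_shift shift_shift finv_finv H)
  have Kh: "?K * ?h = 1" "?h * ?K = 1"
    by (simp_all add: K finv_left finv_right H calg_hom_one[OF calg_hom_embV] flip: calg_hom_mult[OF calg_hom_embV])
  have comm: "z * (lin c * w) = lin c * (z * w)" "z * (ep * w) = ep * (z * w)" for z w :: "'a fps fps" and c
    by (rule centralD'[OF central_lin] centralD'[OF central_ep])+
  have "?l \<longleftrightarrow> lin 0 * (cmt (embU e) (embV k)) = ep * (embV k * (embU e - embV e))"
  proof
    assume "lin 0 * (cmt (embU e) (embV k)) = ep * (embV k * (embU e - embV e))"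
    from swap_rel[OF this] have "lin 0 * (cmt (embV e) (embU k)) = - (ep * (embU k * (embV e - embU e)))"
      by (simp add: calg_hom_simps[OF calg_hom_swap])
    then show ?l unfolding k_def[symmetric] KE_rel_def by (simp add: algebra_simps)
  qed (unfold k_def[symmetric], rule KE_rel_swap)
  also have "\<dots> \<longleftrightarrow> lin (- (1/2)) * (embU e * ?K - ?K * embU e) = ep * (?K * (embU e - ?e'))"
  proof
    assume "lin 0 * (cmt (embU e) (embV k)) = ep * (embV k * (embU e - embV e))"
    from shift_rel[OF this, of "1/2"] show "lin (- (1/2)) * (embU e * ?K - ?K * embU e) = ep * (?K * (embU e - ?e'))"
      by (simp add: calg_hom_simps[OF calg_hom_shift])
  next
    assume "lin (- (1/2)) * (embU e * ?K - ?K * embU e) = ep * (?K * (embU e - ?e'))"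
    from shift_rel[OF this, of "- (1/2)"] show "lin 0 * (cmt (embU e) (embV k)) = ep * (embV k * (embU e - embV e))"
      by (simp add: calg_hom_simps[OF calg_hom_shift] shift_shift)
  qed
  also have "\<dots> \<longleftrightarrow> lin (- (1/2)) * (?h * embU e - embU e * ?h) = ep * ((embU e - ?e') * ?h)"
  proof
    assume "lin (- (1/2)) * (embU e * ?K - ?K * embU e) = ep * (?K * (embU e - ?e'))"
    then have "?h * (lin (- (1/2)) * (embU e * ?K - ?K * embU e)) * ?h = ?h * (ep * (?K * (embU e - ?e'))) * ?h" by simp
    then have "lin (- (1/2)) * (?h * embU e * (?K * ?h) - (?h * ?K) * (embU e * ?h)) = ep * ((?h * ?K) * ((embU e - ?e') * ?h))"
      by (simp only: comm mult.assoc left_diff_distrib right_diff_distrib)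
    then show "lin (- (1/2)) * (?h * embU e - embU e * ?h) = ep * ((embU e - ?e') * ?h)" by (simp add: Kh)
  next
    assume "lin (- (1/2)) * (?h * embU e - embU e * ?h) = ep * ((embU e - ?e') * ?h)"
    then have "?K * (lin (- (1/2)) * (?h * embU e - embU e * ?h)) * ?K = ?K * (ep * ((embU e - ?e') * ?h)) * ?K" by simp
    then have "lin (- (1/2)) * ((?K * ?h) * (embU e * ?K) - ?K * embU e * (?h * ?K)) = ep * (?K * ((embU e - ?e') * (?h * ?K)))"
      by (simp only: comm mult.assoc left_diff_distrib right_diff_distrib)
    then show "lin (- (1/2)) * (embU e * ?K - ?K * embU e) = ep * (?K * (embU e - ?e'))" by (simp add: Kh)
  qed
  also have "\<dots> \<longleftrightarrow> ?r"
  proof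
    assume "lin (- (1/2)) * (?h * embU e - embU e * ?h) = ep * ((embU e - ?e') * ?h)"
    from swap_rel[OF this] show ?r
      by (simp add: calg_hom_simps[OF calg_hom_swap] algebra_simps)
  next
    assume ?r
    from swap_rel[OF this] show "lin (- (1/2)) * (?h * embU e - embU e * ?h) = ep * ((embU e - ?e') * ?h)"
      by (simp add: calg_hom_simps[OF calg_hom_swap] algebra_simps)
  qed
  finally show ?thesis .
qed

lemma KF_iff:
  assumes H: "H $ 0 = 1"
  shows "KF_rel (finv (shift (- 1/2) H)) f \<longleftrightarrow>
     lin (1/2) * (cmt (embU H) (embV f)) = ep * (embU H * (embV f - embU (shift (1/2) f)))" (is "?l \<longleftrightarrow> ?r")
proof -
  define k where "k = finv (shift (- 1/2) H)"
  let ?K = "embV (shift (1/2) k)" and ?h = "embV H" and ?f' = "embV (shift (1/2) f)"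
  have K: "shift (1/2) k = finv H" "shift (1/2) (finv k) = H" by (simp_all add: k_def finv_shift shift_shift finv_finv H)
  have Kh: "?K * ?h = 1" "?h * ?K = 1"
    by (simp_all add: K finv_left finv_right H calg_hom_one[OF calg_hom_embV] flip: calg_hom_mult[OF calg_hom_embV])
  have comm: "z * (lin c * w) = lin c * (z * w)" "z * (ep * w) = ep * (z * w)" for z w :: "'a fps fps" and c
    by (rule centralD'[OF central_lin] centralD'[OF central_ep])+
  have "?l \<longleftrightarrow> lin 0 * (cmt (embU f) (embV k)) = ep * ((embV f - embU f) * embV k)"
  proof
    assume "lin 0 * (cmt (embU f) (embV k)) = ep * ((embV f - embU f) * embV k)"
    from swap_rel[OF this] have "lin 0 * (cmt (embV f) (embU k)) = - (ep * ((embU f - embV f) * embU k))"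
      by (simp add: calg_hom_simps[OF calg_hom_swap])
    then show ?l unfolding k_def[symmetric] KF_rel_def by (simp add: algebra_simps)
  qed (unfold k_def[symmetric], rule KF_rel_swap)
  also have "\<dots> \<longleftrightarrow> lin (- (1/2)) * (embU f * ?K - ?K * embU f) = ep * ((?f' - embU f) * ?K)"
  proof
    assume "lin 0 * (cmt (embU f) (embV k)) = ep * ((embV f - embU f) * embV k)"
    from shift_rel[OF this, of "1/2"] show "lin (- (1/2)) * (embU f * ?K - ?K * embU f) = ep * ((?f' - embU f) * ?K)"
      by (simp add: calg_hom_simps[OF calg_hom_shift])
  next
    assume "lin (- (1/2)) * (embU f * ?K - ?K * embU f) = ep * ((?f' - embU f) * ?K)"
    from shift_rel[OF this, of "- (1/2)"] show "lin 0 * (cmt (embU f) (embV k)) = ep * ((embV f - embU f) * embV k)"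
      by (simp add: calg_hom_simps[OF calg_hom_shift] shift_shift)
  qed
  also have "\<dots> \<longleftrightarrow> lin (- (1/2)) * (?h * embU f - embU f * ?h) = ep * (?h * (?f' - embU f))"
  proof
    assume "lin (- (1/2)) * (embU f * ?K - ?K * embU f) = ep * ((?f' - embU f) * ?K)"
    then have "?h * (lin (- (1/2)) * (embU f * ?K - ?K * embU f)) * ?h = ?h * (ep * ((?f' - embU f) * ?K)) * ?h" by simp
    then have "lin (- (1/2)) * (?h * embU f * (?K * ?h) - (?h * ?K) * (embU f * ?h)) = ep * (?h * (?f' - embU f) * (?K * ?h))"
      by (simp only: comm mult.assoc left_diff_distrib right_diff_distrib)
    then show "lin (- (1/2)) * (?h * embU f - embU f * ?h) = ep * (?h * (?f' - embU f))" by (simp add: Kh)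
  next
    assume "lin (- (1/2)) * (?h * embU f - embU f * ?h) = ep * (?h * (?f' - embU f))"
    then have "?K * (lin (- (1/2)) * (?h * embU f - embU f * ?h)) * ?K = ?K * (ep * (?h * (?f' - embU f))) * ?K" by simp
    then have "lin (- (1/2)) * ((?K * ?h) * (embU f * ?K) - ?K * embU f * (?h * ?K)) = ep * ((?K * ?h) * ((?f' - embU f) * ?K))"
      by (simp only: comm mult.assoc left_diff_distrib right_diff_distrib)
    then show "lin (- (1/2)) * (embU f * ?K - ?K * embU f) = ep * ((?f' - embU f) * ?K)" by (simp add: Kh)
  qed
  also have "\<dots> \<longleftrightarrow> ?r"
  proof
    assume "lin (- (1/2)) * (?h * embU f - embU f * ?h) = ep * (?h * (?f' - embU f))"
    from swap_rel[OF this] show ?r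
      by (simp add: calg_hom_simps[OF calg_hom_swap] algebra_simps)
  next
    assume ?r
    from swap_rel[OF this] show "lin (- (1/2)) * (?h * embU f - embU f * ?h) = ep * (?h * (?f' - embU f))"
      by (simp add: calg_hom_simps[OF calg_hom_swap] algebra_simps)
  qed
  finally show ?thesis .
qed

text \<open>With a and b the two products in a commutator, this trades the half commutator produced
  by \<open>lin (1/2)\<close> for the half anticommutator of the defining relations.\<close>

lemma half_eq: "z + sc (1/2) * (a - b) = - b \<longleftrightarrow> z = - (sc (1/2) * (a + b :: 'a::calg))"
  and half_eq': "z + sc (1/2) * (a - b) = a \<longleftrightarrow> z = sc (1/2) * (a + b :: 'a::calg)"
proof -
  have a: "a = sc (1/2) * a + sc (1/2) * a" and b: "b = sc (1/2) * b + sc (1/2) * b"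
    by (simp_all only: half_double)
  have "z + sc (1/2) * (a - b) = - (sc (1/2) * b + sc (1/2) * b) \<longleftrightarrow> z = - (sc (1/2) * (a + b))"
    "z + sc (1/2) * (a - b) = sc (1/2) * a + sc (1/2) * a \<longleftrightarrow> z = sc (1/2) * (a + b)"
    by (auto simp: algebra_simps eq_neg_iff_add_eq_0)
  then show "z + sc (1/2) * (a - b) = - b \<longleftrightarrow> z = - (sc (1/2) * (a + b))"
    "z + sc (1/2) * (a - b) = a \<longleftrightarrow> z = sc (1/2) * (a + b)"
    by (simp_all only: half_double)
qed

lemma HE_iff:
  fixes e H :: "'a::calg fps"
  assumes H: "H $ 0 = 1" and e: "e $ 0 = 0"
  shows "lin (1/2) * (cmt (embU H) (embV e)) = ep * ((embU (shift (1/2) e) - embV e) * embU H)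
    \<longleftrightarrow> (\<forall>k l. cmt (H $ Suc k) (e $ Suc l) - (cmt (H $ k) (e $ Suc (Suc l)))
          = - (sc (1/2) * (H $ k * e $ Suc l + e $ Suc l * H $ k)))" (is "?l \<longleftrightarrow> ?r")
proof
  assume ?l
  then have "cmt (H $ Suc m) (e $ n) - (cmt (H $ m) (e $ Suc n))
     + sc (1/2) * (cmt (H $ m) (e $ n)) = (if n = 0 then (shift (1/2) e * H) $ m else 0) - e $ n * H $ m" for n m
    unfolding lin_ep_iff left_diff_distrib calg_hom_mult[OF calg_hom_embU, symmetric]
    by (simp add: emb_mult_nth embU_nth)
  from this[of _ "Suc _"] show ?r by (simp add: half_eq)
next
  assume r: ?r
  \<comment> \<open>The boundary series is again kept as an unknown \<open>G\<close>; at v = u + 1/2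
    the factor u - v + 1/2 vanishes, which gives G = e(u + 1/2) H(u).\<close>
  define G where "G = fps_const (e $ 1) * H - H * fps_const (e $ 1)"
  have "cmt (H $ Suc m) (e $ n) - (cmt (H $ m) (e $ Suc n))
     + sc (1/2) * (cmt (H $ m) (e $ n)) = (if n = 0 then G $ m else 0) - e $ n * H $ m" for n m
    using r[rule_format, of m "n - 1", folded half_eq] by (cases n) (simp_all add: e G_def)
  then have l: "lin (1/2) * (cmt (embU H) (embV e)) = ep * (embU G - embV e * embU H)"
    unfolding lin_ep_iff by (simp add: emb_mult_nth embU_nth e H)
  from spec_rel[OF this, of "1/2"] have "G = shift (1/2) e * H" by (simp add: spec_simps)
  with l show ?l by (simp add: emb_simps left_diff_distrib)
qed

lemma HF_iff:
  fixes f H :: "'a::calg fps"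
  assumes H: "H $ 0 = 1" and f: "f $ 0 = 0"
  shows "lin (1/2) * (cmt (embU H) (embV f)) = ep * (embU H * (embV f - embU (shift (1/2) f)))
    \<longleftrightarrow> (\<forall>k l. cmt (H $ Suc k) (f $ Suc l) - (cmt (H $ k) (f $ Suc (Suc l)))
          = sc (1/2) * (H $ k * f $ Suc l + f $ Suc l * H $ k))" (is "?l \<longleftrightarrow> ?r")
proof
  assume ?l
  then have "cmt (H $ Suc m) (f $ n) - (cmt (H $ m) (f $ Suc n))
     + sc (1/2) * (cmt (H $ m) (f $ n)) = H $ m * f $ n - (if n = 0 then (H * shift (1/2) f) $ m else 0)" for n m
    unfolding lin_ep_iff right_diff_distrib[of "embU H"] calg_hom_mult[OF calg_hom_embU, symmetric]
    by (simp add: emb_mult_nth embU_nth)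
  from this[of _ "Suc _"] show ?r by (simp add: half_eq')
next
  assume r: ?r
  define G where "G = H * fps_const (f $ 1) - fps_const (f $ 1) * H"
  have "cmt (H $ Suc m) (f $ n) - (cmt (H $ m) (f $ Suc n))
     + sc (1/2) * (cmt (H $ m) (f $ n)) = H $ m * f $ n - (if n = 0 then G $ m else 0)" for n m
    using r[rule_format, of m "n - 1", folded half_eq'] by (cases n) (simp_all add: f G_def)
  then have l: "lin (1/2) * (cmt (embU H) (embV f)) = ep * (embU H * embV f - embU G)"
    unfolding lin_ep_iff by (simp add: emb_mult_nth embU_nth f H)
  from spec_rel[OF this, of "1/2"] have "G = H * shift (1/2) f" by (simp add: spec_simps)
  with l show ?l by (simp add: emb_simps right_diff_distrib)
qed

lemma drinfeld_iff: "drinfeld e f H \<longleftrightarrow> H $ 0 = 1 \<and> e $ 0 = 0 \<and> f $ 0 = 0 \<and> drinfeld_coeffs e f H"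
proof (cases "H $ 0 = 1 \<and> e $ 0 = 0 \<and> f $ 0 = 0")
  case True
  then have 0: "H $ 0 = 1" "e $ 0 = 0" "f $ 0 = 0" by auto
  have E: "(lin 0 + lin 0) * z = lin 0 * (z + z)" for z :: "'a fps fps" by (simp add: algebra_simps)
  have m1: "sc (- 1) * z = - z" for z :: "'a fps fps" by (simp add: sc_minus)
  have m2: "sc (- 1/2) * z = - (sc (1/2) * z)" for z :: 'a using sc_minus[of "1/2", where 'a = 'a] by simp
  show ?thesis
    unfolding drinfeld_def drinfeld_coeffs_def KE_iff[OF 0(1)] KF_iff[OF 0(1)] HE_iff[OF 0(1,2)] HF_iff[OF 0(1,3)] commuting_iff EF_iff[OF 0(2,3)] E
    using EE_iff[OF 0(2), of 1] EE_iff[OF 0(3), of "- 1"] 0 unfolding sc_one m1 m2 by auto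
qed (auto simp: drinfeld_def)

text \<open>The one-dimensional representation, which shows that neither relation ideal contains
  1.\<close>

lemma drinfeld_trivial: "drinfeld 0 0 1"
  by (simp add: drinfeld_iff drinfeld_coeffs_def fps_one_nth)

section \<open>The Drinfeld realisation\<close>

lemma one_notin_genideal:
  fixes \<phi> :: "'g \<Rightarrow> 'a::calg"
  assumes "\<And>p. p \<in> S \<Longrightarrow> fa_eval \<phi> p = 0" shows "1 \<notin> genideal fa_ring S"
  using genideal_subset_kernel[OF calg_hom_fa_eval, of S \<phi> 1] assms by (auto simp: fa_eval_simps)

fun series_eval :: "'a fps \<Rightarrow> 'a fps \<Rightarrow> 'a fps \<Rightarrow> genY \<Rightarrow> 'a" where
  "series_eval e f H (GH k) = H $ Suc k"
| "series_eval e f H (GXp k) = f $ Suc k"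
| "series_eval e f H (GXm k) = e $ Suc k"

lemma relsY_zero_of_drinfeld:
  assumes d: "drinfeld e f H" and p: "p \<in> relsY"
  shows "fa_eval (series_eval e f H) p = 0"
proof -
  have c: "H $ 0 = 1" "\<And>k l. H $ k * H $ l = H $ l * H $ k"
    "\<And>k l. cmt (f $ Suc k) (e $ Suc l) = H $ Suc (k + l)"
    "\<And>k l. cmt (H $ Suc k) (f $ Suc l) - (cmt (H $ k) (f $ Suc (Suc l)))
          = sc (1/2) * (H $ k * f $ Suc l + f $ Suc l * H $ k)"
    "\<And>k l. cmt (H $ Suc k) (e $ Suc l) - (cmt (H $ k) (e $ Suc (Suc l)))
          = - (sc (1/2) * (H $ k * e $ Suc l + e $ Suc l * H $ k))"
    "\<And>k l. cmt (f $ Suc (Suc k)) (f $ Suc l) - (cmt (f $ Suc k) (f $ Suc (Suc l)))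
          = sc (1/2) * (f $ Suc k * f $ Suc l + f $ Suc l * f $ Suc k)"
    "\<And>k l. cmt (e $ Suc (Suc k)) (e $ Suc l) - (cmt (e $ Suc k) (e $ Suc (Suc l)))
          = - (sc (1/2) * (e $ Suc k * e $ Suc l + e $ Suc l * e $ Suc k))"
    using d unfolding drinfeld_iff drinfeld_coeffs_def by blast+
  \<comment> \<open>The relations of h_0 with x_l are the case of index 0, where the coefficient of
    H is 1.\<close>
  have h0: "cmt (H $ Suc 0) (f $ Suc l) = f $ Suc l"
    "cmt (H $ Suc 0) (e $ Suc l) = - (e $ Suc l)" for l
    using c(4)[of 0 l] c(5)[of 0 l] by (simp_all add: c(1) distrib_left half_double)
  show ?thesis
    using p unfolding relsY_def
    by (auto simp: fa_eval_simps comm_def acomm_def hY_def xpY_def xmY_def h0 c(2-) sc_eq_fa_scal[symmetric])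
qed

instantiation genY :: presentation
begin
definition rels_genY :: "genY fa set" where "rels_genY = relsY"
instance
  by standard (unfold rels_genY_def, rule one_notin_genideal[OF relsY_zero_of_drinfeld[OF drinfeld_trivial[where 'a = complex]]])
end

definition "yE = Abs_fps (\<lambda>n. if n = 0 then 0 else pcls (xmY (n - 1)))"
definition "yF = Abs_fps (\<lambda>n. if n = 0 then 0 else pcls (xpY (n - 1)))"
definition "yH = Abs_fps (\<lambda>n. if n = 0 then 1 else pcls (hY (n - 1)))"

lemma drinfeld_Y: "drinfeld yE yF yH"
proof -
  have 0: "pcls p = 0" if "p \<in> relsY" for p
    using that by (intro pcls_eq_zero) (simp add: rels_genY_def)
  note s = calg_hom_simps[OF calg_hom_pcls] comm_def acomm_def sc_eq_fa_scal[symmetric]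
  have "comm (hY k) (hY l) \<in> relsY" for k l
    unfolding relsY_def by blast
  from 0[OF this] have hh: "pcls (hY k) * pcls (hY l) = pcls (hY l) * pcls (hY k)" for k l
    by (simp add: s)
  have "comm (xpY k) (xmY l) - hY (k + l) \<in> relsY" for k l
    unfolding relsY_def by blast
  from 0[OF this] have xx: "cmt (pcls (xpY k)) (pcls (xmY l)) = pcls (hY (k + l))" for k l
    by (simp add: s)
  have "comm (hY 0) (xpY l) - xpY l \<in> relsY" for l
    unfolding relsY_def by blast
  from 0[OF this] have h0p: "cmt (pcls (hY 0)) (pcls (xpY l)) = pcls (xpY l)" for l
    by (simp add: s)
  have "comm (hY 0) (xmY l) + xmY l \<in> relsY" for l
    unfolding relsY_def by blast
  from 0[OF this] have h0m: "cmt (pcls (hY 0)) (pcls (xmY l)) = - pcls (xmY l)" for l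
    by (simp add: s eq_neg_iff_add_eq_0)
  have "comm (hY (k+1)) (xpY l) - comm (hY k) (xpY (l+1)) - fa_scal (1/2) * acomm (hY k) (xpY l) \<in> relsY" for k l
    unfolding relsY_def by blast
  from 0[OF this] have hp: "cmt (pcls (hY (Suc k))) (pcls (xpY l))
     - (cmt (pcls (hY k)) (pcls (xpY (Suc l))))
     = sc (1/2) * (pcls (hY k) * pcls (xpY l) + pcls (xpY l) * pcls (hY k))" for k l
    by (simp add: s)
  have "comm (hY (k+1)) (xmY l) - comm (hY k) (xmY (l+1)) + fa_scal (1/2) * acomm (hY k) (xmY l) \<in> relsY" for k l
    unfolding relsY_def by blast
  from 0[OF this] have hm: "cmt (pcls (hY (Suc k))) (pcls (xmY l))
     - (cmt (pcls (hY k)) (pcls (xmY (Suc l))))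
     = - (sc (1/2) * (pcls (hY k) * pcls (xmY l) + pcls (xmY l) * pcls (hY k)))" for k l
    by (simp add: s eq_neg_iff_add_eq_0)
  have "comm (xpY (k+1)) (xpY l) - comm (xpY k) (xpY (l+1)) - fa_scal (1/2) * acomm (xpY k) (xpY l) \<in> relsY" for k l
    unfolding relsY_def by blast
  from 0[OF this] have pp: "cmt (pcls (xpY (Suc k))) (pcls (xpY l))
     - (cmt (pcls (xpY k)) (pcls (xpY (Suc l))))
     = sc (1/2) * (pcls (xpY k) * pcls (xpY l) + pcls (xpY l) * pcls (xpY k))" for k l
    by (simp add: s)
  have "comm (xmY (k+1)) (xmY l) - comm (xmY k) (xmY (l+1)) + fa_scal (1/2) * acomm (xmY k) (xmY l) \<in> relsY" for k l
    unfolding relsY_def by blast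
  from 0[OF this] have mm: "cmt (pcls (xmY (Suc k))) (pcls (xmY l))
     - (cmt (pcls (xmY k)) (pcls (xmY (Suc l))))
     = - (sc (1/2) * (pcls (xmY k) * pcls (xmY l) + pcls (xmY l) * pcls (xmY k)))" for k l
    by (simp add: s eq_neg_iff_add_eq_0)
  have "drinfeld_coeffs yE yF yH"
    unfolding drinfeld_coeffs_def
  proof (intro conjI allI)
    fix k l
    show "cmt (yH $ Suc k) (yF $ Suc l) - (cmt (yH $ k) (yF $ Suc (Suc l)))
          = sc (1/2) * (yH $ k * yF $ Suc l + yF $ Suc l * yH $ k)"
      \<comment> \<open>Coefficient k of H is h_(k-1) for k > 0; for k = 0 it is 1, and the claim is
        the relation of h_0.\<close>
      using hp[of "k - 1" l] h0p[of l] by (cases k) (simp_all add: yH_def yF_def distrib_left half_double)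
    show "cmt (yH $ Suc k) (yE $ Suc l) - (cmt (yH $ k) (yE $ Suc (Suc l)))
          = - (sc (1/2) * (yH $ k * yE $ Suc l + yE $ Suc l * yH $ k))"
      using hm[of "k - 1" l] h0m[of l] by (cases k) (simp_all add: yH_def yE_def distrib_left half_double del: minus_add_distrib)
  qed (auto simp: yE_def yF_def yH_def hh xx pp mm)
  then show ?thesis by (simp add: drinfeld_iff yE_def yF_def yH_def)
qed

lemma ex_hom_Y:
  assumes "drinfeld e f H"
  obtains \<Phi> :: "genY palg \<Rightarrow> 'a::calg" where "calg_hom \<Phi>" "fmap \<Phi> yE = e" "fmap \<Phi> yF = f" "fmap \<Phi> yH = H"
proof -
  have "fa_eval (series_eval e f H) p = 0" if "p \<in> rels" for p
    using relsY_zero_of_drinfeld[OF assms] that by (simp add: rels_genY_def)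
  from ex_palg_hom[OF this] obtain \<Phi> where \<Phi>: "calg_hom \<Phi>" "\<And>g. \<Phi> (pcls (fa_gen g)) = series_eval e f H g"
    by blast
  have "fmap \<Phi> yE = e" "fmap \<Phi> yF = f" "fmap \<Phi> yH = H"
    using assms \<Phi> by (auto simp: drinfeld_def fps_eq_iff yE_def yF_def yH_def xmY_def xpY_def hY_def calg_hom_simps[OF \<Phi>(1)] gr0_conv_Suc)
  with \<Phi>(1) that show thesis by blast
qed

lemma hom_eq_Y:
  assumes "calg_hom \<Phi>" "calg_hom \<Psi>" and "fmap \<Phi> yE = fmap \<Psi> yE" "fmap \<Phi> yF = fmap \<Psi> yF" "fmap \<Phi> yH = fmap \<Psi> yH"
  shows "\<Phi> a = \<Psi> a"
proof (rule palg_hom_eq[OF assms(1,2)])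
  have "fmap \<Phi> yE $ Suc k = fmap \<Psi> yE $ Suc k" "fmap \<Phi> yF $ Suc k = fmap \<Psi> yF $ Suc k" "fmap \<Phi> yH $ Suc k = fmap \<Psi> yH $ Suc k" for k
    by (simp_all only: assms)
  then show "\<Phi> (pcls (fa_gen g)) = \<Psi> (pcls (fa_gen g))" for g
    by (cases g) (simp_all add: yE_def yF_def yH_def hY_def xpY_def xmY_def)
qed

section \<open>Coefficients of the RTT relations\<close>

text \<open>The coefficients of the identity, \<open>P\<close> and \<open>Q\<close> in \<open>MC\<close>.\<close>

definition mcI :: "nat \<Rightarrow> nat \<Rightarrow> complex" where
  "mcI p q = (if (p, q) = (2, 0) then 1 else if (p, q) = (1, 1) then - 2 else if (p, q) = (0, 2) then 1
     else if (p, q) = (1, 0) then - (1/2) else if (p, q) = (0, 1) then 1/2 else 0)"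
definition mcP :: "nat \<Rightarrow> nat \<Rightarrow> complex" where
  "mcP p q = (if (p, q) = (1, 0) then - 1 else if (p, q) = (0, 1) then 1 else if (p, q) = (0, 0) then 1/2 else 0)"
definition mcQ :: "nat \<Rightarrow> nat \<Rightarrow> complex" where
  "mcQ p q = (if (p, q) = (1, 0) then 1 else if (p, q) = (0, 1) then - 1 else 0)"

lemma MC_eq: "MC p q ik mn = mcI p q * IdM ik mn + mcP p q * PM ik mn + mcQ p q * QM ik mn"
  by (simp add: MC_def mcI_def mcP_def mcQ_def)

lemma MC_left:
  "(\<Sum>m\<in>idxs. \<Sum>n\<in>idxs. sc (MC p q (i, k) (m, n)) * g m n) =
    sc (mcI p q) * g i k + sc (mcP p q) * g k i + sc (mcQ p q) * (if k = neg3 i then \<Sum>m\<in>idxs. g m (neg3 m) else (0::'a::calg))"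
  unfolding MC_eq
  by (cases i; cases k) (simp_all add: sum_idxs IdM_def PM_def QM_def sc_add distrib_left distrib_right)

lemma MC_right:
  "(\<Sum>m\<in>idxs. \<Sum>n\<in>idxs. g m n * sc (MC p q (m, n) (j, l))) =
    sc (mcI p q) * g j l + sc (mcP p q) * g l j + sc (mcQ p q) * (if l = neg3 j then \<Sum>m\<in>idxs. g m (neg3 m) else (0::'a::calg))"
proof -
  have *: "g m n * sc (MC p q (m, n) (j, l)) = sc (MC p q (m, n) (j, l)) * g m n" for m n
    by (rule sc_commute[symmetric])
  show ?thesis
    unfolding * unfolding MC_eq
    by (cases j; cases l) (simp_all add: sum_idxs IdM_def PM_def QM_def sc_add distrib_left distrib_right)
qed

text \<open>The monomial u^p v^q / (u v)^2: \<open>rel\<close> carries the denominator (u v)^2,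
  whereas \<open>rttRel\<close> does not.\<close>

definition uv_mono :: "nat \<Rightarrow> nat \<Rightarrow> 'a::calg fps fps" where
  "uv_mono p q = fps_const (fps_X ^ (2 - p)) * fps_X ^ (2 - q)"

lemma sum_three: "(\<Sum>p\<in>{0..2::nat}. g p) = g 0 + g 1 + g 2"
  by (simp add: numeral_2_eq_2)

lemma lin_expand:
  fixes X Y F :: "'a::calg fps fps"
  defines "X \<equiv> fps_const fps_X" and "Y \<equiv> fps_X"
  shows "(\<Sum>p\<in>{0..2}. \<Sum>q\<in>{0..2}. uv_mono p q * (sc (mcI p q) * F)) = lin 0 * (lin (- 1/2) * F)"
    and "(\<Sum>p\<in>{0..2}. \<Sum>q\<in>{0..2}. uv_mono p q * (sc (mcP p q) * F)) = - (ep * (lin (- 1/2) * F))"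
    and "(\<Sum>p\<in>{0..2}. \<Sum>q\<in>{0..2}. uv_mono p q * (sc (mcQ p q) * F)) = ep * (lin 0 * F)"
proof -
  have XY: "X * (Y * z) = Y * (X * z)" "X * Y = Y * X" for z
    unfolding X_def Y_def by (simp_all add: centralC[OF central_X])
  have c: "X * (sc d * z) = sc d * (X * z)" "Y * (sc d * z) = sc d * (Y * z)" for d z
    by (rule sc_left_commute)+
  have m: "uv_mono 0 0 = Y * (Y * (X * X))" "uv_mono 0 1 = Y * (X * X)" "uv_mono 0 2 = X * X" "uv_mono 1 0 = Y * (Y * X)"
    "uv_mono 1 1 = Y * X" "uv_mono 1 2 = X" "uv_mono 2 0 = Y * Y" "uv_mono 2 1 = Y" "uv_mono 2 2 = 1"
    "uv_mono 0 (Suc 0) = Y * (X * X)" "uv_mono (Suc 0) 0 = Y * (Y * X)" "uv_mono (Suc 0) (Suc 0) = Y * X" "uv_mono (Suc 0) 2 = X" "uv_mono 2 (Suc 0) = Y"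
    unfolding uv_mono_def X_def[symmetric] Y_def[symmetric]
    by (simp_all add: power2_eq_square XY mult.assoc flip: fps_const_mult) (simp_all add: X_def[symmetric] XY mult.assoc)
  have l: "lin d = Y - X + sc d * (Y * X)" "ep = Y * X" for d
    by (simp_all add: lin_def ep_def X_def Y_def)
  have n: "sc (- d) * z = - (sc d * z)" for d and z :: "'a fps fps" by (simp add: sc_minus)
  show "(\<Sum>p\<in>{0..2}. \<Sum>q\<in>{0..2}. uv_mono p q * (sc (mcI p q) * F)) = lin 0 * (lin (- 1/2) * F)"
    "(\<Sum>p\<in>{0..2}. \<Sum>q\<in>{0..2}. uv_mono p q * (sc (mcP p q) * F)) = - (ep * (lin (- 1/2) * F))"
    "(\<Sum>p\<in>{0..2}. \<Sum>q\<in>{0..2}. uv_mono p q * (sc (mcQ p q) * F)) = ep * (lin 0 * F)"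
    unfolding sum_three
    by (simp_all add: mcI_def mcP_def mcQ_def m l n sc_two algebra_simps XY c)
qed

lemma uv_mono_mult_nth:
  "(uv_mono p q * F) $ N $ M = (if 2 - q \<le> N \<and> 2 - p \<le> M then F $ (N - (2 - q)) $ (M - (2 - p)) else 0)"
  by (simp add: uv_mono_def mult.assoc fps_X_power_mult_nth)

definition matrix_eval :: "(genR \<Rightarrow> 'a::calg) \<Rightarrow> idx3 \<Rightarrow> idx3 \<Rightarrow> 'a fps" where
  "matrix_eval \<phi> i j = Abs_fps (\<lambda>r. fa_eval \<phi> (tR i j r))"

lemma fa_eval_sum: "fa_eval \<phi> (\<Sum>i\<in>A. g i) = (\<Sum>i\<in>A. fa_eval \<phi> (g i))"
  by (rule calg_hom_sum[OF calg_hom_fa_eval])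

text \<open>Dividing by (u v)^2 shifts exponents by 2, so the coefficient of u^a v^b is found at
  v^-(2-b) u^-(2-a); for larger a or b there is none.\<close>

lemma fa_eval_rttRel:
  "fa_eval \<phi> (rttRel a b i k j l) =
     (if a \<le> 2 \<and> b \<le> 2 then rel (matrix_eval \<phi>) i k j l $ nat (2 - b) $ nat (2 - a) else 0)"
proof (cases "a \<le> 2 \<and> b \<le> 2")
  case True
  let ?T = "matrix_eval \<phi>"
  let ?f = "\<lambda>m n. embU (?T m j) * embV (?T n l)" and ?g = "\<lambda>m n. embV (?T k n) * embU (?T i m)"
  let ?C = "?f i k - ?g j l" and ?P = "?f k i - ?g l j"
    and ?Q = "(if k = neg3 i then \<Sum>m\<in>idxs. ?f m (neg3 m) else 0) - (if l = neg3 j then \<Sum>m\<in>idxs. ?g m (neg3 m) else 0)"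
  have "rel ?T i k j l = (\<Sum>p\<in>{0..2}. \<Sum>q\<in>{0..2}. uv_mono p q * (sc (mcI p q) * ?C))
     + (\<Sum>p\<in>{0..2}. \<Sum>q\<in>{0..2}. uv_mono p q * (sc (mcP p q) * ?P)) + (\<Sum>p\<in>{0..2}. \<Sum>q\<in>{0..2}. uv_mono p q * (sc (mcQ p q) * ?Q))"
    unfolding lin_expand rel_def by simp
  also have "\<dots> = (\<Sum>p\<in>{0..2}. \<Sum>q\<in>{0..2}. uv_mono p q * (sc (mcI p q) * ?C + sc (mcP p q) * ?P + sc (mcQ p q) * ?Q))"
    by (simp add: sum.distrib distrib_left)
  finally have rel: "rel ?T i k j l $ nat (2 - b) $ nat (2 - a) = (\<Sum>p\<in>{0..2}. \<Sum>q\<in>{0..2}.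
     (uv_mono p q * (sc (mcI p q) * ?C + sc (mcP p q) * ?P + sc (mcQ p q) * ?Q)) $ nat (2 - b) $ nat (2 - a))"
    by (simp add: fps_sum_nth)
  have "fa_eval \<phi> (rttRel a b i k j l) = (\<Sum>p\<in>{0..2}. \<Sum>q\<in>{0..2}.
     (uv_mono p q * (sc (mcI p q) * ?C + sc (mcP p q) * ?P + sc (mcQ p q) * ?Q)) $ nat (2 - b) $ nat (2 - a))"
    unfolding rttRel_def fa_eval_sum
  proof (intro sum.cong refl)
    fix p q :: nat assume "p \<in> {0..2}" "q \<in> {0..2}"
    then have pq: "p \<le> 2" "q \<le> 2" by auto
    let ?S = "\<Sum>m\<in>idxs. \<Sum>n\<in>idxs.
              fa_scal (MC p q (i, k) (m, n)) * tR m j (nat (int p - a)) * tR n l (nat (int q - b))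
            - tR k n (nat (int q - b)) * tR i m (nat (int p - a)) * fa_scal (MC p q (m, n) (j, l))"
    have idx: "2 - q \<le> nat (2 - b) \<longleftrightarrow> b \<le> int q" "2 - p \<le> nat (2 - a) \<longleftrightarrow> a \<le> int p"
      "a \<le> int p \<Longrightarrow> nat (2 - a) - (2 - p) = nat (int p - a)" "b \<le> int q \<Longrightarrow> nat (2 - b) - (2 - q) = nat (int q - b)"
      using True pq by linarith+
    let ?u = "nat (int p - a)" and ?v = "nat (int q - b)"
    have "fa_eval \<phi> ?S = (\<Sum>m\<in>idxs. \<Sum>n\<in>idxs. sc (MC p q (i, k) (m, n)) * (?T m j $ ?u * ?T n l $ ?v))
       - (\<Sum>m\<in>idxs. \<Sum>n\<in>idxs. ?T k n $ ?v * ?T i m $ ?u * sc (MC p q (m, n) (j, l)))"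
      by (simp add: fa_eval_sum fa_eval_simps matrix_eval_def sum_subtractf mult.assoc flip: sc_eq_fa_scal)
    also have "\<dots> = (sc (mcI p q) * ?C + sc (mcP p q) * ?P + sc (mcQ p q) * ?Q) $ ?v $ ?u"
      unfolding MC_left MC_right by (simp add: emb_mult_nth fps_sum_nth right_diff_distrib)
    finally have S: "fa_eval \<phi> ?S = (sc (mcI p q) * ?C + sc (mcP p q) * ?P + sc (mcQ p q) * ?Q) $ ?v $ ?u" .
    show "fa_eval \<phi> (if a \<le> int p \<and> b \<le> int q then ?S else 0) =
      (uv_mono p q * (sc (mcI p q) * ?C + sc (mcP p q) * ?P + sc (mcQ p q) * ?Q)) $ nat (2 - b) $ nat (2 - a)"
      unfolding uv_mono_mult_nth idx(1,2) using S idx(3,4) by (simp add: fa_eval_simps)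
  qed
  with rel True show ?thesis by simp
next
  case False
  then have "(if a \<le> int p \<and> b \<le> int q then z else 0) = 0" if "p \<in> {0..2}" "q \<in> {0..2}" for p q and z :: "genR fa"
    using that by auto
  then have "rttRel a b i k j l = 0" unfolding rttRel_def by (intro sum.neutral ballI) simp
  with False show ?thesis by (auto simp: fa_eval_simps)
qed

lemma cshift_eq: "cshift s n = shift_coeff (1/2) s n"
  by (simp add: cshift_def shift_coeff_def)

lemma fa_eval_unitRel1:
  "fa_eval \<phi> (unitRel1 N i j) =
     (\<Sum>m\<in>idxs. matrix_eval \<phi> i m * shift (1/2) (matrix_eval \<phi> (neg3 j) (neg3 m))) $ N - (if N = 0 \<and> i = j then 1 else 0)"
proof -
  let ?T = "matrix_eval \<phi>"
  have "(\<Sum>m\<in>idxs. ?T i m * shift (1/2) (?T (neg3 j) (neg3 m))) $ N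
    = (\<Sum>m\<in>idxs. \<Sum>r\<in>{0..N}. \<Sum>s\<in>{0..N-r}. sc (shift_coeff (1/2) s (N - r - s)) * (?T i m $ r * ?T (neg3 j) (neg3 m) $ s))"
    by (simp add: fps_sum_nth fps_mult_nth shift_nth atLeast0AtMost sum_distrib_left sc_left_commute)
  also have "\<dots> = (\<Sum>r\<in>{0..N}. \<Sum>s\<in>{0..N-r}. \<Sum>m\<in>idxs. sc (shift_coeff (1/2) s (N - r - s)) * (?T i m $ r * ?T (neg3 j) (neg3 m) $ s))"
    by (subst sum.swap, rule sum.cong[OF refl], rule sum.swap)
  finally show ?thesis
    by (simp add: unitRel1_def fa_eval_simps fa_eval_sum matrix_eval_def cshift_eq mult.assoc flip: sc_eq_fa_scal)
qed

lemma fa_eval_unitRel2: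
  "fa_eval \<phi> (unitRel2 N i j) =
     (\<Sum>m\<in>idxs. shift (1/2) (matrix_eval \<phi> (neg3 m) (neg3 i)) * matrix_eval \<phi> m j) $ N - (if N = 0 \<and> i = j then 1 else 0)"
proof -
  let ?T = "matrix_eval \<phi>"
  \<comment> \<open>In \<open>unitRel2\<close> the outer summation index is the degree of the second
    factor.\<close>
  have rev: "(f * g) $ N = (\<Sum>r\<in>{0..N}. f $ (N - r) * g $ r)" for f g :: "'a fps"
    unfolding fps_mult_nth by (rule sum.reindex_bij_witness[where i = "\<lambda>r. N - r" and j = "\<lambda>r. N - r"]) auto
  have "(\<Sum>m\<in>idxs. shift (1/2) (?T (neg3 m) (neg3 i)) * ?T m j) $ N
    = (\<Sum>m\<in>idxs. \<Sum>r\<in>{0..N}. \<Sum>s\<in>{0..N-r}. sc (shift_coeff (1/2) s (N - r - s)) * (?T (neg3 m) (neg3 i) $ s * ?T m j $ r))"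
    by (simp add: fps_sum_nth rev shift_nth atLeast0AtMost sum_distrib_right mult.assoc)
  also have "\<dots> = (\<Sum>r\<in>{0..N}. \<Sum>s\<in>{0..N-r}. \<Sum>m\<in>idxs. sc (shift_coeff (1/2) s (N - r - s)) * (?T (neg3 m) (neg3 i) $ s * ?T m j $ r))"
    by (subst sum.swap, rule sum.cong[OF refl], rule sum.swap)
  finally show ?thesis
    by (simp add: unitRel2_def fa_eval_simps fa_eval_sum matrix_eval_def cshift_eq mult.assoc flip: sc_eq_fa_scal)
qed

lemma rtt_iff: "rtt (matrix_eval \<phi>) \<longleftrightarrow> (\<forall>p\<in>relsR. fa_eval \<phi> p = 0)" (is "rtt ?T \<longleftrightarrow> _")
proof
  assume "rtt ?T"
  then show "\<forall>p\<in>relsR. fa_eval \<phi> p = 0"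
    unfolding relsR_def rtt_def by (auto simp: fa_eval_rttRel fa_eval_unitRel1 fa_eval_unitRel2 fps_one_nth)
next
  assume r: "\<forall>p\<in>relsR. fa_eval \<phi> p = 0"
  have "rel ?T i k j l $ N $ M = 0" for i k j l N M
  proof -
    have "rttRel (2 - int M) (2 - int N) i k j l \<in> relsR" unfolding relsR_def by blast
    then show ?thesis using r fa_eval_rttRel[of \<phi> "2 - int M" "2 - int N" i k j l] by simp
  qed
  then have 1: "rel ?T i k j l = 0" for i k j l by (simp add: fps_eq_iff)
  have "unitRel1 N i j \<in> relsR" "unitRel2 N i j \<in> relsR" for N i j unfolding relsR_def by blast+
  then have "fa_eval \<phi> (unitRel1 N i j) = 0" "fa_eval \<phi> (unitRel2 N i j) = 0" for N i j using r by blast+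
  then have 2: "(\<Sum>m\<in>idxs. ?T i m * shift (1/2) (?T (neg3 j) (neg3 m))) = (if i = j then 1 else 0)"
    "(\<Sum>m\<in>idxs. shift (1/2) (?T (neg3 m) (neg3 i)) * ?T m j) = (if i = j then 1 else 0)" for i j
    unfolding fa_eval_unitRel1 fa_eval_unitRel2 by (auto simp: fps_eq_iff fps_one_nth)
  have "?T i j $ 0 = (if i = j then 1 else 0)" for i j
    by (simp add: matrix_eval_def tR_def fa_eval_simps)
  with 1 2 show "rtt ?T" by (simp add: rtt_def)
qed

fun entry_eval :: "(idx3 \<Rightarrow> idx3 \<Rightarrow> 'a fps) \<Rightarrow> genR \<Rightarrow> 'a" where
  "entry_eval T (GT i j r) = T i j $ Suc r"

lemma matrix_eval_entry_eval:
  assumes "\<And>i j. T i j $ 0 = (if i = j then 1 else 0)"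
  shows "matrix_eval (entry_eval T) = T"
  by (intro ext fps_ext) (auto simp: matrix_eval_def tR_def fa_eval_simps assms gr0_conv_Suc)

lemma relsR_zero_of_rtt:
  assumes "rtt T" "p \<in> relsR" shows "fa_eval (entry_eval T) p = 0"
  using assms rtt_iff[of "entry_eval T"] matrix_eval_entry_eval[of T] by (simp add: rtt_def[of T])

lemma drinfeld_imp_rtt: "drinfeld e f H \<Longrightarrow> rtt (gmat (drinfeld_gauss e f H))"
  using drinfeld_alg.rtt[of e f H] by (simp add: drinfeld_alg_def drinfeld_alg.T_def)

instantiation genR :: presentation
begin
definition rels_genR :: "genR fa set" where "rels_genR = relsR"
instance
  by standard (unfold rels_genR_def,
    rule one_notin_genideal[OF relsR_zero_of_rtt[OF drinfeld_imp_rtt[OF drinfeld_trivial[where 'a = complex]]]])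
end

definition rT :: "idx3 \<Rightarrow> idx3 \<Rightarrow> genR palg fps" where
  "rT i j = Abs_fps (\<lambda>r. pcls (tR i j r))"

lemma rtt_R: "rtt rT"
proof -
  have eval: "fa_eval (\<lambda>g. pcls (fa_gen g)) p = pcls p" for p :: "genR fa"
    by (rule calg_hom_eq_on_generators[OF calg_hom_fa_eval calg_hom_pcls]) simp
  have "rT = matrix_eval (\<lambda>g. pcls (fa_gen g))"
    by (intro ext) (simp add: rT_def matrix_eval_def eval)
  moreover have "\<forall>p\<in>relsR. pcls p = (0 :: genR palg)"
    using pcls_eq_zero[where 'a = genR] by (simp add: rels_genR_def)
  ultimately show ?thesis using rtt_iff[of "\<lambda>g. pcls (fa_gen g) :: genR palg"] unfolding eval by simp
qed

lemma ex_hom_R: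
  assumes "rtt T"
  shows "\<exists>\<Phi> :: genR palg \<Rightarrow> 'a::calg. calg_hom \<Phi> \<and> (\<forall>i j. fmap \<Phi> (rT i j) = T i j)"
proof -
  have "fa_eval (entry_eval T) p = 0" if "p \<in> rels" for p
    using relsR_zero_of_rtt[OF assms] that by (simp add: rels_genR_def)
  from ex_palg_hom[OF this] obtain \<Phi> where \<Phi>: "calg_hom \<Phi>" "\<And>g. \<Phi> (pcls (fa_gen g)) = entry_eval T g"
    by blast
  have "fmap \<Phi> (rT i j) = T i j" for i j
    using assms by (auto simp: fps_eq_iff rT_def tR_def \<Phi>(2) rtt_def calg_hom_simps[OF \<Phi>(1)] calg_hom_simps[OF calg_hom_pcls] gr0_conv_Suc)
  with \<Phi>(1) show ?thesis by blast
qed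

lemma hom_eq_R:
  assumes "calg_hom \<Phi>" "calg_hom \<Psi>" and eq: "\<And>i j. fmap \<Phi> (rT i j) = fmap \<Psi> (rT i j)"
  shows "\<Phi> a = \<Psi> a"
proof (rule palg_hom_eq[OF assms(1,2)])
  have "fmap \<Phi> (rT i j) $ Suc r = fmap \<Psi> (rT i j) $ Suc r" for i j r by (simp only: eq)
  then show "\<Phi> (pcls (fa_gen g)) = \<Psi> (pcls (fa_gen g))" for g
    by (cases g) (simp add: rT_def tR_def)
qed

section \<open>Series over a presented algebra\<close>

declare fps_mult_nth_0 [simp] fps_mult_nth_1' [simp]

definition cseries :: "'g::presentation palg fps \<Rightarrow> nat \<Rightarrow> 'g fa set" where
  "cseries a n = coset (a $ n)"

lemma coset_in_carrier [simp]: "coset a \<in> carrier (presented rels)"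
  by (simp add: carrier_eq_range_coset)

lemma cseries_inj: "cseries a = cseries b \<longleftrightarrow> a = b"
  by (auto simp: cseries_def fun_eq_iff fps_eq_iff coset_inj)

lemma ex_cseries:
  assumes "\<And>n. b n \<in> carrier (presented rels)" obtains b' where "b = cseries b'"
proof -
  have "\<forall>n. \<exists>a. b n = coset a" using assms by (auto simp: carrier_eq_range_coset)
  then obtain a where "\<And>n. b n = coset (a n)" by metis
  then have "b = cseries (Abs_fps a)" by (simp add: cseries_def fun_eq_iff)
  with that show thesis .
qed

lemma finsum_coset:
  fixes g :: "'i \<Rightarrow> 'g::presentation palg"
  shows "finite A \<Longrightarrow> finsum (presented rels) (\<lambda>i. coset (g i)) A = coset (\<Sum>i\<in>A. g i)"
proof (induction A rule: finite_induct)
  interpret ring "presented (rels :: 'g fa set)" by (rule ring_presented)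
  case empty
  show ?case by (simp add: coset_zero)
next
  interpret ring "presented (rels :: 'g fa set)" by (rule ring_presented)
  case (insert i A)
  then show ?case by (simp add: finsum_insert coset_add)
qed

lemma ser_mult_cseries: "ser_mult (presented rels) (cseries a) (cseries b) = cseries (a * b)"
  by (rule ext) (simp add: ser_mult_def cseries_def fps_mult_nth atLeast0AtMost finsum_coset flip: coset_mult)

lemma ser_one_cseries: "ser_one (presented rels) = cseries 1"
  and ser_zero_cseries: "ser_zero (presented rels) = cseries 0"
  by (auto simp: ser_one_def ser_zero_def cseries_def fun_eq_iff fps_one_nth coset_one coset_zero)

lemma ser_inv_cseries:
  assumes "a $ 0 = 1" shows "ser_inv (presented rels) (cseries a) = cseries (finv a)"
  unfolding ser_inv_def
proof (rule the_equality)
  show "(\<forall>n. cseries (finv a) n \<in> carrier (presented rels)) \<and>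
     ser_mult (presented rels) (cseries (finv a)) (cseries a) = ser_one (presented rels) \<and>
     ser_mult (presented rels) (cseries a) (cseries (finv a)) = ser_one (presented rels)"
    by (simp add: ser_mult_cseries ser_one_cseries finv_left finv_right assms) (simp add: cseries_def)
  fix b assume b: "(\<forall>n. b n \<in> carrier (presented rels)) \<and>
     ser_mult (presented rels) b (cseries a) = ser_one (presented rels) \<and>
     ser_mult (presented rels) (cseries a) b = ser_one (presented rels)"
  then obtain b' where b': "b = cseries b'" by (metis ex_cseries)
  with b have "b' * a = 1" by (simp add: ser_mult_cseries ser_one_cseries cseries_inj)
  then have "b' = finv a" by (rule finv_unique[OF assms])
  then show "b = cseries (finv a)" by (simp add: b')
qed

lemma ser_shift_cseries:
  fixes a :: "'g::presentation palg fps"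
  shows "ser_shift (presented rels) (\<lambda>c. cls rels (fa_scal c)) c (cseries a) = cseries (shift c a)"
proof -
  have "cls rels (fa_scal d) = coset (sc d :: 'g palg)" for d
    by (simp add: calg_hom_sc[OF calg_hom_pcls] flip: coset_pcls sc_eq_fa_scal)
  then show ?thesis
    by (intro ext) (simp add: ser_shift_def cseries_def shift_nth shift_coeff_def finsum_coset flip: coset_mult)
qed

lemma is_gauss_cseries:
  fixes T :: "idx3 \<Rightarrow> idx3 \<Rightarrow> 'g::presentation palg fps"
  shows "is_gauss (presented rels) (\<lambda>i j. cseries (T i j)) (\<lambda>c. cseries (g c)) \<longleftrightarrow>
     (\<forall>c\<in>{Km1, K0, K1}. g c $ 0 = 1) \<and> (\<forall>c\<in>{Em10, Em11, E01, F0m1, F1m1, F10}. g c $ 0 = 0) \<and> T = gmat g"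
proof -
  let ?R = "presented (rels :: 'g fa set)" and ?g = "\<lambda>c. cseries (g c)"
  define F where "F i m = (if i = m then 1 else
     (case (i, m) of (I0, Im) \<Rightarrow> g F0m1 | (Ip, Im) \<Rightarrow> g F1m1 | (Ip, I0) \<Rightarrow> g F10 | _ \<Rightarrow> 0))" for i m
  define E where "E m j = (if m = j then 1 else
     (case (m, j) of (Im, I0) \<Rightarrow> g Em10 | (Im, Ip) \<Rightarrow> g Em11 | (I0, Ip) \<Rightarrow> g E01 | _ \<Rightarrow> 0))" for m j
  have F: "Fm ?R ?g i m = cseries (F i m)" for i m
    by (cases i; cases m) (simp_all add: Fm_def F_def ser_one_cseries ser_zero_cseries)
  have E: "Em ?R ?g m j = cseries (E m j)" for m j
    by (cases m; cases j) (simp_all add: Em_def E_def ser_one_cseries ser_zero_cseries)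
  define K where "K m = (case m of Im \<Rightarrow> g Km1 | I0 \<Rightarrow> g K0 | Ip \<Rightarrow> g K1)" for m
  have K: "Km ?g m = cseries (K m)" for m
    by (cases m) (simp_all add: Km_def K_def)
  have prod: "(\<Sum>m\<in>idxs. F i m * K m * E m j) = gmat g i j" for i j
    by (cases i; cases j) (simp_all add: sum_idxs F_def E_def K_def algebra_simps)
  have "(\<lambda>n. finsum ?R (\<lambda>m. ser_mult ?R (ser_mult ?R (Fm ?R ?g i m) (Km ?g m)) (Em ?R ?g m j) n) idxs) = cseries (gmat g i j)" for i j
    unfolding F E K ser_mult_cseries prod[symmetric] by (simp add: cseries_def finsum_coset fps_sum_nth fun_eq_iff)
  then show ?thesis
    unfolding is_gauss_def by (auto simp: cseries_inj fun_eq_iff cseries_def coset_inj simp flip: coset_one coset_zero)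
      (auto simp: fps_eq_iff)
qed

text \<open>Uniqueness of the Gauss decomposition: the first row and column are read off first, then
  the inner block, each time cancelling a diagonal series with constant term 1.\<close>

lemma gmat_inj:
  assumes eq: "gmat g = gmat (h :: gcomp \<Rightarrow> 'a::ring_1 fps)"
    and one: "g Km1 $ 0 = 1" "g K0 $ 0 = 1"
  shows "g = h"
proof -
  have c: "a = b" if "z * a = z * b" "z $ 0 = 1" for z a b :: "'a fps"
    using that by (metis finv_left mult.assoc mult_1_left)
  have c': "a = b" if "a * z = b * z" "z $ 0 = 1" for z a b :: "'a fps"
    using that by (metis finv_right mult.assoc mult_1_right)
  have *: "gmat g i j = gmat h i j" for i j by (simp add: eq)
  have k: "g Km1 = h Km1" using *[of Im Im] by simp
  have e: "g Em10 = h Em10" "g Em11 = h Em11" using *[of Im I0] *[of Im Ip] one by (auto simp: k intro: c)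
  have f: "g F0m1 = h F0m1" "g F1m1 = h F1m1" using *[of I0 Im] *[of Ip Im] one by (auto simp: k intro: c')
  have k0: "g K0 = h K0" using *[of I0 I0] by (simp add: k e f)
  have e01: "g E01 = h E01" using *[of I0 Ip] one by (auto simp: k e f k0 intro: c)
  have f10: "g F10 = h F10" using *[of Ip I0] one by (auto simp: k e f k0 intro: c')
  have k1: "g K1 = h K1" using *[of Ip Ip] by (simp add: k e f k0 e01 f10)
  show ?thesis by (rule ext, rename_tac c, case_tac c) (simp_all add: k e f k0 e01 f10 k1)
qed

lemma fmap_gmat:
  assumes \<phi>: "calg_hom \<phi>" and H: "H $ 0 = 1"
  shows "fmap \<phi> (gmat (drinfeld_gauss e f H) i j) = gmat (drinfeld_gauss (fmap \<phi> e) (fmap \<phi> f) (fmap \<phi> H)) i j"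
proof -
  have "fmap \<phi> (finv (shift c H)) = finv (shift c (fmap \<phi> H))" for c
    using finv_fmap[OF \<phi>, of "shift c H"] by (simp add: shift_fmap[OF \<phi>] H)
  then show ?thesis
    by (cases i; cases j) (simp_all add: calg_hom_simps[OF calg_hom_fmap[OF \<phi>]] shift_fmap[OF \<phi>])
qed

interpretation R: rtt_matrix rT
  by standard (rule rtt_R)

lemma YR_eq: "YR = presented rels" and YD_eq: "YD = presented rels"
  by (simp_all add: YR_def YD_def rels_genR_def rels_genY_def)

lemma clsR_eq: "clsR p = coset (pcls p)" and clsY_eq: "clsY q = coset (pcls q)"
  by (simp_all add: clsR_def clsY_def coset_pcls rels_genR_def rels_genY_def)

lemma gR_eq: "gR c = cseries (drinfeld_gauss R.e R.f R.H c)"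
proof -
  have t: "tser = (\<lambda>i j. cseries (rT i j))"
    by (simp add: fun_eq_iff tser_def cseries_def rT_def clsR_eq)
  let ?g = "drinfeld_gauss R.e R.f R.H"
  have one: "?g Km1 $ 0 = 1" "?g K0 $ 0 = 1" by (simp_all add: fps_mult_nth_0)
  have "gauss YR tser = (\<lambda>c. cseries (?g c))"
    unfolding gauss_def YR_eq t
  proof (rule the_equality)
    show "is_gauss (presented rels) (\<lambda>i j. cseries (rT i j)) (\<lambda>c. cseries (?g c))"
      unfolding is_gauss_cseries using R.T_eq by simp
    fix g assume g: "is_gauss (presented rels) (\<lambda>i j. cseries (rT i j)) g"
    have "\<exists>g'. g c = cseries g'" for c
      using g by (metis ex_cseries is_gauss_def)
    then obtain g' where g': "g = (\<lambda>c. cseries (g' c))" by metis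
    have "rT = gmat g'" using g unfolding g' is_gauss_cseries by blast
    then have "?g = g'" by (intro gmat_inj one) (simp flip: R.T_eq)
    then show "g = (\<lambda>c. cseries (?g c))" by (simp add: g')
  qed
  then show ?thesis by (simp add: gR_def)
qed

theorem mainTheorem16:
  shows "\<exists>\<Phi>. \<Phi> \<in> ring_iso YD YR
    \<and> (\<forall>c. \<Phi> (clsY (fa_scal c)) = clsR (fa_scal c))
    \<and> (\<forall>k. \<Phi> (clsY (xmY k)) = gR Em10 (Suc k))
    \<and> (\<forall>k. \<Phi> (clsY (xpY k)) = gR F0m1 (Suc k))
    \<and> (\<forall>k. \<Phi> (clsY (hY k)) = ser_mult YR (ser_inv YR (gR Km1)) (gR K0) (Suc k))
    \<and> (\<forall>r. inv_into (carrier YD) \<Phi> (gR Em10 (Suc r)) = clsY (xmY r))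
    \<and> (\<forall>r. inv_into (carrier YD) \<Phi> (gR F0m1 (Suc r)) = clsY (xpY r))
    \<and> (\<forall>n. inv_into (carrier YD) \<Phi> (gR Km1 n)
           = ser_shift YD (\<lambda>c. clsY (fa_scal c)) (- 1/2) (ser_inv YD Hser) n)"
proof -
  let ?D = "gmat (drinfeld_gauss yE yF yH)"
  have yH: "yH $ 0 = 1" by (simp add: yH_def)
  obtain \<phi> where \<phi>: "calg_hom \<phi>" "fmap \<phi> yE = R.e" "fmap \<phi> yF = R.f" "fmap \<phi> yH = R.H"
    using ex_hom_Y[OF R.drinfeld] by blast
  obtain \<psi> where \<psi>: "calg_hom \<psi>" "\<And>i j. fmap \<psi> (rT i j) = ?D i j"
    using ex_hom_R[OF drinfeld_imp_rtt[OF drinfeld_Y]] by blast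
  have fmap_comp: "fmap (\<lambda>a. g (h a)) z = fmap g (fmap h z)" "fmap (\<lambda>a. a) w = w" for g h z w
    by (simp_all add: fps_eq_iff)
  have id: "calg_hom (\<lambda>a. a)" by (simp add: calg_hom_def)
  \<comment> \<open>Applying \<open>\<phi>\<close> to the matrix built from \<open>yE\<close>,
    \<open>yF\<close>, \<open>yH\<close> gives the matrix built from the Gauss factors of
    \<open>rT\<close>, which is \<open>rT\<close> itself.\<close>
  have \<phi>\<psi>: "\<phi> (\<psi> a) = a" for a
    by (rule hom_eq_R[OF calg_hom_comp[OF \<phi>(1) \<psi>(1)] id])
      (simp add: fmap_comp \<psi>(2) fmap_gmat[OF \<phi>(1) yH] \<phi>(2-) flip: R.T_eq)
  \<comment> \<open>\<open>\<psi>\<close> respects the matrix formula, so uniqueness of the Gauss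
    decomposition yields the images of e, f and H separately.\<close>
  have "gmat (drinfeld_gauss (fmap \<psi> R.e) (fmap \<psi> R.f) (fmap \<psi> R.H)) i j = ?D i j" for i j
    using \<psi>(2)[of i j] fmap_gmat[OF \<psi>(1) R.H_0, of R.e R.f i j] by (simp flip: R.T_eq)
  then have "drinfeld_gauss (fmap \<psi> R.e) (fmap \<psi> R.f) (fmap \<psi> R.H) = drinfeld_gauss yE yF yH"
    by (intro gmat_inj ext) (simp_all add: fps_mult_nth_0 calg_hom_one[OF \<psi>(1)])
  from fun_cong[OF this, of Em10] fun_cong[OF this, of F0m1] fun_cong[OF this, of K1]
  have "fmap \<psi> R.e = yE" "fmap \<psi> R.f = yF" "fmap \<psi> R.H = yH" by simp_all
  then have \<psi>\<phi>: "\<psi> (\<phi> a) = a" for a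
    by (intro hom_eq_Y[OF calg_hom_comp[OF \<psi>(1) \<phi>(1)] id]) (simp_all add: fmap_comp \<phi>(2-))
  \<comment> \<open>Transports \<open>\<phi>\<close> to cosets; the description is unique because
    \<open>coset\<close> is injective.\<close>
  define \<Phi> where "\<Phi> X = coset (\<phi> (THE a. coset a = X))" for X
  have \<Phi>: "\<Phi> (coset a) = coset (\<phi> a)" for a
  proof -
    have "(THE b. coset b = coset a) = a" by (rule the_equality) (simp_all add: coset_inj)
    then show ?thesis by (simp add: \<Phi>_def)
  qed
  have bij: "bij_betw \<Phi> (carrier YD) (carrier YR)"
    unfolding YD_eq YR_eq carrier_eq_range_coset
  proof (rule bij_betw_imageI)
    show "inj_on \<Phi> (range coset)"
    proof (rule inj_onI, elim rangeE)
      fix X Y a b assume XY: "\<Phi> X = \<Phi> Y" "X = coset a" "Y = coset b"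
      then have "\<phi> a = \<phi> b" by (simp add: \<Phi> coset_inj)
      then have "a = b" by (metis \<psi>\<phi>)
      then show "X = Y" by (simp add: XY)
    qed
    have "coset a = \<Phi> (coset (\<psi> a))" for a by (simp add: \<Phi> \<phi>\<psi>)
    then have "coset a \<in> \<Phi> ` range coset" for a by blast
    moreover have "\<Phi> (coset a) \<in> range coset" for a by (simp add: \<Phi>)
    ultimately show "\<Phi> ` range coset = range coset" by blast
  qed
  have "\<Phi> \<in> ring_hom YD YR"
    unfolding YD_eq YR_eq
  proof (rule ring_hom_memI)
    fix X Y :: "genY fa set" assume "X \<in> carrier (presented rels)" "Y \<in> carrier (presented rels)"
    then obtain a b where [simp]: "X = coset a" "Y = coset b" by (auto simp: carrier_eq_range_coset)
    show "\<Phi> X \<in> carrier (presented rels)" by (simp add: \<Phi>)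
    show "\<Phi> (X \<otimes>\<^bsub>presented rels\<^esub> Y) = \<Phi> X \<otimes>\<^bsub>presented rels\<^esub> \<Phi> Y"
      by (simp add: \<Phi> calg_hom_mult[OF \<phi>(1)] flip: coset_mult)
    show "\<Phi> (X \<oplus>\<^bsub>presented rels\<^esub> Y) = \<Phi> X \<oplus>\<^bsub>presented rels\<^esub> \<Phi> Y"
      by (simp add: \<Phi> calg_hom_add[OF \<phi>(1)] flip: coset_add)
  qed (simp add: \<Phi> calg_hom_one[OF \<phi>(1)] flip: coset_one)
  with bij have iso: "\<Phi> \<in> ring_iso YD YR" by (simp add: ring_iso_def)
  have inv: "inv_into (carrier YD) \<Phi> (coset (\<phi> a)) = coset a" for a
    using bij inv_into_f_f[of \<Phi> "carrier YD" "coset a"]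
    by (simp add: bij_betw_def \<Phi> YD_eq)
  have nth: "\<phi> (yE $ n) = R.e $ n" "\<phi> (yF $ n) = R.f $ n" "\<phi> (yH $ n) = R.H $ n" for n
    using \<phi>(2-) by (metis fmap_nth)+
  have gen: "clsY (xmY k) = coset (yE $ Suc k)" "clsY (xpY k) = coset (yF $ Suc k)" "clsY (hY k) = coset (yH $ Suc k)" for k
    by (simp_all add: clsY_eq yE_def yF_def yH_def)
  have Hser: "Hser = cseries yH"
    by (auto simp: fun_eq_iff Hser_def cseries_def yH_def clsY_eq YD_eq coset_one)
  have k: "\<phi> (shift (- 1/2) (finv yH) $ n) = finv (shift (- 1/2) R.H) $ n" for n
  proof -
    have "fmap \<phi> (finv (shift (- 1/2) yH)) = finv (shift (- 1/2) R.H)"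
      using finv_fmap[OF \<phi>(1), of "shift (- 1/2) yH"] by (simp add: yH \<phi>(4) flip: shift_fmap[OF \<phi>(1)])
    then show ?thesis by (simp add: finv_shift yH flip: fmap_nth[of \<phi>])
  qed
  show ?thesis
  proof (intro exI[of _ \<Phi>] conjI allI iso)
    show "\<Phi> (clsY (fa_scal c)) = clsR (fa_scal c)" for c
      by (simp add: clsY_eq clsR_eq \<Phi> calg_hom_sc[OF calg_hom_pcls] calg_hom_sc[OF \<phi>(1)] flip: sc_eq_fa_scal)
    show "\<Phi> (clsY (xmY k)) = gR Em10 (Suc k)" "\<Phi> (clsY (xpY k)) = gR F0m1 (Suc k)" for k
      by (simp_all add: gen \<Phi> nth gR_eq cseries_def)
    show "\<Phi> (clsY (hY k)) = ser_mult YR (ser_inv YR (gR Km1)) (gR K0) (Suc k)" for k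
    proof -
      let ?k = "finv (shift (- 1/2) R.H)"
      have "ser_mult YR (ser_inv YR (gR Km1)) (gR K0) = cseries (finv ?k * (?k * R.H))"
        unfolding gR_eq YR_eq drinfeld_gauss.simps by (simp add: ser_inv_cseries ser_mult_cseries)
      also have "finv ?k * (?k * R.H) = R.H" by (simp add: finv_left flip: mult.assoc)
      finally show ?thesis by (simp add: gen \<Phi> nth cseries_def)
    qed
    show "inv_into (carrier YD) \<Phi> (gR Em10 (Suc r)) = clsY (xmY r)"
      "inv_into (carrier YD) \<Phi> (gR F0m1 (Suc r)) = clsY (xpY r)" for r
      by (simp_all add: gR_eq cseries_def gen inv flip: nth)
    have "ser_shift YD (\<lambda>c. clsY (fa_scal c)) (- 1/2) (ser_inv YD Hser) = cseries (shift (- 1/2) (finv yH))"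
      using ser_shift_cseries[of "- 1/2" "finv yH"] ser_inv_cseries[OF yH]
      by (simp add: YD_eq Hser clsY_def rels_genY_def)
    then show "inv_into (carrier YD) \<Phi> (gR Km1 n)
           = ser_shift YD (\<lambda>c. clsY (fa_scal c)) (- 1/2) (ser_inv YD Hser) n" for n
      unfolding gR_eq cseries_def drinfeld_gauss.simps k[symmetric] inv by simp
  qed
qed

end
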